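(* Let $\mathcal{P}=\{P_n\}_{n\ge0}$ be an HG-family given by a pair $(R,f)$, and suppose $(R,f)$ is as in one of the cases (a), (b), (c) of the list below: (a) $\deg R\le 2$ and there are polynomials $q,v\in\mathbb{C}[t]$ of degree $\le1$ with $f(u,s)=\dfrac{(s-u)q(s+u)}{s\,q(s)[R(s+1)-R(0)]+(s+1)v(s)}$; (b) $R$ is constant and for some $c,\lambda\in\mathbb{C}$, $f(u,s)=\lambda(s-u)(s-u+1-c)\dfrac{(s+u+1)(s+u+c)}{(s+1/2)(s+1)}$; (c) $R$ is constant and for some $c,\lambda\in\mathbb{C}$, $f(u,s)=\lambda(s-u)(s-u+1-c)\dfrac{(s+u+2)(s+u+c+1)}{(s+1)(s+3/2)}$. Let $f_1,f_2$, $\{\alpha_n\}_{n\ge0}$, $\{\beta_n\}_{n\ge0}$ be defined from $(R,f)$ as in the context. Then: (i) The family $\mathcal{P}$ is well-defined and quasi-orthogonal if and only if for all integers $n\ge0$ the values $f_1(n)$ and $f_2(n)$ are finite and in addition $\beta_n\ne0$. (ii) The family $\mathcal{P}$ is well-defined and orthogonal if and only if for all integers $n\ge0$ the values $f_1(n)$ and $f_2(n)$ are finite and in addition $\alpha_n,\beta_n\in\mathbb{R}$ and $\beta_n>0$. (iii) Two choices of $(R,f)$ in the list (a)–(c) lead to the same family $\mathcal{P}$ if and only if they yield the same values of $\alpha_n,\beta_n$ for all $n\ge0$.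
   Context: A family of polynomials is a sequence $\mathcal{P}=(P_0,P_1,\dots)$ where $P_n\in\mathbb{C}[z]$ is monic of degree $n$. For $R\in\mathbb{C}[s]$ the Newtonian basis given by $R$ is the sequence $\{\Phi_k\}$ with $\Phi_{-1}=0$, $\Phi_0=1$, $\Phi_{k+1}=z\Phi_k+R(k)\Phi_k$ for $k\ge 0$. Write $P_n=\sum_{k=0}^n c(n,k)\Phi_k$; thus $c(n,n)=1$ for $n\ge 0$, and set $c(n,k)=0$ unless $n\ge k\ge 0$. $\mathcal{P}$ is an HG-family given by the pair $(R,f)$ if there are relatively prime polynomials $N\in\mathbb{C}[u,s]$ and $D\in\mathbb{C}[s]$ with $f=N/D$ such that, with respect to the Newtonian basis given by $R$, $D(k)c(n,k+1)=N(n,k)c(n,k)$ for all $n,k\in\mathbb{Z}$. Not every pair in the list defines a family; "$\mathcal{P}$ is well-defined" means that the pair $(R,f)$ does define a family in this way. A family is quasi-orthogonal if there is a linear functional $M:\mathbb{C}[z]\to\mathbb{C}$ with $M(P_iP_j)=0$ for $i\neq j$ and $M(P_i^2)\ne0$ for all $i$. A quasi-orthogonal family is orthogonal if all $P_i$ have real coefficients and such an $M$ exists with all $M(P_i^2)$ real and strictly positive. Definitions: $f_1(u):=f(u+1,u)^{-1}$, $f_2(u):=f(u+2,u)^{-1}f_1(u+1)$, $$\alpha(u)=f_1(u-1)-f_1(u)-R(u),\quad \beta(u)=f_2(u-1)-f_2(u)-f_1(u)(\alpha(u+1)+R(u)),$$ $\alpha_n=\alpha(n)$ and $\beta_n=\beta(n)$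 for $n>0$, $\alpha_0=\alpha(0)-f_1(-1)$ and $\beta_0=\beta(0)-f_2(-1)$, where the last two formulas are understood after cancelling $f_1(-1)$, respectively $f_2(-1)$, i.e. $\alpha_0=-f_1(0)-R(0)$ and $\beta_0=-f_2(0)-f_1(0)(\alpha(1)+R(0))$. Finiteness of $f_i(n)$ means that the rational function $f_i$ is defined (the function being inverted is not identically zero) and has no pole at $n$. *)

theory Defs
  imports
    "HOL-Computational_Algebra.Computational_Algebra"
    "HOL-Computational_Algebra.Field_as_Ring"
begin

section \<open>Families of polynomials and orthogonality\<close>

definition poly_family :: "(nat \<Rightarrow> complex poly) \<Rightarrow> bool" where
  "poly_family P \<longleftrightarrow> (\<forall>n. degree (P n) = n \<and> lead_coeff (P n) = 1)"

definition linear_functional :: "(complex poly \<Rightarrow> complex) \<Rightarrow> bool" where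
  "linear_functional M \<longleftrightarrow> Vector_Spaces.linear smult (*) M"

definition quasi_orthogonal :: "(nat \<Rightarrow> complex poly) \<Rightarrow> bool" where
  "quasi_orthogonal P \<longleftrightarrow> poly_family P \<and>
     (\<exists>M. linear_functional M \<and>
          (\<forall>i j. i \<noteq> j \<longrightarrow> M (P i * P j) = 0) \<and>
          (\<forall>i. M (P i * P i) \<noteq> 0))"

definition orthogonal_family :: "(nat \<Rightarrow> complex poly) \<Rightarrow> bool" where
  "orthogonal_family P \<longleftrightarrow> quasi_orthogonal P \<and> (\<forall>i k. coeff (P i) k \<in> \<real>) \<and>
     (\<exists>M. linear_functional M \<and>
          (\<forall>i j. i \<noteq> j \<longrightarrow> M (P i * P j) = 0) \<and>
          (\<forall>i. M (P i * P i) \<in> \<real> \<and> Re (M (P i * P i)) > 0))"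


section \<open>Rational functions\<close>

text \<open>
  Polynomials in \<open>\<complex>[u,s]\<close> are represented by the type \<^typ>\<open>complex poly poly\<close>: the outer
  variable is \<open>u\<close> and the coefficients are polynomials in \<open>s\<close>.

  Every rational function \<open>f = N/D\<close> considered below has \<open>N \<in> \<complex>[u,s]\<close> and \<open>D \<in> \<complex>[s]\<close>, so
  it lives in the subring \<open>\<complex>(s)[u]\<close> of \<open>\<complex>(u,s)\<close>. Such an \<open>f\<close> is represented by the type
  \<^typ>\<open>complex poly fract poly\<close>.
\<close>

definition var_u :: "complex poly poly" where "var_u = [:0, 1:]"
definition var_s :: "complex poly poly" where "var_s = [:[:0, 1:]:]"
definition const_us :: "complex \<Rightarrow> complex poly poly" where "const_us c = [:[:c:]:]"

definition subst_us :: "complex poly \<Rightarrow> complex poly poly \<Rightarrow> complex poly poly" where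
  "subst_us q x = poly (map_poly const_us q) x"

definition eval_us :: "complex poly poly \<Rightarrow> complex \<Rightarrow> complex \<Rightarrow> complex" where
  "eval_us N a b = poly (poly N [:a:]) b"

definition quot_us :: "complex poly poly \<Rightarrow> complex poly \<Rightarrow> complex poly fract poly" where
  "quot_us N D = smult (inverse (to_fract D)) (fract_poly N)"

text \<open>
  Univariate rational functions are elements of \<^typ>\<open>complex poly fract\<close>; \<^const>\<open>quot_of_fract\<close>
  yields numerator and denominator in lowest terms, so cancellation is taken into account.
  The value \<open>rat_val g z\<close> is meaningful only if \<open>no_pole g z\<close>.
\<close>

definition no_pole :: "complex poly fract \<Rightarrow> complex \<Rightarrow> bool" where
  "no_pole g z \<longleftrightarrow> poly (snd (quot_of_fract g)) z \<noteq> 0"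

definition rat_val :: "complex poly fract \<Rightarrow> complex \<Rightarrow> complex" where
  "rat_val g z = poly (fst (quot_of_fract g)) z / poly (snd (quot_of_fract g)) z"

text \<open>The rational function \<open>g(u + a)\<close>.\<close>

definition rat_shift :: "complex \<Rightarrow> complex poly fract \<Rightarrow> complex poly fract" where
  "rat_shift a g =
     Fract (fst (quot_of_fract g) \<circ>\<^sub>p [:a, 1:]) (snd (quot_of_fract g) \<circ>\<^sub>p [:a, 1:])"

text \<open>
  The rational function \<open>f(u + j, u)\<close> of \<open>u\<close>: rename the variable \<open>s\<close> of the coefficient field
  \<open>\<complex>(s)\<close> to \<open>u\<close> and evaluate \<open>f \<in> \<complex>(s)[u]\<close> at \<open>u + j\<close>.
\<close>

definition diag_shift :: "nat \<Rightarrow> complex poly fract poly \<Rightarrow> complex poly fract" where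
  "diag_shift j f = poly f (to_fract [:of_nat j, 1:])"


section \<open>HG-families\<close>

text \<open>The convention \<open>\<Phi>\<^sub>-\<^sub>1 = 0\<close> is not needed here, as only \<open>\<Phi>\<^sub>k\<close> with \<open>k \<ge> 0\<close> is used.\<close>

fun newton_basis :: "complex poly \<Rightarrow> nat \<Rightarrow> complex poly" where
  "newton_basis R 0 = 1"
| "newton_basis R (Suc k) =
     [:0, 1:] * newton_basis R k + smult (poly R (of_nat k)) (newton_basis R k)"

definition newton_coeffs ::
    "complex poly \<Rightarrow> (nat \<Rightarrow> complex poly) \<Rightarrow> (int \<Rightarrow> int \<Rightarrow> complex) \<Rightarrow> bool" where
  "newton_coeffs R P c \<longleftrightarrow>
     (\<forall>n. P n = (\<Sum>k\<le>n. smult (c (int n) (int k)) (newton_basis R k))) \<and>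
     (\<forall>n k. \<not> (0 \<le> k \<and> k \<le> n) \<longrightarrow> c n k = 0)"

definition HG_family ::
    "complex poly \<Rightarrow> complex poly fract poly \<Rightarrow> (nat \<Rightarrow> complex poly) \<Rightarrow> bool" where
  "HG_family R f P \<longleftrightarrow> poly_family P \<and>
     (\<exists>N D c. coprime N [:D:] \<and> D \<noteq> 0 \<and> f = quot_us N D \<and> newton_coeffs R P c \<and>
        (\<forall>n k. poly D (of_int k) * c n (k + 1) = eval_us N (of_int n) (of_int k) * c n k))"

definition HG_well_defined :: "complex poly \<Rightarrow> complex poly fract poly \<Rightarrow> bool" where
  "HG_well_defined R f \<longleftrightarrow> (\<exists>P. HG_family R f P)"


section \<open>The list of pairs\<close>

definition den_a :: "complex poly \<Rightarrow> complex poly \<Rightarrow> complex poly \<Rightarrow> complex poly" where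
  "den_a R q v = [:0, 1:] * q * (R \<circ>\<^sub>p [:1, 1:] - [:poly R 0:]) + [:1, 1:] * v"

definition case_a :: "complex poly \<Rightarrow> complex poly fract poly \<Rightarrow> bool" where
  "case_a R f \<longleftrightarrow> degree R \<le> 2 \<and>
     (\<exists>q v. degree q \<le> 1 \<and> degree v \<le> 1 \<and> den_a R q v \<noteq> 0 \<and>
        f = quot_us ((var_s - var_u) * subst_us q (var_s + var_u)) (den_a R q v))"

definition case_b :: "complex poly \<Rightarrow> complex poly fract poly \<Rightarrow> bool" where
  "case_b R f \<longleftrightarrow> degree R = 0 \<and>
     (\<exists>c l. f = quot_us
        (const_us l * (var_s - var_u) * (var_s - var_u + 1 - const_us c)
           * ((var_s + var_u + 1) * (var_s + var_u + const_us c)))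
        ([:1/2, 1:] * [:1, 1:]))"

definition case_c :: "complex poly \<Rightarrow> complex poly fract poly \<Rightarrow> bool" where
  "case_c R f \<longleftrightarrow> degree R = 0 \<and>
     (\<exists>c l. f = quot_us
        (const_us l * (var_s - var_u) * (var_s - var_u + 1 - const_us c)
           * ((var_s + var_u + 2) * (var_s + var_u + const_us c + 1)))
        ([:1, 1:] * [:3/2, 1:]))"

definition listed :: "complex poly \<Rightarrow> complex poly fract poly \<Rightarrow> bool" where
  "listed R f \<longleftrightarrow> case_a R f \<or> case_b R f \<or> case_c R f"


section \<open>The recurrence coefficients\<close>

definition hg_f1 :: "complex poly fract poly \<Rightarrow> complex poly fract" where
  "hg_f1 f = inverse (diag_shift 1 f)"

definition hg_f2 :: "complex poly fract poly \<Rightarrow> complex poly fract" where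
  "hg_f2 f = inverse (diag_shift 2 f) * rat_shift 1 (hg_f1 f)"

text \<open>
  As \<open>inverse 0 = 0\<close> in \<^typ>\<open>complex poly fract\<close>, the requirement that the inverted functions
  do not vanish identically is stated separately.
\<close>

definition f1_finite :: "complex poly fract poly \<Rightarrow> nat \<Rightarrow> bool" where
  "f1_finite f n \<longleftrightarrow> diag_shift 1 f \<noteq> 0 \<and> no_pole (hg_f1 f) (of_nat n)"

definition f2_finite :: "complex poly fract poly \<Rightarrow> nat \<Rightarrow> bool" where
  "f2_finite f n \<longleftrightarrow>
     diag_shift 1 f \<noteq> 0 \<and> diag_shift 2 f \<noteq> 0 \<and> no_pole (hg_f2 f) (of_nat n)"

definition alpha_fun :: "complex poly \<Rightarrow> complex poly fract poly \<Rightarrow> complex poly fract" where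
  "alpha_fun R f = rat_shift (-1) (hg_f1 f) - hg_f1 f - to_fract R"

definition beta_fun :: "complex poly \<Rightarrow> complex poly fract poly \<Rightarrow> complex poly fract" where
  "beta_fun R f = rat_shift (-1) (hg_f2 f) - hg_f2 f
     - hg_f1 f * (rat_shift 1 (alpha_fun R f) + to_fract R)"

text \<open>
  At \<open>n = 0\<close> the terms \<open>f\<^sub>1(-1)\<close> and \<open>f\<^sub>2(-1)\<close>, which need not be finite, have been cancelled
  from \<open>\<alpha>(0) - f\<^sub>1(-1)\<close> and \<open>\<beta>(0) - f\<^sub>2(-1)\<close>.
\<close>

definition alpha :: "complex poly \<Rightarrow> complex poly fract poly \<Rightarrow> nat \<Rightarrow> complex" where
  "alpha R f n =
     (if n = 0 then - rat_val (hg_f1 f) 0 - poly R 0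
      else rat_val (alpha_fun R f) (of_nat n))"

definition beta :: "complex poly \<Rightarrow> complex poly fract poly \<Rightarrow> nat \<Rightarrow> complex" where
  "beta R f n =
     (if n = 0
      then - rat_val (hg_f2 f) 0
           - rat_val (hg_f1 f) 0 * (rat_val (alpha_fun R f) 1 + poly R 0)
      else rat_val (beta_fun R f) (of_nat n))"

end

theory Submission
  imports Defs
begin

text \<open>In all three cases the numerator factors as \<open>N(u,s) = A(s-u) B(s+u)\<close> with univariate \<open>A\<close> and
  \<open>B\<close>, where \<open>A(0) = 0\<close>, and \<open>D(-1) = 0\<close>. This makes the coefficients accessible: \<open>c(n,n-i)\<close> is the
  value at \<open>n\<close> of the rational function \<open>F\<^sub>i(u) = \<Prod>\<^sub>j D(u-j) / (A(-j) B(2u-j))\<close>,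
  \<open>1 \<le> j \<le> i\<close>, and the quotient \<open>c(n+1,k) / c(n,k)\<close> telescopes to a simple rational function
  (\<open>F_contiguous\<close>). Dividing the desired recurrence for the coefficients of
  \<open>z P\<^sub>n = P\<^sub>n\<^sub>+\<^sub>1 + \<alpha>\<^sub>n P\<^sub>n + \<beta>\<^sub>n\<^sub>-\<^sub>1 P\<^sub>n\<^sub>-\<^sub>1\<close> by \<open>c(n-1,k)\<close> leaves a single condition: a certain
  polynomial in \<open>k\<close>, called the kernel polynomial below, must be a constant multiple of
  \<open>A(k-n-1) A(k-n)\<close>. In case (a) the kernel polynomial has degree at most 2 in \<open>k\<close>, since the
  coefficient of \<open>R(k)\<close> in it collapses to \<open>n q(n)\<close>, and the choice of \<open>\<alpha>\<close> gives it the zeros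
  \<open>n\<close> and \<open>n+1\<close>. Cases (b) and (c) are one family with a parameter \<open>e \<in> {0,1}\<close>, for which the
  condition is an explicit polynomial identity.

  If no \<open>A(-i)\<close> and no \<open>B(i)\<close> with \<open>i \<ge> 1\<close> vanishes, the family is unique and obeys the recurrence,
  so (i) and (ii) are Favard's theorem. In case (a) with \<open>q \<noteq> 0\<close> the other possibility is
  \<open>q(m) = 0\<close> for some integer \<open>m \<ge> 1\<close>. Then \<open>\<beta>(m) = 0\<close>, because \<open>q(u)\<close> is a factor of the numerator of \<open>\<beta>(u)\<close>; and a family can only
  exist if \<open>D(a) = 0\<close> for some \<open>0 \<le> a < m\<close>, which forces \<open>P\<^sub>n(-R(0)) = 0\<close> for all \<open>n > m\<close>, impossible for a
  quasi-orthogonal family. So both sides of (i) and of (ii) fail. In cases (b) and (c) the values of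
  \<open>D\<close> at the integers \<open>k \<ge> 0\<close> do not vanish, and a zero among the \<open>A(-i)\<close> and \<open>B(i)\<close> destroys both
  well-definedness and finiteness.

  In (iii) a pair with \<open>q(m) = 0\<close> may define several families. One of them has the coefficients
  \<open>c(n,k) = lim F\<^sub>n\<^sub>-\<^sub>k(u)\<close> as \<open>u\<close> tends to \<open>n\<close>, and it obeys the recurrence (\<open>canonical_family\<close>);
  hence equal \<open>\<alpha>\<^sub>n\<close> and \<open>\<beta>\<^sub>n\<close> give a common family. Conversely, all families of a pair agree for large
  \<open>n\<close>, so a common family determines the rational functions \<open>\<alpha>(u)\<close> and \<open>\<beta>(u)\<close>. This settles all
  indices except \<open>n = 0\<close>, where the terms \<open>f\<^sub>1(-1)\<close> and \<open>f\<^sub>2(-1)\<close> have been removed by hand. They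
  vanish for a pair with \<open>q(m) = 0\<close>; if one of them does not vanish for the other pair, then either
  \<open>\<beta>\<close> has no zero at a positive integer, contradicting \<open>\<beta>(m) = 0\<close>, or \<open>\<beta>\<close> has two distinct
  reflection symmetries, hence is periodic, and its zero at \<open>m\<close> recurs infinitely often
  (\<open>no_two_symmetric_forms\<close>).\<close>

section \<open>Values and limits of rational functions\<close>

text \<open>The reduced denominator cannot vanish at \<open>z\<close>: the reduced numerator would vanish
  there as well, against coprimality.\<close>

lemma Fract_value:
  fixes p q :: "complex poly"
  assumes "poly q z \<noteq> 0"
  shows no_pole_Fract: "no_pole (Fract p q) z"
    and rat_val_Fract: "rat_val (Fract p q) z = poly p z / poly q z"
proof -
  define a where "a = fst (quot_of_fract (Fract p q))"
  define b where "b = snd (quot_of_fract (Fract p q))"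
  have nz: "b \<noteq> 0" "q \<noteq> 0" using assms by (auto simp: b_def)
  have "Fract a b = Fract p q" by (simp add: a_def b_def)
  hence eq: "a * q = p * b" using nz by (simp add: eq_fract)
  have cop: "coprime a b" unfolding a_def b_def by (rule coprime_quot_of_fract)
  have eqz: "poly a z * poly q z = poly p z * poly b z"
    using arg_cong[OF eq, of "\<lambda>x. poly x z"] by simp
  have bz: "poly b z \<noteq> 0"
  proof
    assume "poly b z = 0"
    moreover from this have "poly a z = 0" using eqz assms by simp
    ultimately have "[:-z, 1:] dvd a" "[:-z, 1:] dvd b" by (simp_all add: poly_eq_0_iff_dvd)
    hence "is_unit [:-z, 1:]" using cop by (meson coprime_common_divisor)
    thus False by (auto simp: is_unit_poly_iff)
  qed
  show "no_pole (Fract p q) z" using bz by (simp add: no_pole_def b_def)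
  show "rat_val (Fract p q) z = poly p z / poly q z"
    using bz eqz assms by (simp add: rat_val_def a_def b_def field_simps)
qed

lemma rat_val_to_fract [simp]: "rat_val (to_fract p) z = poly p z"
  using rat_val_Fract[of 1 z p] by (simp add: to_fract_def)

lemma no_pole_to_fract [simp]: "no_pole (to_fract p) z"
  using no_pole_Fract[of 1 z p] by (simp add: to_fract_def)

lemma rat_fun_cases:
  fixes g :: "complex poly fract"
  assumes "no_pole g z"
  obtains a b where "g = Fract a b" "b \<noteq> 0" "poly b z \<noteq> 0" "rat_val g z = poly a z / poly b z"
  using assms that[of "fst (quot_of_fract g)" "snd (quot_of_fract g)"]
  by (simp add: no_pole_def rat_val_def)

lemma rat_val_arith:
  fixes g h :: "complex poly fract"
  assumes "no_pole g z" "no_pole h z"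
  shows rat_val_diff: "rat_val (g - h) z = rat_val g z - rat_val h z"
    and rat_val_add: "rat_val (g + h) z = rat_val g z + rat_val h z"
    and rat_val_mult: "rat_val (g * h) z = rat_val g z * rat_val h z"
    and no_pole_diff: "no_pole (g - h) z"
    and no_pole_add: "no_pole (g + h) z"
    and no_pole_mult: "no_pole (g * h) z"
proof -
  obtain a b where g: "g = Fract a b" "b \<noteq> 0" "poly b z \<noteq> 0" "rat_val g z = poly a z / poly b z"
    by (rule rat_fun_cases[OF assms(1)])
  obtain c d where h: "h = Fract c d" "d \<noteq> 0" "poly d z \<noteq> 0" "rat_val h z = poly c z / poly d z"
    by (rule rat_fun_cases[OF assms(2)])
  have bd: "poly (b * d) z \<noteq> 0" using g(3) h(3) by simp
  have e: "g - h = Fract (a * d - c * b) (b * d)" "g + h = Fract (a * d + c * b) (b * d)"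
      "g * h = Fract (a * c) (b * d)"
    unfolding g(1) h(1) diff_fract[OF g(2) h(2)] add_fract[OF g(2) h(2)] mult_fract by (rule refl)+
  show "rat_val (g - h) z = rat_val g z - rat_val h z"
    by (simp only: e(1) rat_val_Fract[OF bd] g(4) h(4) poly_mult poly_diff diff_frac_eq[OF g(3) h(3)])
  show "rat_val (g + h) z = rat_val g z + rat_val h z"
    by (simp only: e(2) rat_val_Fract[OF bd] g(4) h(4) poly_mult poly_add add_frac_eq[OF g(3) h(3)])
  show "rat_val (g * h) z = rat_val g z * rat_val h z"
    by (simp only: e(3) rat_val_Fract[OF bd] g(4) h(4) poly_mult times_divide_times_eq)
  show "no_pole (g - h) z" "no_pole (g + h) z" "no_pole (g * h) z"
    by (simp_all only: e no_pole_Fract[OF bd])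
qed

lemma rat_shift_value:
  assumes "no_pole g (z + a)"
  shows no_pole_shift: "no_pole (rat_shift a g) z"
    and rat_val_shift: "rat_val (rat_shift a g) z = rat_val g (z + a)"
proof -
  have "poly (snd (quot_of_fract g) \<circ>\<^sub>p [:a, 1:]) z \<noteq> 0"
    using assms by (simp add: no_pole_def poly_pcompose add.commute)
  from no_pole_Fract[OF this] rat_val_Fract[OF this]
  show "no_pole (rat_shift a g) z" "rat_val (rat_shift a g) z = rat_val g (z + a)"
    by (simp_all add: rat_shift_def poly_pcompose rat_val_def add.commute)
qed

lemma eventually_poly_nonzero:
  fixes p :: "complex poly"
  assumes "p \<noteq> 0"
  shows "\<forall>\<^sub>F z in at w. poly p z \<noteq> 0"
proof -
  have "finite {z. poly p z = 0}" using assms by (rule poly_roots_finite)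
  hence "finite ({z. poly p z = 0} - {w})" by simp
  hence "open (- ({z. poly p z = 0} - {w}))"
    by (intro open_Compl finite_imp_closed)
  thus ?thesis unfolding eventually_at_topological
    by (intro exI[of _ "- ({z. poly p z = 0} - {w})"]) auto
qed

lemma tendsto_rat_val:
  assumes "no_pole g w"
  shows "(rat_val g \<longlongrightarrow> rat_val g w) (at w)"
  using assms unfolding rat_val_def[abs_def] no_pole_def by (intro tendsto_intros) auto

text \<open>A pole makes the function unbounded, since numerator and denominator in lowest terms
  have no common zero. Hence a finite limit certifies that a value is finite.\<close>

lemma rat_val_limit:
  assumes "(rat_val g \<longlongrightarrow> l) (at w)"
  shows no_pole_if_limit: "no_pole g w" and rat_val_eq_limit: "rat_val g w = l"
proof -
  define a where "a = fst (quot_of_fract g)"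
  define b where "b = snd (quot_of_fract g)"
  have rv: "rat_val g = (\<lambda>z. poly a z / poly b z)"
    by (simp add: rat_val_def[abs_def] a_def b_def)
  have cop: "coprime a b" unfolding a_def b_def by (rule coprime_quot_of_fract)
  have b0: "b \<noteq> 0" by (simp add: b_def)
  have "((\<lambda>z. rat_val g z * poly b z) \<longlongrightarrow> l * poly b w) (at w)"
    by (intro tendsto_intros assms)
  moreover have "\<forall>\<^sub>F z in at w. rat_val g z * poly b z = poly a z"
    using eventually_poly_nonzero[OF b0, of w] by eventually_elim (simp add: rv)
  ultimately have "(poly a \<longlongrightarrow> l * poly b w) (at w)"
    using Lim_transform_eventually by blast
  moreover have "(poly a \<longlongrightarrow> poly a w) (at w)" by (intro tendsto_intros)
  ultimately have aw: "poly a w = l * poly b w"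
    using LIM_unique by blast
  have "poly b w \<noteq> 0"
  proof
    assume "poly b w = 0"
    with aw have "[:-w, 1:] dvd a" "[:-w, 1:] dvd b" by (simp_all add: poly_eq_0_iff_dvd)
    hence "is_unit [:-w, 1:]" using cop by (meson coprime_common_divisor)
    thus False by (auto simp: is_unit_poly_iff)
  qed
  thus "no_pole g w" by (simp add: no_pole_def b_def)
  with tendsto_rat_val[of g w] assms show "rat_val g w = l"
    using LIM_unique by blast
qed

lemma tendsto_shift:
  fixes g :: "complex \<Rightarrow> complex"
  assumes "(g \<longlongrightarrow> l) (at (w + c))"
  shows "((\<lambda>z. g (z + c)) \<longlongrightarrow> l) (at w)"
  using LIM_offset[OF assms, of c] by simp

lemma removable:
  fixes p :: "complex poly"
  assumes "poly p w = 0" "c \<noteq> 0"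
  shows "\<exists>l. ((\<lambda>u. poly p u / (c * (u - w))) \<longlongrightarrow> l) (at w)"
proof -
  obtain p' where p: "p = [:-w, 1:] * p'" using assms by (auto simp: poly_eq_0_iff_dvd elim: dvdE)
  have "((\<lambda>u. poly p' u / c) \<longlongrightarrow> poly p' w / c) (at w)" using assms by (intro tendsto_intros)
  moreover have "\<forall>\<^sub>F u in at w. poly p' u / c = poly p u / (c * (u - w))"
    using eventually_neq_at_within[of w w UNIV] 
  proof eventually_elim
    case (elim u)
    have "poly p u = poly p' u * (u - w)" by (simp add: p algebra_simps)
    thus ?case using elim by simp
  qed
  ultimately have "((\<lambda>u. poly p u / (c * (u - w))) \<longlongrightarrow> poly p' w / c) (at w)"
    by (rule Lim_transform_eventually)
  thus ?thesis by blast
qed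

lemma rat_fun_eqI:
  assumes "infinite {z. rat_val g z = rat_val h z}"
  shows "g = h"
proof -
  define a b where "a = fst (quot_of_fract g)" and "b = snd (quot_of_fract g)"
  define c d where "c = fst (quot_of_fract h)" and "d = snd (quot_of_fract h)"
  have nz: "b \<noteq> 0" "d \<noteq> 0" by (simp_all add: b_def d_def)
  have "{z. rat_val g z = rat_val h z} \<subseteq>
      {z. poly (a * d - c * b) z = 0} \<union> {z. poly b z = 0} \<union> {z. poly d z = 0}"
    by (auto simp: rat_val_def a_def b_def c_def d_def field_simps)
  moreover have "finite {z. poly b z = 0}" "finite {z. poly d z = 0}"
    using nz poly_roots_finite by blast+
  ultimately have "infinite {z. poly (a * d - c * b) z = 0}"
    using assms by (meson finite_Un finite_subset)
  hence "a * d - c * b = 0" using poly_roots_finite by blast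
  hence "Fract a b = Fract c d" using nz by (simp add: eq_fract)
  thus ?thesis by (simp add: a_def b_def c_def d_def)
qed

lemma poly_fract_poly: "poly (fract_poly p) (to_fract x) = to_fract (poly p x)"
  by (induction p) (simp_all add: map_poly_pCons)

lemma diag_shift_quot:
  assumes "D \<noteq> 0"
  shows "diag_shift j (quot_us N D) = Fract (poly N [:of_nat j, 1:]) D"
  using assms unfolding diag_shift_def quot_us_def poly_smult poly_fract_poly
  by (simp add: to_fract_def)

section \<open>Three-term recurrences and orthogonality\<close>

text \<open>The coefficients are indexed so that \<open>b n\<close> couples \<open>P (n + 2)\<close> with
  \<open>P n\<close>; with this convention the sequences \<open>\<alpha>\<^sub>n\<close>,
  \<open>\<beta>\<^sub>n\<close> of a pair fit without a shift.\<close>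

definition three_term ::
    "(nat \<Rightarrow> complex) \<Rightarrow> (nat \<Rightarrow> complex) \<Rightarrow> (nat \<Rightarrow> complex poly) \<Rightarrow> bool" where
  "three_term a b P \<longleftrightarrow> P 0 = 1 \<and> P 1 = [:- a 0, 1:] \<and>
     (\<forall>n. P (n + 2) = [:- a (n + 1), 1:] * P (n + 1) - smult (b n) (P n))"

lemma three_term_unique:
  assumes P: "three_term a b P" and Q: "three_term a b Q"
  shows "P = Q"
proof -
  have "P n = Q n \<and> P (Suc n) = Q (Suc n)" for n
  proof (induction n)
    case 0
    show ?case using P Q by (simp add: three_term_def)
  next
    case (Suc n)
    have "P (n + 2) = [:- a (n + 1), 1:] * P (n + 1) - smult (b n) (P n)"
      "Q (n + 2) = [:- a (n + 1), 1:] * Q (n + 1) - smult (b n) (Q n)"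
      using P Q by (simp_all add: three_term_def)
    with Suc show ?case by simp
  qed
  thus ?thesis by auto
qed

lemma poly_family_degree: "poly_family P \<Longrightarrow> degree (P n) = n"
  and poly_family_lead: "poly_family P \<Longrightarrow> coeff (P n) n = 1"
  and poly_family_nonzero: "poly_family P \<Longrightarrow> P n \<noteq> 0"
  unfolding poly_family_def by (metis, metis, metis zero_neq_one leading_coeff_0_iff)

lemma recurrence_step_unique:
  assumes P: "poly_family P"
    and eq: "[:- x, 1:] * P (n + 1) - smult y (P n) = [:- x', 1:] * P (n + 1) - smult y' (P n)"
  shows "x = x'" "y = y'"
proof -
  have eq': "smult (x' - x) (P (n + 1)) = smult (y - y') (P n)"
    using eq by (simp add: algebra_simps smult_diff_left)
  from arg_cong[OF this, of "\<lambda>p. coeff p (n + 1)"]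
  show x: "x = x'" using poly_family_degree[OF P, of n] poly_family_lead[OF P, of "n + 1"]
    by (simp add: coeff_eq_0)
  from eq' show "y = y'" using poly_family_nonzero[OF P, of n] unfolding x by simp
qed

lemma three_term_coeffs_unique:
  assumes fam: "poly_family P" and P: "three_term a b P" "three_term a' b' P"
  shows "a n = a' n" "b n = b' n"
proof -
  have s: "[:- a (k + 1), 1:] * P (k + 1) - smult (b k) (P k) =
      [:- a' (k + 1), 1:] * P (k + 1) - smult (b' k) (P k)" for k
    using P by (metis three_term_def)
  note u = recurrence_step_unique[OF fam s]
  show "b n = b' n" by (rule u)
  show "a n = a' n"
  proof (cases n)
    case 0
    thus ?thesis using P by (simp add: three_term_def)
  next
    case (Suc k)
    thus ?thesis using u(1)[of k] by simp
  qed
qed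

lemma three_term_family:
  assumes "three_term a b P"
  shows "poly_family P"
proof -
  have "degree (P n) = n \<and> coeff (P n) n = 1 \<and> degree (P (Suc n)) = Suc n \<and> coeff (P (Suc n)) (Suc n) = 1" for n
  proof (induction n)
    case 0
    show ?case using assms by (simp add: three_term_def)
  next
    case (Suc n)
    let ?q = "[:- a (n + 1), 1:] * P (n + 1)"
    have e: "P (n + 2) = ?q - smult (b n) (P n)"
      using assms by (simp add: three_term_def)
    have nz: "P (n + 1) \<noteq> 0" using Suc by auto
    have dq: "degree ?q = n + 2" using degree_mult_eq[OF _ nz, of "[:- a (n + 1), 1:]"] Suc by simp
    have lq: "coeff ?q (n + 2) = 1"
      using lead_coeff_mult[of "[:- a (n + 1), 1:]" "P (n + 1)"] Suc dq by simp
    have c: "coeff (P (n + 2)) (n + 2) = 1"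
      unfolding e coeff_diff lq using Suc by (simp add: coeff_eq_0)
    have "degree (P (n + 2)) \<le> n + 2" unfolding e
      by (rule degree_diff_le) (use dq Suc in auto)
    moreover have "n + 2 \<le> degree (P (n + 2))" by (rule le_degree) (simp only: c, simp)
    ultimately show ?case using Suc c by simp
  qed
  thus ?thesis by (auto simp: poly_family_def)
qed

lemma linear_functionalD:
  assumes "linear_functional M"
  shows M_add: "M (p + q) = M p + M q" and M_smult: "M (smult c p) = c * M p"
    and M_zero: "M 0 = 0" and M_diff: "M (p - q) = M p - M q"
proof -
  interpret Vector_Spaces.linear smult "(*)" M
    using assms by (simp add: linear_functional_def)
  show "M (p + q) = M p + M q" "M (smult c p) = c * M p" "M 0 = 0" "M (p - q) = M p - M q"
    by (simp_all add: add scale diff)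
qed

lemma times_X_three_term:
  assumes "three_term a b P"
  shows "[:0, 1:] * P (n + 1) = P (n + 2) + smult (a (n + 1)) (P (n + 1)) + smult (b n) (P n)"
    and "[:0, 1:] * P 0 = P 1 + smult (a 0) (P 0)"
  using assms by (simp_all add: three_term_def)

lemma linear_functional_X_three_term:
  assumes M: "linear_functional M" and P: "three_term a b P"
  shows "M ([:0, 1:] * P n * p) = M (P (n + 1) * p) + a n * M (P n * p) +
           (if n = 0 then 0 else b (n - 1) * M (P (n - 1) * p))"
proof (cases n)
  case 0
  thus ?thesis unfolding 0 times_X_three_term(2)[OF P]
    by (simp add: M_add[OF M] M_smult[OF M] distrib_right)
next
  case (Suc k)
  show ?thesis unfolding Suc using times_X_three_term(1)[OF P, of k]
    by (simp add: M_add[OF M] M_smult[OF M] distrib_right)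
qed

text \<open>The values on the powers of \<open>z\<close> of the functional that maps \<open>P 0\<close> to 1
  and annihilates all other \<open>P n\<close>: as \<open>P n\<close> is monic, \<open>M (P n) = 0\<close>
  determines the \<open>n\<close>-th moment from the earlier ones.\<close>

fun moment :: "(nat \<Rightarrow> complex poly) \<Rightarrow> nat \<Rightarrow> complex" where
  "moment P n = (if n = 0 then 1 else - (\<Sum>i<n. coeff (P n) i * moment P i))"

declare moment.simps [simp del]

lemma exists_moment_functional:
  assumes P: "poly_family P"
  shows "\<exists>M. linear_functional M \<and> M (P 0) = 1 \<and> (\<forall>n>0. M (P n) = 0)"
proof -
  define M where "M p = (\<Sum>i\<le>degree p. coeff p i * moment P i)" for p
  have M_eq: "M p = (\<Sum>i\<le>N. coeff p i * moment P i)" if "degree p \<le> N" for p N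
    unfolding M_def using that by (intro sum.mono_neutral_left) (auto simp: coeff_eq_0)
  have "linear_functional M" unfolding linear_functional_def
  proof (unfold_locales, goal_cases)
    case (1 a p q) show ?case by (simp add: smult_add_right)
  next
    case (2 a b p) show ?case by (simp add: smult_add_left)
  next
    case (5 a p q) show ?case by (simp add: algebra_simps)
  next
    case (9 p q)
    define N where "N = max (degree p) (degree q)"
    have "degree (p + q) \<le> N" unfolding N_def by (rule degree_add_le_max)
    thus ?case unfolding M_eq[OF \<open>degree (p + q) \<le> N\<close>]
      M_eq[of p N, unfolded N_def, OF max.cobounded1] M_eq[of q N, unfolded N_def, OF max.cobounded2]
      by (simp add: N_def sum.distrib algebra_simps)
  next
    case (10 c p)
    show ?case unfolding M_eq[OF degree_smult_le[of c p]] by (simp add: M_def sum_distrib_left mult.assoc)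
  qed (auto simp: algebra_simps)
  moreover have "M (P 0) = 1"
    using poly_family_degree[OF P, of 0] poly_family_lead[OF P, of 0] by (simp add: M_def moment.simps)
  moreover have "M (P n) = 0" if "n > 0" for n
  proof -
    have "{..n} = insert n {..<n}" by auto
    thus ?thesis using that poly_family_degree[OF P, of n] poly_family_lead[OF P, of n]
      by (simp add: M_def moment.simps[of P n])
  qed
  ultimately show ?thesis by blast
qed

text \<open>Multiplication by \<open>z\<close> is symmetric for the bilinear form \<open>M (p * q)\<close>.
  Expanding \<open>M (z * P n * P j)\<close> once through \<open>z * P n\<close> and once through \<open>z * P
  j\<close> gives the values for \<open>n + 1\<close> from those for \<open>n\<close> and \<open>n -
  1\<close>.\<close>

lemma three_term_moment_functional:
  assumes P: "three_term a b P" and M: "linear_functional M"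
    and M0: "M (P 0) = 1" "\<And>n. n > 0 \<Longrightarrow> M (P n) = 0"
  shows "M (P i * P j) = (if i = j then (\<Prod>k<i. b k) else 0)"
proof (induction i arbitrary: j rule: less_induct)
  case (less i)
  show ?case
  proof (cases i)
    case 0
    thus ?thesis using M0 P by (cases j) (auto simp: three_term_def)
  next
    case (Suc n)
    have IH: "M (P n * P l) = (if n = l then (\<Prod>k<n. b k) else 0)" for l
      using less[of n] Suc by simp
    have IH': "M (P (n - 1) * P l) = (if n - 1 = l then (\<Prod>k<n-1. b k) else 0)" if "n > 0" for l
      using less[of "n - 1"] Suc that by simp
    have "M (P (n + 1) * P j) + a n * M (P n * P j) +
        (if n = 0 then 0 else b (n - 1) * M (P (n - 1) * P j)) = M ([:0, 1:] * P j * P n)"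
      using linear_functional_X_three_term[OF M P, of n "P j"]
      by (simp add: mult.commute mult.left_commute)
    also have "\<dots> = M (P n * P (j + 1)) + a j * M (P n * P j) +
        (if j = 0 then 0 else b (j - 1) * M (P n * P (j - 1)))"
      using linear_functional_X_three_term[OF M P, of j "P n"] by (simp add: mult.commute)
    finally have main: "M (P (n + 1) * P j) =
        M (P n * P (j + 1)) + a j * M (P n * P j) - a n * M (P n * P j)
        + (if j = 0 then 0 else b (j - 1) * M (P n * P (j - 1)))
        - (if n = 0 then 0 else b (n - 1) * M (P (n - 1) * P j))"
      by (simp add: algebra_simps)
    show ?thesis
    proof (cases n)
      case 0
      show ?thesis using main unfolding Suc 0 using IH unfolding 0
        by (cases j) (auto split: if_splits)
    next
      case (Suc m)
      have IH2: "M (P m * P l) = (if m = l then (\<Prod>k<m. b k) else 0)" for l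
        using IH'[of l] Suc by simp
      show ?thesis using main unfolding \<open>i = Suc n\<close> IH unfolding Suc
        by (cases j) (auto simp: IH2 split: if_splits)
    qed
  qed
qed

text \<open>Both sides are \<open>M (z * P n * P (n + 1))\<close>, expanded through \<open>z * P n\<close> and
  through \<open>z * P (n + 1)\<close>.\<close>

lemma three_term_norm_step:
  assumes P: "three_term a b P" and M: "linear_functional M"
    and orth: "\<And>i j. i \<noteq> j \<Longrightarrow> M (P i * P j) = 0"
  shows "M (P (n + 1) * P (n + 1)) = b n * M (P n * P n)"
proof -
  have "M ([:0, 1:] * P (n + 1) * P n) = b n * M (P n * P n)"
    using linear_functional_X_three_term[OF M P, of "n + 1" "P n"] orth[of "n + 2" n] orth[of "n + 1" n]
    by simp
  moreover have "M ([:0, 1:] * P n * P (n + 1)) = M (P (n + 1) * P (n + 1))"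
    using linear_functional_X_three_term[OF M P, of n "P (n + 1)"] orth[of "n" "n + 1"]
      orth[of "n - 1" "n + 1"] by simp
  ultimately show ?thesis by (simp add: mult.commute mult.left_commute)
qed

text \<open>Favard's theorem, without positivity.\<close>

lemma quasi_orthogonal_iff:
  assumes P: "three_term a b P"
  shows "quasi_orthogonal P \<longleftrightarrow> (\<forall>n. b n \<noteq> 0)"
proof
  assume "quasi_orthogonal P"
  then obtain M where M: "linear_functional M" "\<And>i j. i \<noteq> j \<Longrightarrow> M (P i * P j) = 0"
    "\<And>i. M (P i * P i) \<noteq> 0"
    by (auto simp: quasi_orthogonal_def)
  show "\<forall>n. b n \<noteq> 0"
  proof
    fix n
    show "b n \<noteq> 0" using three_term_norm_step[OF P M(1,2), of n] M(3)[of "n + 1"] by auto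
  qed
next
  assume b: "\<forall>n. b n \<noteq> 0"
  obtain M where M: "linear_functional M" "M (P 0) = 1" "\<And>n. n > 0 \<Longrightarrow> M (P n) = 0"
    using exists_moment_functional[OF three_term_family[OF P]] by blast
  show "quasi_orthogonal P" unfolding quasi_orthogonal_def
    by (rule conjI[OF three_term_family[OF P]], rule exI[of _ M])
       (use b M(1) three_term_moment_functional[OF P M] in auto)
qed

lemma real_poly_mult:
  fixes p q :: "complex poly"
  assumes "\<And>k. coeff p k \<in> \<real>" "\<And>k. coeff q k \<in> \<real>"
  shows "coeff (p * q) k \<in> \<real>"
  unfolding coeff_mult using assms by (intro sum_in_Reals Reals_mult) auto

lemma orthogonal_family_iff:
  assumes P: "three_term a b P"
  shows "orthogonal_family P \<longleftrightarrow> (\<forall>n. a n \<in> \<real> \<and> b n \<in> \<real> \<and> Re (b n) > 0)"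
proof
  assume "orthogonal_family P"
  then obtain M where M: "linear_functional M" "\<And>i j. i \<noteq> j \<Longrightarrow> M (P i * P j) = 0"
    "\<And>i. M (P i * P i) \<in> \<real>" "\<And>i. Re (M (P i * P i)) > 0" and re: "\<And>i k. coeff (P i) k \<in> \<real>"
    by (auto simp: orthogonal_family_def)
  note fam = three_term_family[OF P]
  show "\<forall>n. a n \<in> \<real> \<and> b n \<in> \<real> \<and> Re (b n) > 0"
  proof
    fix n
    obtain x where x: "M (P n * P n) = of_real x" using M(3) by (auto elim: Reals_cases)
    obtain y where y: "M (P (n + 1) * P (n + 1)) = of_real y" using M(3) by (auto elim: Reals_cases)
    have xy: "x > 0" "y > 0" using M(4)[of n] M(4)[of "n + 1"] x y by simp_all
    have "b n = of_real (y / x)"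
      using three_term_norm_step[OF P M(1,2), of n] xy unfolding x y by (simp add: field_simps)
    moreover have "a n \<in> \<real>"
    proof (cases n)
      case 0
      have "coeff (P 1) 0 = - a 0" using P by (simp add: three_term_def)
      thus ?thesis using re[of 1 0] 0 by (metis Reals_minus minus_minus)
    next
      case (Suc k)
      have "coeff ([:0, 1:] * P (k + 1)) (k + 1) = coeff (P (k + 2)) (k + 1) + a (k + 1)"
        unfolding times_X_three_term(1)[OF P] using poly_family_lead[OF fam, of "k + 1"]
          poly_family_degree[OF fam, of k] by (simp add: coeff_eq_0)
      hence "a n = coeff (P (k + 1)) k - coeff (P (k + 2)) (k + 1)"
        using Suc by (simp add: coeff_pCons)
      thus ?thesis using re by simp
    qed
    ultimately show "a n \<in> \<real> \<and> b n \<in> \<real> \<and> Re (b n) > 0" using xy by simp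
  qed
next
  assume ab: "\<forall>n. a n \<in> \<real> \<and> b n \<in> \<real> \<and> Re (b n) > 0"
  have b0: "\<forall>n. b n \<noteq> 0" using ab by (metis less_irrefl zero_complex.simps(1))
  obtain M where M: "linear_functional M" "M (P 0) = 1" "\<And>n. n > 0 \<Longrightarrow> M (P n) = 0"
    using exists_moment_functional[OF three_term_family[OF P]] by blast
  note orth = three_term_moment_functional[OF P M]
  have re: "(\<forall>k. coeff (P n) k \<in> \<real>) \<and> (\<forall>k. coeff (P (Suc n)) k \<in> \<real>)" for n
  proof (induction n)
    case 0
    show ?case using P ab by (auto simp: three_term_def coeff_pCons split: nat.splits)
  next
    case (Suc n)
    have "P (n + 2) = [:- a (n + 1), 1:] * P (n + 1) - smult (b n) (P n)"
      using P by (simp add: three_term_def)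
    moreover have "coeff ([:- a (n + 1), 1:] * P (n + 1)) k \<in> \<real>" for k
      by (rule real_poly_mult) (use ab Suc in \<open>auto simp: coeff_pCons split: nat.splits\<close>)
    moreover have "coeff (smult (b n) (P n)) k \<in> \<real>" for k
      using ab Suc by simp
    ultimately have "coeff (P (n + 2)) k \<in> \<real>" for k
      by (simp only: coeff_diff) (rule Reals_diff)
    thus ?case using Suc by simp
  qed
  have pos: "(\<Prod>k<n. b k) \<in> \<real> \<and> Re (\<Prod>k<n. b k) > 0" for n
  proof (induction n)
    case (Suc n)
    have "b n \<in> \<real>" "Re (b n) > 0" using ab by auto
    thus ?case using Suc by (auto elim!: Reals_cases)
  qed simp
  show "orthogonal_family P" unfolding orthogonal_family_def
    using re M(1) orth pos quasi_orthogonal_iff[OF P] b0 by (intro conjI exI[of _ M]) auto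
qed

text \<open>A quasi-orthogonal family is graded, so \<open>P\<^sub>n\<close> is orthogonal to all polynomials of smaller
  degree, which is what produces its three-term recurrence.\<close>

lemma orthogonal_lower_degree:
  assumes P: "poly_family P" and M: "linear_functional M"
    and orth: "\<And>i j. i \<noteq> j \<Longrightarrow> M (P i * P j) = 0"
  shows "degree p < n \<Longrightarrow> M (P n * p) = 0"
proof (induction "degree p" arbitrary: p rule: less_induct)
  case less
  define d where "d = degree p"
  define r where "r = p - smult (lead_coeff p) (P d)"
  have p: "p = r + smult (lead_coeff p) (P d)" by (simp add: r_def)
  have "M (P n * p) = M (P n * r) + lead_coeff p * M (P n * P d)"
    by (subst (1) p) (simp only: distrib_left mult_smult_right M_add[OF M] M_smult[OF M])
  moreover have "M (P n * P d) = 0" using orth less.prems by (simp add: d_def)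
  moreover have "M (P n * r) = 0"
  proof (cases "r = 0")
    case True
    thus ?thesis using M_zero[OF M] by simp
  next
    case False
    have "degree r \<le> d" unfolding r_def
      by (rule degree_diff_le) (use poly_family_degree[OF P, of d] in \<open>simp_all add: d_def\<close>)
    moreover have "coeff r d = 0"
      using poly_family_lead[OF P, of d] by (simp add: r_def d_def)
    ultimately have "degree r < d" using False
      by (metis leading_coeff_0_iff le_neq_implies_less)
    thus ?thesis using less by (simp add: d_def)
  qed
  ultimately show ?case by simp
qed

text \<open>Subtracting from \<open>z * P (n + 1)\<close> its components along \<open>P (n + 2)\<close>,
  \<open>P (n + 1)\<close> and \<open>P n\<close> leaves a polynomial of degree at most \<open>n + 1\<close>
  that is orthogonal to \<open>P 0, \<dots>, P (n + 1)\<close>, and such a polynomial is 0.\<close>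

lemma quasi_orthogonal_recurrence:
  assumes "quasi_orthogonal P"
  obtains a b where "\<And>n. [:0, 1:] * P (n + 1) =
      P (n + 2) + smult (a n) (P (n + 1)) + smult (b n) (P n)" "\<And>n. b n \<noteq> 0"
proof -
  from assms obtain M where P: "poly_family P" and M: "linear_functional M" and
    orth: "\<And>i j. i \<noteq> j \<Longrightarrow> M (P i * P j) = 0" and nz: "\<And>i. M (P i * P i) \<noteq> 0"
    by (auto simp: quasi_orthogonal_def)
  have low: "M (P n * p) = 0" if "degree p < n" for n p
    using orthogonal_lower_degree[OF P M _ that] orth by blast
  have deg: "degree (P n) = n" and lead: "coeff (P n) n = 1" for n
    using poly_family_degree[OF P] poly_family_lead[OF P] by auto
  have monic: "M (P (n + 1) * ([:0, 1:] * P n)) = M (P (n + 1) * P (n + 1))" for n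
  proof -
    have "degree ([:0, 1:] * P n - P (n + 1)) < n + 1"
    proof -
      have "degree ([:0, 1:] * P n - P (n + 1)) \<le> n + 1"
        by (rule degree_diff_le) (simp_all add: deg degree_pCons_le[THEN order_trans])
      moreover have "coeff ([:0, 1:] * P n - P (n + 1)) (n + 1) = 0"
        using lead[of n] lead[of "n + 1"] by simp
      ultimately show ?thesis
        by (metis Suc_eq_plus1 degree_0 le_neq_implies_less leading_coeff_0_iff zero_less_Suc)
    qed
    from low[OF this] show ?thesis by (simp add: right_diff_distrib M_diff[OF M])
  qed
  define a where "a n = M (P (n + 1) * ([:0, 1:] * P (n + 1))) / M (P (n + 1) * P (n + 1))" for n
  define b where "b n = M (P n * ([:0, 1:] * P (n + 1))) / M (P n * P n)" for n
  have swap: "M (P i * ([:0, 1:] * P j)) = M (P j * ([:0, 1:] * P i))" for i j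
    by (simp add: mult.left_commute mult.commute)
  have b: "b n \<noteq> 0" for n
    unfolding b_def swap[of n] monic using nz by simp
  have rec: "[:0, 1:] * P (n + 1) = P (n + 2) + smult (a n) (P (n + 1)) + smult (b n) (P n)" for n
  proof -
    define S where "S = [:0, 1:] * P (n + 1) - P (n + 2) - smult (a n) (P (n + 1)) - smult (b n) (P n)"
    have MS: "M (P j * S) = M (P j * ([:0, 1:] * P (n + 1))) - M (P j * P (n + 2))
        - a n * M (P j * P (n + 1)) - b n * M (P j * P n)" for j
      by (simp only: S_def right_diff_distrib mult_smult_right M_diff[OF M] M_smult[OF M])
    have S0: "M (P j * S) = 0" if "j \<le> n + 1" for j
    proof -
      have "j = n + 1 \<or> j = n \<or> j < n" using that by linarith
      then consider "j = n + 1" | "j = n" | "j < n" by blast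
      thus ?thesis
      proof cases
        case 1
        thus ?thesis unfolding MS using orth[of "n + 1" "n + 2"] orth[of "n + 1" n] nz[of "n + 1"]
          by (simp add: a_def)
      next
        case 2
        thus ?thesis unfolding MS using orth[of n "n + 2"] orth[of n "n + 1"] nz[of n]
          by (simp add: b_def)
      next
        case 3
        have "degree ([:0, 1:] * P j) < n + 1" using 3
          by (simp add: deg degree_pCons_le[THEN le_less_trans])
        from low[OF this] show ?thesis unfolding MS swap[of j] using 3 orth by simp
      qed
    qed
    have "S = 0"
    proof (rule ccontr)
      assume "S \<noteq> 0"
      define d where "d = degree S"
      have "degree S \<le> n + 2" unfolding S_def
        by (intro degree_diff_le order_trans[OF degree_smult_le]) (simp_all add: deg degree_pCons_le[THEN order_trans])
      moreover have "coeff S (n + 2) = 0"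
        unfolding S_def using lead[of "n + 1"] lead[of "n + 2"] by (simp add: coeff_eq_0 deg)
      ultimately have d: "d \<le> n + 1" using \<open>S \<noteq> 0\<close> unfolding d_def
        by (metis Suc_1 add_Suc_right le_Suc_eq leading_coeff_0_iff Suc_eq_plus1)
      define r where "r = S - smult (lead_coeff S) (P d)"
      have "M (P d * r) = 0"
      proof (cases "r = 0")
        case True
        thus ?thesis using M_zero[OF M] by simp
      next
        case False
        have "degree r \<le> d" unfolding r_def
          by (rule degree_diff_le) (use deg in \<open>simp_all add: d_def\<close>)
        moreover have "coeff r d = 0" using lead[of d] by (simp add: r_def d_def)
        ultimately have "degree r < d" using False
          by (metis leading_coeff_0_iff le_neq_implies_less)
        thus ?thesis by (rule low)
      qed
      hence "M (P d * S) = lead_coeff S * M (P d * P d)"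
        by (simp add: r_def right_diff_distrib M_diff[OF M] M_smult[OF M])
      thus False using S0[OF d] nz[of d] \<open>S \<noteq> 0\<close> by simp
    qed
    thus ?thesis by (simp add: S_def algebra_simps)
  qed
  show ?thesis by (rule that[of a b]) (use rec b in blast)+
qed

text \<open>As the coefficients \<open>b n\<close> do not vanish, a common zero of two consecutive members is
  a zero of the preceding one, and so eventually of \<open>P 0 = 1\<close>.\<close>

lemma quasi_orthogonal_no_persistent_root:
  assumes P: "quasi_orthogonal P"
  shows "\<exists>n\<ge>L. poly (P n) z \<noteq> 0"
proof (rule ccontr)
  assume "\<not> ?thesis"
  hence z: "\<And>n. n \<ge> L \<Longrightarrow> poly (P n) z = 0" by auto
  obtain a b where rec: "\<And>n. [:0, 1:] * P (n + 1) =
      P (n + 2) + smult (a n) (P (n + 1)) + smult (b n) (P n)" and b: "\<And>n. b n \<noteq> 0"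
    by (rule quasi_orthogonal_recurrence[OF P]) blast
  have step: "poly (P n) z = 0" if "poly (P (n + 1)) z = 0" "poly (P (n + 2)) z = 0" for n
    using arg_cong[OF rec[of n], of "\<lambda>p. poly p z"] that b[of n] by simp
  have "poly (P (L - k)) z = 0 \<and> poly (P (L - k + 1)) z = 0" for k
  proof (induction k)
    case 0
    show ?case using z by simp
  next
    case (Suc k)
    show ?case
    proof (cases "k < L")
      case True
      hence "L - k = L - Suc k + 1" by simp
      thus ?thesis using Suc step[of "L - Suc k"] by simp
    next
      case False
      thus ?thesis using Suc by simp
    qed
  qed
  from this[of L] have "poly (P 0) z = 0" by simp
  moreover have "poly_family P" using P by (simp add: quasi_orthogonal_def)
  hence "P 0 = 1" using poly_family_degree[of P 0] poly_family_lead[of P 0]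
    by (metis degree_eq_zeroE coeff_pCons_0 one_pCons)
  ultimately show False by simp
qed

section \<open>Coefficients of HG-families\<close>

lemma newton_basis_monic: "degree (newton_basis R k) = k \<and> coeff (newton_basis R k) k = 1"
proof (induction k)
  case (Suc k)
  let ?p = "newton_basis R k"
  have c: "coeff (newton_basis R (Suc k)) (Suc k) = 1" using Suc by (simp add: coeff_eq_0)
  have "degree (newton_basis R (Suc k)) \<le> Suc k" unfolding newton_basis.simps
    by (rule degree_add_le) (use Suc in \<open>simp_all add: degree_pCons_le[THEN order_trans]\<close>)
  moreover have "Suc k \<le> degree (newton_basis R (Suc k))"
    by (rule le_degree) (simp only: c, simp)
  ultimately have "degree (newton_basis R (Suc k)) = Suc k" by (rule antisym)
  thus ?case using c by blast
qed simp

lemma newton_basis_root: "k > 0 \<Longrightarrow> poly (newton_basis R k) (- poly R 0) = 0"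
proof (induction k)
  case (Suc k)
  thus ?case by (cases k) simp_all
qed simp

text \<open>Restricting the defining relation to indices \<open>k \<ge> 0\<close> loses exactly one condition:
  \<open>k = -1\<close>, \<open>n = 0\<close> says that \<open>D(-1) = 0\<close>.\<close>

definition HG_coeffs :: "complex poly \<Rightarrow> complex poly poly \<Rightarrow> complex poly \<Rightarrow>
    (nat \<Rightarrow> complex poly) \<Rightarrow> (nat \<Rightarrow> nat \<Rightarrow> complex) \<Rightarrow> bool" where
  "HG_coeffs R N D P C \<longleftrightarrow>
     (\<forall>n. P n = (\<Sum>k\<le>n. smult (C n k) (newton_basis R k))) \<and>
     (\<forall>n. C n n = 1) \<and> (\<forall>n k. n < k \<longrightarrow> C n k = 0) \<and>
     (\<forall>n k. poly D (of_nat k) * C n (k + 1) = eval_us N (of_nat n) (of_nat k) * C n k)"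

lemma newton_sum_lead:
  "coeff (\<Sum>k\<le>n. smult (C k) (newton_basis R k)) n = C n"
  "degree (\<Sum>k\<le>n. smult (C k) (newton_basis R k)) \<le> n"
proof -
  have "(\<Sum>k<n. coeff (smult (C k) (newton_basis R k)) n) = 0"
    by (intro sum.neutral ballI) (use newton_basis_monic[of R] in \<open>simp add: coeff_eq_0\<close>)
  moreover have "{..n} = insert n {..<n}" by auto
  ultimately show "coeff (\<Sum>k\<le>n. smult (C k) (newton_basis R k)) n = C n"
    using newton_basis_monic[of R n] by (simp add: coeff_sum)
  show "degree (\<Sum>k\<le>n. smult (C k) (newton_basis R k)) \<le> n"
    by (intro degree_sum_le order_trans[OF degree_smult_le]) (use newton_basis_monic[of R] in auto)
qed

text \<open>A family may use another coprime representation \<open>f = N'/D'\<close>. Then \<open>D = h *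
  D'\<close> and \<open>N = h * N'\<close> for a polynomial \<open>h\<close>, and multiplying by
  \<open>h(k)\<close> turns its relations into those for \<open>N\<close> and \<open>D\<close>.\<close>

lemma HG_familyD:
  assumes P: "HG_family R (quot_us N D) P" and D: "D \<noteq> 0"
  shows "\<exists>C. HG_coeffs R N D P C"
proof -
  from P obtain N' D' c where cop: "coprime N' [:D':]" and D': "D' \<noteq> 0"
    and f: "quot_us N D = quot_us N' D'" and c: "newton_coeffs R P c"
    and rel: "\<And>n k. poly D' (of_int k) * c n (k + 1) = eval_us N' (of_int n) (of_int k) * c n k"
    and fam: "poly_family P"
    unfolding HG_family_def by blast
  have nz: "to_fract D \<noteq> 0" "to_fract D' \<noteq> 0" using D D' by simp_all
  have cancel: "x * y * inverse x = y" "x * y * inverse y = x" if "x \<noteq> 0" "y \<noteq> 0"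
    for x y :: "complex poly fract" using that by simp_all
  note cancel = cancel[OF nz]
  have "smult (to_fract D * to_fract D') (quot_us N D) = smult (to_fract D * to_fract D') (quot_us N' D')"
    by (simp only: f)
  hence "fract_poly (smult D' N) = fract_poly (smult D N')"
    by (simp only: quot_us_def smult_smult cancel fract_poly_smult)
  hence eq: "smult D' N = smult D N'" by (simp only: fract_poly_eq_iff)
  have "[:D':] dvd [:D:] * N'" using eq by (metis dvd_triv_left mult_pCons_left add.right_neutral
        mult_zero_left pCons_0_0 smult_0_left)
  hence "[:D':] dvd [:D:]" using cop by (metis coprime_commute coprime_dvd_mult_left_iff)
  hence "D' dvd D" by (metis const_poly_dvd_iff coeff_pCons_0)
  then obtain h where h: "D = D' * h" by (rule dvdE)
  have "smult D' N = smult D' (smult h N')" by (simp add: eq h)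
  hence N: "N = smult h N'" using D' by (metis smult_cancel)
  define C where "C n k = c (int n) (int k)" for n k
  have Pn: "P n = (\<Sum>k\<le>n. smult (C n k) (newton_basis R k))" for n
    using c by (simp add: newton_coeffs_def C_def)
  have "C n n = 1" for n
    using poly_family_lead[OF fam, of n] newton_sum_lead(1)[of "C n" R n] by (simp add: Pn[symmetric])
  moreover have "C n k = 0" if "n < k" for n k
    using c that by (simp add: newton_coeffs_def C_def)
  moreover have "poly D (of_nat k) * C n (k + 1) = eval_us N (of_nat n) (of_nat k) * C n k" for n k
    using rel[of "int k" "int n"] by (simp add: h N eval_us_def C_def add.commute)
  ultimately show ?thesis using Pn unfolding HG_coeffs_def by blast
qed

text \<open>A coprime representation of 0 has a constant denominator, but the index \<open>k = -1\<close>
  requires a zero of the denominator.\<close>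

lemma not_HG_zero: "\<not> HG_family R 0 P"
proof
  assume "HG_family R 0 P"
  then obtain N D c where cop: "coprime N [:D:]" and D: "D \<noteq> 0"
    and f: "0 = quot_us N D" and c: "newton_coeffs R P c"
    and rel: "\<And>n k. poly D (of_int k) * c n (k + 1) = eval_us N (of_int n) (of_int k) * c n k"
    and fam: "poly_family P"
    unfolding HG_family_def by blast
  have N: "N = 0" using f D by (simp add: quot_us_def)
  hence "is_unit [:D:]" using cop by simp
  then obtain d where d: "D = [:d:]" "d \<noteq> 0"
    using D by (auto simp: is_unit_const_poly_iff is_unit_poly_iff)
  have "d * c 0 0 = 0" using rel[of "-1" 0] by (simp add: d N eval_us_def)
  moreover have "c 0 0 = 1"
  proof -
    have "P 0 = (\<Sum>k\<le>0. smult (c 0 (int k)) (newton_basis R k))"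
      using c unfolding newton_coeffs_def by (metis of_nat_0)
    thus ?thesis using poly_family_lead[OF fam, of 0] by simp
  qed
  ultimately show False using d by simp
qed

text \<open>The condition on the leading coefficient in \<open>u\<close> excludes factors of \<open>N\<close>
  that depend on \<open>s\<close> only, which makes \<open>N\<close> and \<open>D\<close> coprime.\<close>

lemma HG_familyI:
  assumes C: "HG_coeffs R N D P C" and D: "D \<noteq> 0" "poly D (-1) = 0"
    and lead: "lead_coeff N = [:a:]" "a \<noteq> 0"
  shows "HG_family R (quot_us N D) P"
proof -
  define c where "c n k = (if 0 \<le> k \<and> k \<le> n then C (nat n) (nat k) else 0)" for n k
  have cnat: "c (int n) (int k) = C n k" for n k
    using C by (auto simp: c_def HG_coeffs_def)
  have Pn: "P n = (\<Sum>k\<le>n. smult (C n k) (newton_basis R k))" for n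
    using C by (simp add: HG_coeffs_def)
  have "poly_family P" unfolding poly_family_def
  proof
    fix n
    have c1: "coeff (P n) n = 1"
      unfolding Pn newton_sum_lead using C by (simp add: HG_coeffs_def)
    moreover have "degree (P n) \<le> n" unfolding Pn by (rule newton_sum_lead)
    ultimately have "degree (P n) = n" by (intro antisym le_degree) simp_all
    thus "degree (P n) = n \<and> lead_coeff (P n) = 1" using c1 by simp
  qed
  moreover have "coprime N [:D:]"
  proof (rule coprimeI)
    fix x assume x: "x dvd N" "x dvd [:D:]"
    have "degree x = 0" using dvd_imp_degree_le[OF x(2)] D by simp
    then obtain y where y: "x = [:y:]" by (rule degree_eq_zeroE)
    from x(1) have "y dvd lead_coeff N" by (simp add: y const_poly_dvd_iff)
    moreover have "is_unit [:a:]" using lead(2) by (rule is_unit_triv)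
    ultimately have "is_unit y" using lead(1) by (metis dvd_trans)
    thus "is_unit x" by (simp add: y is_unit_const_poly_iff)
  qed
  moreover have "newton_coeffs R P c"
    unfolding newton_coeffs_def using Pn cnat by (auto simp: c_def)
  moreover have "poly D (of_int k) * c n (k + 1) = eval_us N (of_int n) (of_int k) * c n k" for n k
  proof -
    consider "n < 0 \<or> k < -1" | "k = -1" | "n \<ge> 0" "k \<ge> 0" by linarith
    thus ?thesis
    proof cases
      case 1
      thus ?thesis by (auto simp: c_def)
    next
      case 2
      thus ?thesis using D by (simp add: c_def)
    next
      case 3
      have "poly D (of_nat (nat k)) * C (nat n) (nat k + 1) =
          eval_us N (of_nat (nat n)) (of_nat (nat k)) * C (nat n) (nat k)"
        using C by (simp add: HG_coeffs_def)
      moreover have "c n (k + 1) = C (nat n) (nat k + 1)" "c n k = C (nat n) (nat k)"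
        using cnat[of "nat n" "nat k + 1"] cnat[of "nat n" "nat k"] 3 by (simp_all add: add.commute)
      ultimately show ?thesis using 3 by simp
    qed
  qed
  ultimately show ?thesis using D(1) unfolding HG_family_def by blast
qed

lemma HG_coeffs_row_unique:
  assumes C: "HG_coeffs R N D P C" and C': "HG_coeffs R N D Q C'"
    and nz: "\<And>k. k < n \<Longrightarrow> eval_us N (of_nat n) (of_nat k) \<noteq> 0"
  shows "P n = Q n"
proof -
  have "C n (n - j) = C' n (n - j)" if "j \<le> n" for j
    using that
  proof (induction j)
    case 0
    show ?case using C C' by (simp add: HG_coeffs_def)
  next
    case (Suc j)
    define k where "k = n - Suc j"
    have k: "n - j = k + 1" "k < n" using Suc.prems by (simp_all add: k_def)
    have "poly D (of_nat k) * C n (k + 1) = eval_us N (of_nat n) (of_nat k) * C n k"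
      "poly D (of_nat k) * C' n (k + 1) = eval_us N (of_nat n) (of_nat k) * C' n k"
      using C C' by (simp_all add: HG_coeffs_def)
    thus ?case using Suc nz[OF k(2)] k by (simp add: k_def[symmetric])
  qed
  hence "C n k = C' n k" if "k \<le> n" for k using that by (metis diff_diff_cancel diff_le_self)
  moreover have "P n = (\<Sum>k\<le>n. smult (C n k) (newton_basis R k))"
    "Q n = (\<Sum>k\<le>n. smult (C' n k) (newton_basis R k))"
    using C C' by (simp_all add: HG_coeffs_def)
  ultimately show ?thesis by simp
qed

text \<open>Row \<open>n\<close> of the coefficients is computed downwards from \<open>c(n,n) = 1\<close>; as long as the
  factors \<open>D(k)\<close> do not vanish, a zero of \<open>N(n,k)\<close> would contradict this.\<close>

lemma HG_coeffs_numerator_nonzero: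
  assumes C: "HG_coeffs R N D P C" and D: "\<And>k. poly D (of_nat k) \<noteq> 0" and kn: "k < n"
  shows "eval_us N (of_nat n) (of_nat k) \<noteq> 0"
proof -
  have rel: "poly D (of_nat k) * C n (k + 1) = eval_us N (of_nat n) (of_nat k) * C n k" for k
    using C by (simp add: HG_coeffs_def)
  have nz: "C n (n - j) \<noteq> 0" if "j \<le> n" for j
    using that
  proof (induction j)
    case 0
    show ?case using C by (simp add: HG_coeffs_def)
  next
    case (Suc j)
    define k where "k = n - Suc j"
    have k: "n - j = k + 1" using Suc.prems by (simp add: k_def)
    show ?case using rel[of k] Suc D[of k] unfolding k_def[symmetric] k[symmetric] by auto
  qed
  have "C n (k + 1) \<noteq> 0" using nz[of "n - (k + 1)"] kn by simp
  thus ?thesis using rel[of k] D[of k] by auto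
qed

lemma eval_us_diag: "poly (poly N [:of_nat j, 1:]) z = eval_us N (z + of_nat j) z"
proof -
  have "poly (poly N p) z = poly (poly N [:poly p z:]) z" for p
    by (induction N) simp_all
  from this[of "[:of_nat j, 1:]"] show ?thesis by (simp add: eval_us_def add.commute)
qed

lemma hg_f1_Fract:
  assumes "D \<noteq> 0"
  shows "hg_f1 (quot_us N D) = Fract D (poly N [:of_nat 1, 1:])"
  unfolding hg_f1_def diag_shift_quot[OF assms] inverse_fract by (rule refl)

text \<open>With denominators cleared, the definition of \<open>f\<^sub>1\<close> and \<open>f\<^sub>2\<close>
  extends by continuity to the points where \<open>N\<close> vanishes. In this form it shows that
  \<open>N(n+1,n)\<close> can only vanish together with \<open>D(n)\<close>, and \<open>N(n+2,n)\<close>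
  together with \<open>D(n) D(n+1)\<close>.\<close>

lemma finite_values:
  assumes D: "D \<noteq> 0"
  shows f1_finite_value: "f1_finite (quot_us N D) n \<Longrightarrow>
      rat_val (hg_f1 (quot_us N D)) (of_nat n) * eval_us N (of_nat n + 1) (of_nat n) = poly D (of_nat n)"
    and f2_finite_value: "f2_finite (quot_us N D) n \<Longrightarrow>
      rat_val (hg_f2 (quot_us N D)) (of_nat n) *
        (eval_us N (of_nat n + 2) (of_nat n) * eval_us N (of_nat n + 2) (of_nat n + 1)) =
      poly D (of_nat n) * poly D (of_nat n + 1)"
proof -
  let ?f = "quot_us N D"
  define N1 where "N1 = poly N [:of_nat 1, 1:]"
  define N2 where "N2 = poly N [:of_nat 2, 1:]"
  have N1: "poly N1 z = eval_us N (z + 1) z" and N2: "poly N2 z = eval_us N (z + 2) z" for z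
    unfolding N1_def N2_def eval_us_diag by simp_all
  have f1: "hg_f1 ?f = Fract D N1" by (simp only: hg_f1_Fract[OF D] N1_def)
  have f2: "hg_f2 ?f = Fract D N2 * rat_shift 1 (hg_f1 ?f)"
    by (simp only: hg_f2_def diag_shift_quot[OF D] inverse_fract N2_def)
  let ?w = "of_nat n :: complex"
  have Fract0: "Fract 0 D = (0 :: complex poly fract)" by (rule fract_collapse)
  have f1v: "rat_val (hg_f1 ?f) z * poly N1 z = poly D z" if "poly N1 z \<noteq> 0" for z
    using that unfolding f1 rat_val_Fract[OF that] by simp
  { assume fin: "f1_finite ?f n"
    have N0: "N1 \<noteq> 0" using fin unfolding f1_finite_def diag_shift_quot[OF D] N1_def[symmetric]
      by (auto simp only: Fract0)
    have "((\<lambda>z. rat_val (hg_f1 ?f) z * poly N1 z) \<longlongrightarrow> rat_val (hg_f1 ?f) ?w * poly N1 ?w) (at ?w)"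
      using fin by (intro tendsto_intros tendsto_rat_val) (simp_all add: f1_finite_def)
    moreover have "\<forall>\<^sub>F z in at ?w. rat_val (hg_f1 ?f) z * poly N1 z = poly D z"
      using eventually_poly_nonzero[OF N0] by eventually_elim (rule f1v)
    ultimately have "(poly D \<longlongrightarrow> rat_val (hg_f1 ?f) ?w * poly N1 ?w) (at ?w)"
      by (rule Lim_transform_eventually)
    from LIM_unique[OF this tendsto_poly[OF tendsto_ident_at]]
    show "rat_val (hg_f1 ?f) ?w * eval_us N (?w + 1) ?w = poly D ?w" by (simp only: N1) }
  { assume fin: "f2_finite ?f n"
    have N0: "N1 \<noteq> 0" "N2 \<noteq> 0" using fin
      unfolding f2_finite_def diag_shift_quot[OF D] N1_def[symmetric] N2_def[symmetric]
      by (auto simp only: Fract0)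
    have N0': "N1 \<circ>\<^sub>p [:1, 1:] \<noteq> 0" using N0(1) by (simp add: pcompose_eq_0_iff)
    let ?g = "\<lambda>z. rat_val (hg_f2 ?f) z * (poly N2 z * poly N1 (z + 1))"
    have "(?g \<longlongrightarrow> rat_val (hg_f2 ?f) ?w * (poly N2 ?w * poly N1 (?w + 1))) (at ?w)"
      using fin by (intro tendsto_intros tendsto_rat_val) (simp_all add: f2_finite_def)
    moreover have "\<forall>\<^sub>F z in at ?w. ?g z = poly D z * poly D (z + 1)"
      using eventually_poly_nonzero[OF N0(2)] eventually_poly_nonzero[OF N0']
    proof eventually_elim
      case (elim z)
      have n1: "poly N1 (z + 1) \<noteq> 0" using elim by (simp add: poly_pcompose add.commute)
      have np: "no_pole (hg_f1 ?f) (z + 1)" unfolding f1 by (rule no_pole_Fract[OF n1])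
      have "rat_val (hg_f2 ?f) z = poly D z / poly N2 z * rat_val (hg_f1 ?f) (z + 1)"
        unfolding f2 using no_pole_Fract[OF elim(1)] no_pole_shift[OF np]
        by (subst rat_val_mult) (simp_all add: rat_val_Fract[OF elim(1)] rat_val_shift[OF np])
      thus ?case using elim(1) f1v[OF n1] by simp
    qed
    ultimately have lim: "((\<lambda>z. poly D z * poly D (z + 1)) \<longlongrightarrow>
        rat_val (hg_f2 ?f) ?w * (poly N2 ?w * poly N1 (?w + 1))) (at ?w)"
      by (rule Lim_transform_eventually)
    have "((\<lambda>z. poly D z * poly D (z + 1)) \<longlongrightarrow> poly D ?w * poly D (?w + 1)) (at ?w)"
      by (intro tendsto_intros)
    from LIM_unique[OF lim this]
    have "rat_val (hg_f2 ?f) ?w * (poly N2 ?w * poly N1 (?w + 1)) = poly D ?w * poly D (?w + 1)" .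
    thus "rat_val (hg_f2 ?f) ?w * (eval_us N (?w + 2) ?w * eval_us N (?w + 2) (?w + 1)) =
        poly D ?w * poly D (?w + 1)" by (simp add: N1 N2 add.assoc) }
qed

text \<open>Comparison of coefficients, using \<open>z * \<Phi>\<^sub>k = \<Phi>\<^sub>k\<^sub>+\<^sub>1 -
  R(k) * \<Phi>\<^sub>k\<close>.\<close>

lemma newton_sum_recurrence:
  assumes P: "\<And>n. P n = (\<Sum>k\<le>n. smult (C n k) (newton_basis R k))"
    and C: "\<And>n k. n < k \<Longrightarrow> C n k = (0 :: complex)"
    and rec: "\<And>k. C (n + 2) k = (if k = 0 then 0 else C (n + 1) (k - 1))
        - (poly R (of_nat k) + a) * C (n + 1) k - b * C n k"
  shows "P (n + 2) = [:- a, 1:] * P (n + 1) - smult b (P n)"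
proof -
  let ?\<Phi> = "newton_basis R"
  have smult_sum2: "smult c (\<Sum>k\<in>S. g k) = (\<Sum>k\<in>S. smult c (g k))"
    for c :: complex and S :: "nat set" and g :: "nat \<Rightarrow> complex poly"
    by (induction S rule: infinite_finite_induct) (simp_all add: smult_add_right)
  have ext: "P m = (\<Sum>k\<le>n + 2. smult (C m k) (?\<Phi> k))" if "m \<le> n + 2" for m
    unfolding P using that C by (intro sum.mono_neutral_left) auto
  have "[:0, 1:] * P (n + 1) = (\<Sum>k\<le>n + 1. smult (C (n + 1) k) (?\<Phi> (Suc k)))
      - (\<Sum>k\<le>n + 1. smult (poly R (of_nat k) * C (n + 1) k) (?\<Phi> k))"
    unfolding P sum_distrib_left sum_subtractf[symmetric]
    by (intro sum.cong refl) (simp add: algebra_simps smult_add_right)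
  also have "(\<Sum>k\<le>n + 1. smult (C (n + 1) k) (?\<Phi> (Suc k))) =
      (\<Sum>k\<le>n + 2. smult (if k = 0 then 0 else C (n + 1) (k - 1)) (?\<Phi> k))"
    using sum.atMost_Suc_shift[of "\<lambda>k. smult (if k = 0 then 0 else C (n + 1) (k - 1)) (?\<Phi> k)" "n + 1"]
    by (simp del: newton_basis.simps)
  also have "(\<Sum>k\<le>n + 1. smult (poly R (of_nat k) * C (n + 1) k) (?\<Phi> k)) =
      (\<Sum>k\<le>n + 2. smult (poly R (of_nat k) * C (n + 1) k) (?\<Phi> k))"
    using C by (intro sum.mono_neutral_left) auto
  finally have X: "[:0, 1:] * P (n + 1) =
      (\<Sum>k\<le>n + 2. smult (if k = 0 then 0 else C (n + 1) (k - 1)) (?\<Phi> k))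
      - (\<Sum>k\<le>n + 2. smult (poly R (of_nat k) * C (n + 1) k) (?\<Phi> k))" .
  have rec': "C (n + 2) k = (if k = 0 then 0 else C (n + 1) (k - 1))
      - poly R (of_nat k) * C (n + 1) k - a * C (n + 1) k - b * C n k" for k
    unfolding rec by (simp add: algebra_simps)
  have "P (n + 2) = (\<Sum>k\<le>n + 2. smult (if k = 0 then 0 else C (n + 1) (k - 1)) (?\<Phi> k))
      - (\<Sum>k\<le>n + 2. smult (poly R (of_nat k) * C (n + 1) k) (?\<Phi> k))
      - smult a (\<Sum>k\<le>n + 2. smult (C (n + 1) k) (?\<Phi> k)) - smult b (\<Sum>k\<le>n + 2. smult (C n k) (?\<Phi> k))"
    unfolding ext[OF order_refl] smult_sum2 sum_subtractf[symmetric]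
    by (intro sum.cong refl) (simp only: rec' smult_diff_left smult_smult)
  also have "\<dots> = [:0, 1:] * P (n + 1) - smult a (P (n + 1)) - smult b (P n)"
    by (simp only: X ext[of "n + 1", symmetric] ext[of n, symmetric] add_le_mono one_le_numeral
        le_add1 order_refl)
  also have "[:0, 1:] * P (n + 1) - smult a (P (n + 1)) = [:- a, 1:] * P (n + 1)"
    by simp
  finally show ?thesis .
qed

section \<open>Factored pairs and the three-term recurrence\<close>

text \<open>This is \<open>\<alpha>(u) = f\<^sub>1(u-1) - f\<^sub>1(u) - R(u)\<close> for \<open>N(u,s) =
  A(s-u) B(s+u)\<close>.\<close>

definition alpha_at :: "complex poly \<Rightarrow> complex poly \<Rightarrow> complex poly \<Rightarrow> complex poly \<Rightarrow> complex \<Rightarrow> complex" where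
  "alpha_at R D A B u = poly D (u - 1) / (poly A (-1) * poly B (2 * u - 1))
     - poly D u / (poly A (-1) * poly B (2 * u + 1)) - poly R u"

definition step_factor :: "complex poly \<Rightarrow> complex poly \<Rightarrow> complex \<Rightarrow> complex" where
  "step_factor D B u = poly D u / (poly B (2 * u) * poly B (2 * u + 1))"

text \<open>The recurrence for the coefficients \<open>c(u+1,k)\<close>, \<open>c(u,k)\<close>,
  \<open>c(u,k-1)\<close>, after division by \<open>c(u-1,k)\<close> and removal of the denominators
  \<open>A(k-u-1) A(k-u)\<close>.\<close>

definition kernel_poly ::
    "complex poly \<Rightarrow> complex poly \<Rightarrow> complex poly \<Rightarrow> complex poly \<Rightarrow> complex \<Rightarrow> complex \<Rightarrow> complex" where
  "kernel_poly R D A B u k = poly D (k - 1)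
     - (poly R k + alpha_at R D A B u) * poly B (k + u - 1) * poly A (k - u - 1)
     - step_factor D B u * poly B (k + u) * poly B (k + u - 1)"

text \<open>The assumption on \<open>kernel_poly\<close> is what the three-term recurrence amounts to, see
  \<open>coefficient_recurrence_aux\<close>; the quotient by the two values of \<open>A\<close> may depend on
  \<open>u\<close> but not on \<open>k\<close>.\<close>

locale factored_pair =
  fixes R D A B :: "complex poly" and N :: "complex poly poly" and f :: "complex poly fract poly"
  assumes f: "f = quot_us N D"
    and D: "D \<noteq> 0" and D_neg1: "poly D (-1) = 0"
    and lead: "\<exists>a. a \<noteq> 0 \<and> lead_coeff N = [:a:]"
    and N: "\<And>u s. eval_us N u s = poly A (s - u) * poly B (s + u)"
    and A0: "poly A 0 = 0" and A: "\<And>i::nat. i > 0 \<Longrightarrow> poly A (- of_nat i) \<noteq> 0"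
    and B: "B \<noteq> 0"
    and kernel: "\<And>u. poly B (2 * u - 1) \<noteq> 0 \<Longrightarrow> poly B (2 * u) \<noteq> 0 \<Longrightarrow> poly B (2 * u + 1) \<noteq> 0 \<Longrightarrow>
      \<exists>K. \<forall>k. kernel_poly R D A B u k = K * (poly A (k - u - 1) * poly A (k - u))"
begin

text \<open>The coefficient \<open>c(u,u-i)\<close>, continued to complex \<open>u\<close>.\<close>

definition F :: "nat \<Rightarrow> complex \<Rightarrow> complex" where
  "F i u = (\<Prod>j = 1..i. poly D (u - of_nat j) / (poly A (- of_nat j) * poly B (2 * u - of_nat j)))"

abbreviation alp :: "complex \<Rightarrow> complex" where "alp \<equiv> alpha_at R D A B"

abbreviation G :: "complex \<Rightarrow> complex" where "G \<equiv> step_factor D B"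

text \<open>The rational function \<open>\<beta>(u)\<close>, written with \<open>f\<^sub>1(u) = F 1 (u +
  1)\<close> and \<open>f\<^sub>2(u) = F 2 (u + 2)\<close>.\<close>

definition bet :: "complex \<Rightarrow> complex" where
  "bet u = F 2 (u + 1) - F 2 (u + 2) - F 1 (u + 1) * (alp (u + 1) + poly R u)"

lemma F_0 [simp]: "F 0 u = 1"
  by (simp add: F_def)

lemma F_Suc: "F (Suc i) u = F i u *
    (poly D (u - of_nat (Suc i)) / (poly A (- of_nat (Suc i)) * poly B (2 * u - of_nat (Suc i))))"
  unfolding F_def by (subst prod.nat_ivl_Suc') (simp_all add: mult.commute)

lemma F_1: "F 1 u = poly D (u - 1) / (poly A (-1) * poly B (2 * u - 1))"
  by (simp add: F_def)

lemma alp_F: "alp u = F 1 u - F 1 (u + 1) - poly R u"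
proof -
  have e: "u + 1 - 1 = u" "2 * (u + 1) - 1 = 2 * u + 1" by simp_all
  show ?thesis by (simp only: alpha_at_def F_1 e)
qed

lemma A_nz: "poly A (- of_nat (Suc i)) \<noteq> 0"
  by (rule A) simp

lemma F_Suc_mult:
  assumes "poly B (2 * u - of_nat (Suc i)) \<noteq> 0"
  shows "F (Suc i) u * (poly A (- of_nat (Suc i)) * poly B (2 * u - of_nat (Suc i))) =
    F i u * poly D (u - of_nat (Suc i))"
  unfolding F_Suc using assms A_nz[of i] by (simp del: of_nat_Suc)

text \<open>Raising the row index changes the coefficient by a rational factor, because \<open>A\<close> depends
  only on \<open>s - u\<close> and \<open>B\<close> only on \<open>s + u\<close>, so that the quotient of the two products telescopes.\<close>

lemma F_contiguous:
  assumes "\<And>j. j \<le> i + 1 \<Longrightarrow> poly B (2 * u + 1 - of_nat j) \<noteq> 0"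
  shows "poly A (- of_nat (Suc i)) * F (Suc i) (u + 1) = G u * poly B (2 * u - of_nat i) * F i u"
  using assms
proof (induction i)
  case 0
  have "poly B (2 * u + 1) \<noteq> 0" "poly B (2 * u) \<noteq> 0" using 0[of 0] 0[of 1] by simp_all
  thus ?case using A_nz[of 0] by (simp add: F_1[unfolded One_nat_def] step_factor_def algebra_simps)
next
  case (Suc i)
  have nz: "poly B (2 * u - of_nat i) \<noteq> 0" "poly B (2 * u - of_nat (Suc i)) \<noteq> 0"
    using Suc.prems[of "i + 1"] Suc.prems[of "i + 2"] by (simp_all add: algebra_simps)
  have IH: "poly A (- of_nat (Suc i)) * F (Suc i) (u + 1) = G u * poly B (2 * u - of_nat i) * F i u"
    by (rule Suc.IH) (rule Suc.prems, simp)
  have e: "2 * (u + 1) - of_nat (Suc (Suc i)) = 2 * u - (of_nat i :: complex)"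
    "u + 1 - of_nat (Suc (Suc i)) = u - (of_nat (Suc i) :: complex)" by simp_all
  define x where "x = poly A (- of_nat (Suc i))"
  define y where "y = poly A (- of_nat (Suc (Suc i)))"
  define d where "d = poly D (u - of_nat (Suc i))"
  have xy: "x \<noteq> 0" "y \<noteq> 0" unfolding x_def y_def by (rule A_nz)+
  have 1: "F (Suc (Suc i)) (u + 1) * (y * poly B (2 * u - of_nat i)) = F (Suc i) (u + 1) * d"
    using F_Suc_mult[of "u + 1" "Suc i"] nz(1) unfolding e y_def d_def by blast
  have 2: "F (Suc i) u * (x * poly B (2 * u - of_nat (Suc i))) = F i u * d"
    using F_Suc_mult[of u i] nz(2) unfolding x_def d_def by blast
  have "(y * F (Suc (Suc i)) (u + 1)) * (poly B (2 * u - of_nat i) * x) =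
      (F (Suc (Suc i)) (u + 1) * (y * poly B (2 * u - of_nat i))) * x" by (simp add: ac_simps)
  also have "\<dots> = (x * F (Suc i) (u + 1)) * d" unfolding 1 by (simp add: ac_simps)
  also have "\<dots> = G u * poly B (2 * u - of_nat i) * (F i u * d)"
    using IH unfolding x_def by (simp add: ac_simps)
  also have "\<dots> = (G u * poly B (2 * u - of_nat (Suc i)) * F (Suc i) u) * (poly B (2 * u - of_nat i) * x)"
    unfolding 2[symmetric] by (simp add: ac_simps)
  finally show ?case using xy nz unfolding y_def by (metis mult_cancel_right mult_eq_0_iff)
qed

text \<open>By contiguity every term is a multiple of \<open>F m (u - 1)\<close>, and the multiples add up to
  the kernel polynomial at \<open>k = u - (m + 1)\<close>.\<close>

lemma coefficient_recurrence_aux: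
  assumes nz: "\<And>j. j \<le> m + 3 \<Longrightarrow> poly B (2 * u + 1 - of_nat j) \<noteq> 0"
    and K: "\<And>k. kernel_poly R D A B u k = K * (poly A (k - u - 1) * poly A (k - u))"
  shows "F (m + 2) u - (poly R (u - of_nat (m + 1)) + alp u) * F (m + 1) u - F (m + 2) (u + 1)
    = G (u - 1) * K * F m (u - 1)"
proof -
  define a1 where "a1 = poly A (- of_nat (m + 1))"
  define a2 where "a2 = poly A (- of_nat (m + 2))"
  define b1 where "b1 = poly B (2 * u - of_nat (m + 1))"
  define b2 where "b2 = poly B (2 * u - of_nat (m + 2))"
  define d where "d = poly D (u - of_nat (m + 2))"
  define r where "r = poly R (u - of_nat (m + 1)) + alp u"
  have a: "a1 \<noteq> 0" "a2 \<noteq> 0" using A_nz[of m] A_nz[of "m + 1"] by (simp_all add: a1_def a2_def)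
  have b2: "b2 \<noteq> 0" using nz[of "m + 3"] by (simp add: b2_def algebra_simps)
  have 1: "a1 * F (m + 1) u = G (u - 1) * b2 * F m (u - 1)"
  proof -
    have "poly B (2 * (u - 1) + 1 - of_nat j) \<noteq> 0" if "j \<le> m + 1" for j
      using nz[of "j + 2"] that by (simp add: algebra_simps)
    hence c: "poly A (- of_nat (Suc m)) * F (Suc m) (u - 1 + 1) =
        G (u - 1) * poly B (2 * (u - 1) - of_nat m) * F m (u - 1)" by (rule F_contiguous)
    have "u - 1 + 1 = u" "2 * (u - 1) - of_nat m = 2 * u - of_nat (m + 2)" "Suc m = m + 1"
      by simp_all
    from c[unfolded this] show ?thesis unfolding a1_def b2_def .
  qed
  have 2: "F (m + 2) u * (a2 * b2) = F (m + 1) u * d"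
  proof -
    have e: "Suc (m + 1) = m + 2" by simp
    show ?thesis using F_Suc_mult[of u "m + 1"] b2 unfolding a2_def b2_def d_def e by blast
  qed
  have 3: "a2 * F (m + 2) (u + 1) = G u * b1 * F (m + 1) u"
  proof -
    have e: "Suc (m + 1) = m + 2" by simp
    have "poly A (- of_nat (Suc (m + 1))) * F (Suc (m + 1)) (u + 1) =
        G u * poly B (2 * u - of_nat (m + 1)) * F (m + 1) u"
      by (rule F_contiguous) (use nz in simp)
    thus ?thesis unfolding a2_def b1_def e .
  qed
  have 4: "d - r * b2 * a2 - G u * b1 * b2 = K * (a2 * a1)"
  proof -
    have e: "u - of_nat (m + 1) - 1 = u - of_nat (m + 2)"
      "2 * u - of_nat (m + 1) - 1 = 2 * u - of_nat (m + 2)"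
      "- of_nat (m + 1) - 1 = - (of_nat (m + 2) :: complex)"
      "u - of_nat (m + 1) + u = 2 * u - of_nat (m + 1)"
      "u - of_nat (m + 1) - u - 1 = - of_nat (m + 2)"
      "u - of_nat (m + 1) - u = - of_nat (m + 1)" by simp_all
    show ?thesis using K[of "u - of_nat (m + 1)"]
      unfolding kernel_poly_def e unfolding d_def r_def a1_def a2_def b1_def b2_def .
  qed
  have "(F (m + 2) u - r * F (m + 1) u - F (m + 2) (u + 1)) * (a2 * b2)
      = F (m + 2) u * (a2 * b2) - r * b2 * a2 * F (m + 1) u - (a2 * F (m + 2) (u + 1)) * b2"
    by (simp add: algebra_simps)
  also have "\<dots> = F (m + 1) u * (d - r * b2 * a2 - G u * b1 * b2)"
    unfolding 2 3 by (simp add: algebra_simps)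
  also have "\<dots> = K * a2 * (a1 * F (m + 1) u)" unfolding 4 by (simp add: ac_simps)
  also have "\<dots> = (G (u - 1) * K * F m (u - 1)) * (a2 * b2)" unfolding 1 by (simp add: ac_simps)
  finally show ?thesis using a b2 unfolding r_def by (metis mult_cancel_right mult_eq_0_iff)
qed

lemma kernel_ex:
  assumes "\<And>j. j \<le> (3::nat) \<Longrightarrow> poly B (2 * u + 1 - of_nat j) \<noteq> 0"
  shows "\<exists>K. (\<forall>k. kernel_poly R D A B u k = K * (poly A (k - u - 1) * poly A (k - u))) \<and>
    bet (u - 1) = G (u - 1) * K"
proof -
  have "poly B (2 * u + 1) \<noteq> 0" "poly B (2 * u) \<noteq> 0" "poly B (2 * u - 1) \<noteq> 0"
    using assms[of 0] assms[of 1] assms[of 2] by simp_all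
  then obtain K where K: "\<And>k. kernel_poly R D A B u k = K * (poly A (k - u - 1) * poly A (k - u))"
    using kernel[of u] by blast
  have e: "u - 1 + 1 = u" "u - 1 + 2 = u + 1" "u - of_nat (0 + 1) = u - 1" "0 + 2 = (2::nat)" "0 + 1 = (1::nat)"
    by simp_all
  have "F (0 + 2) u - (poly R (u - of_nat (0 + 1)) + alp u) * F (0 + 1) u - F (0 + 2) (u + 1)
    = G (u - 1) * K * F 0 (u - 1)"
    by (rule coefficient_recurrence_aux) (use assms K in simp_all)
  hence "bet (u - 1) = G (u - 1) * K" unfolding bet_def e F_0 by (simp add: algebra_simps)
  with K show ?thesis by blast
qed

text \<open>The number \<open>K\<close> is the same for all \<open>k\<close>, so that any convenient
  \<open>k\<close> serves to compute \<open>\<beta>\<close>.\<close>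

lemma bet_kernel:
  assumes "\<And>j. j \<le> (3::nat) \<Longrightarrow> poly B (2 * u + 1 - of_nat j) \<noteq> 0"
  shows "bet (u - 1) * (poly A (k - u - 1) * poly A (k - u)) = G (u - 1) * kernel_poly R D A B u k"
proof -
  obtain K where "\<And>k. kernel_poly R D A B u k = K * (poly A (k - u - 1) * poly A (k - u))"
    "bet (u - 1) = G (u - 1) * K"
    using kernel_ex[of u] assms by blast
  thus ?thesis by (simp only: mult.assoc)
qed

lemma coefficient_recurrence:
  assumes nz: "\<And>j. j \<le> m + 3 \<Longrightarrow> poly B (2 * u + 1 - of_nat j) \<noteq> 0"
  shows "F (m + 2) (u + 1) = F (m + 2) u - (poly R (u - of_nat (m + 1)) + alp u) * F (m + 1) u
    - bet (u - 1) * F m (u - 1)"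
proof -
  obtain K where K: "\<And>k. kernel_poly R D A B u k = K * (poly A (k - u - 1) * poly A (k - u))"
    "bet (u - 1) = G (u - 1) * K"
  proof -
    have "poly B (2 * u + 1 - of_nat j) \<noteq> 0" if "j \<le> 3" for j
      using nz[of j] that by simp
    hence "\<exists>K. (\<forall>k. kernel_poly R D A B u k = K * (poly A (k - u - 1) * poly A (k - u))) \<and>
      bet (u - 1) = G (u - 1) * K" by (rule kernel_ex)
    thus ?thesis using that by blast
  qed
  have "F (m + 2) u - (poly R (u - of_nat (m + 1)) + alp u) * F (m + 1) u - F (m + 2) (u + 1)
    = bet (u - 1) * F m (u - 1)"
    unfolding K(2) by (rule coefficient_recurrence_aux) (use nz K in simp_all)
  thus ?thesis by (simp only: algebra_simps) 
qed

lemma eventually_B: "\<forall>\<^sub>F z in at w. poly B (2 * z + c) \<noteq> 0"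
proof -
  have "B \<circ>\<^sub>p [:c, 2:] \<noteq> 0" using B by (simp add: pcompose_eq_0_iff)
  from eventually_poly_nonzero[OF this, of w] show ?thesis
    by (simp add: poly_pcompose add.commute mult.commute)
qed

lemma eventually_B_range:
  "\<forall>\<^sub>F z in at w. \<forall>j\<le>n. poly B (2 * z + c - of_nat j) \<noteq> 0"
proof -
  have "\<forall>\<^sub>F z in at w. \<forall>j\<in>{..n}. poly B (2 * z + (c - of_nat j)) \<noteq> 0"
    by (intro eventually_ball_finite ballI eventually_B) simp
  thus ?thesis by (simp add: add_diff_eq Ball_def)
qed

lemma F_tendsto:
  assumes "\<And>j. 1 \<le> j \<Longrightarrow> j \<le> i \<Longrightarrow> poly B (2 * w - of_nat j) \<noteq> 0"
  shows "(F i \<longlongrightarrow> F i w) (at w)"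
  unfolding F_def[abs_def] using assms A by (intro tendsto_intros) auto

lemma numerator_values:
  "poly (poly N [:of_nat j, 1:]) z = poly A (- of_nat j) * poly B (2 * z + of_nat j)"
  unfolding eval_us_diag N by (simp add: algebra_simps)

lemma hg_f1_at:
  assumes "poly B (2 * z + 1) \<noteq> 0"
  shows "no_pole (hg_f1 f) z" "rat_val (hg_f1 f) z = F 1 (z + 1)"
proof -
  have nz: "poly (poly N [:of_nat 1, 1:]) z \<noteq> 0"
    unfolding numerator_values using assms A_nz[of 0] by simp
  show "no_pole (hg_f1 f) z" unfolding f hg_f1_Fract[OF D] by (rule no_pole_Fract[OF nz])
  show "rat_val (hg_f1 f) z = F 1 (z + 1)"
    unfolding f hg_f1_Fract[OF D] rat_val_Fract[OF nz] unfolding numerator_values F_1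
    by (simp add: algebra_simps)
qed

lemma F_2: "F 2 u = poly D (u - 1) / (poly A (-1) * poly B (2 * u - 1)) *
    (poly D (u - 2) / (poly A (-2) * poly B (2 * u - 2)))"
  using F_Suc[of 1 u] F_1[of u] by (simp add: numeral_2_eq_2)

lemma hg_f2_at:
  assumes "poly B (2 * z + 2) \<noteq> 0" "poly B (2 * z + 3) \<noteq> 0"
  shows "no_pole (hg_f2 f) z" "rat_val (hg_f2 f) z = F 2 (z + 2)"
proof -
  have nz: "poly (poly N [:of_nat 2, 1:]) z \<noteq> 0"
    unfolding numerator_values using assms A_nz[of 1] by simp
  have "poly B (2 * (z + 1) + 1) \<noteq> 0" using assms(2) by (simp add: algebra_simps)
  note f1 = hg_f1_at[OF this]
  have f2: "hg_f2 f = Fract D (poly N [:of_nat 2, 1:]) * rat_shift 1 (hg_f1 f)"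
    unfolding hg_f2_def by (subst (1) f) (simp only: diag_shift_quot[OF D] inverse_fract)
  show "no_pole (hg_f2 f) z" unfolding f2
    by (intro no_pole_mult no_pole_Fract[OF nz] no_pole_shift f1)
  have e: "z + 1 + 1 = z + 2" "z + 2 - 1 = z + 1" "z + 2 - 2 = z" "2 * (z + 2) - 1 = 2 * z + 3"
    "2 * (z + 2) - 2 = 2 * z + 2" by simp_all
  have "rat_val (hg_f2 f) z = poly D z / (poly A (-2) * poly B (2 * z + 2)) * F 1 (z + 2)"
    unfolding f2 rat_val_mult[OF no_pole_Fract[OF nz] no_pole_shift[OF f1(1)]]
      rat_val_Fract[OF nz] rat_val_shift[OF f1(1)] f1(2)
    unfolding numerator_values e by simp
  also have "\<dots> = F 2 (z + 2)" unfolding F_2 F_1 e by (rule mult.commute)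
  finally show "rat_val (hg_f2 f) z = F 2 (z + 2)" .
qed

lemma alpha_fun_at:
  assumes "poly B (2 * z - 1) \<noteq> 0" "poly B (2 * z + 1) \<noteq> 0"
  shows "no_pole (alpha_fun R f) z" "rat_val (alpha_fun R f) z = alp z"
proof -
  have "poly B (2 * (z + -1) + 1) \<noteq> 0" using assms(1) by (simp add: algebra_simps)
  note m = hg_f1_at[OF this] and f1 = hg_f1_at[OF assms(2)]
  note ms = no_pole_shift[OF m(1)] rat_val_shift[OF m(1)]
  show "no_pole (alpha_fun R f) z" unfolding alpha_fun_def
    by (intro no_pole_diff ms f1 no_pole_to_fract)
  show "rat_val (alpha_fun R f) z = alp z" unfolding alpha_fun_def
    by (simp only: rat_val_diff no_pole_diff ms m f1 no_pole_to_fract rat_val_to_fract) (simp add: alp_F)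
qed

lemma beta_fun_at:
  assumes "poly B (2 * z) \<noteq> 0" "poly B (2 * z + 1) \<noteq> 0" "poly B (2 * z + 2) \<noteq> 0" "poly B (2 * z + 3) \<noteq> 0"
  shows "no_pole (beta_fun R f) z" "rat_val (beta_fun R f) z = bet z"
proof -
  have "poly B (2 * (z + -1) + 2) \<noteq> 0" "poly B (2 * (z + -1) + 3) \<noteq> 0"
    using assms(1,2) by (simp_all add: algebra_simps)
  note m = hg_f2_at[OF this] and f1 = hg_f1_at[OF assms(2)] and f2 = hg_f2_at[OF assms(3,4)]
  note ms = no_pole_shift[OF m(1)] rat_val_shift[OF m(1)]
  have "poly B (2 * (z + 1) - 1) \<noteq> 0" "poly B (2 * (z + 1) + 1) \<noteq> 0"
    using assms(2,4) by (simp_all add: algebra_simps)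
  note a = alpha_fun_at[OF this]
  note as = no_pole_shift[OF a(1)] rat_val_shift[OF a(1)]
  show "no_pole (beta_fun R f) z" unfolding beta_fun_def
    by (intro no_pole_diff no_pole_add no_pole_mult ms f1 f2 as no_pole_to_fract)
  have e: "z + -1 + 2 = z + 1" by simp
  show "rat_val (beta_fun R f) z = bet z" unfolding beta_fun_def
    by (simp only: rat_val_diff rat_val_add rat_val_mult no_pole_diff no_pole_add no_pole_mult
        ms m f1 f2 a as no_pole_to_fract rat_val_to_fract bet_def e)
qed

lemma eventually_alpha_fun: "\<forall>\<^sub>F z in at w. alp z = rat_val (alpha_fun R f) z"
  using eventually_B[of "-1" w] eventually_B[of 1 w]
  by eventually_elim (use alpha_fun_at in simp)

lemma eventually_beta_fun: "\<forall>\<^sub>F z in at w. bet z = rat_val (beta_fun R f) z"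
  using eventually_B[of 0 w] eventually_B[of 1 w] eventually_B[of 2 w] eventually_B[of 3 w]
  by eventually_elim (use beta_fun_at in simp)

lemma eventually_f1: "\<forall>\<^sub>F z in at w. F 1 (z + 1) = rat_val (hg_f1 f) z"
  using eventually_B[of 1 w] by eventually_elim (use hg_f1_at in simp)

lemma eventually_f2: "\<forall>\<^sub>F z in at w. F 2 (z + 2) = rat_val (hg_f2 f) z"
  using eventually_B[of 2 w] eventually_B[of 3 w] by eventually_elim (use hg_f2_at in simp)

lemma diag_shift_nonzero:
  assumes "j > 0"
  shows "diag_shift j f \<noteq> 0"
proof -
  obtain z where "poly B (2 * z + of_nat j) \<noteq> 0"
    using eventually_happens[OF eventually_B[of "of_nat j" 0]] by auto
  hence "poly (poly N [:of_nat j, 1:]) z \<noteq> 0" unfolding numerator_values using A[OF assms] by simp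
  hence "poly N [:of_nat j, 1:] \<noteq> 0" by auto
  thus ?thesis unfolding f diag_shift_quot[OF D] using D by (simp add: eq_fract Zero_fract_def)
qed

text \<open>The coefficient \<open>c(n,k)\<close> of the canonical family is the limit of \<open>F (n - k) u\<close> as \<open>u\<close> tends to \<open>n\<close>, which may exist although factors of the denominator vanish. The limit 0 of \<open>F (n + 1)\<close> stands for \<open>c(n,-1) = 0\<close>; for \<open>n = 1\<close> it is not demanded, since \<open>\<beta>\<^sub>0\<close> is defined so as to make the recurrence hold there.\<close>

definition limits_exist :: bool where
  "limits_exist \<longleftrightarrow> (\<forall>n i. i \<le> n \<longrightarrow> (\<exists>l. (F i \<longlongrightarrow> l) (at (of_nat n)))) \<and>
     (\<forall>n\<ge>2. (F (n + 1) \<longlongrightarrow> 0) (at (of_nat n)))"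

text \<open>A finite limit of a rational function excludes a pole, so the existence of the limits already
  yields the finiteness conditions.\<close>

lemma finite_from_limits:
  assumes "(F 1 \<longlongrightarrow> l1) (at (of_nat n + 1))" "(F 2 \<longlongrightarrow> l2) (at (of_nat n + 2))"
  shows "f1_finite f n" "f2_finite f n" "rat_val (hg_f1 f) (of_nat n) = l1" "rat_val (hg_f2 f) (of_nat n) = l2"
proof -
  have "(rat_val (hg_f1 f) \<longlongrightarrow> l1) (at (of_nat n))"
    by (rule Lim_transform_eventually[OF tendsto_shift[OF assms(1)] eventually_f1])
  note r1 = rat_val_limit[OF this]
  have "(rat_val (hg_f2 f) \<longlongrightarrow> l2) (at (of_nat n))"
    by (rule Lim_transform_eventually[OF tendsto_shift[OF assms(2)] eventually_f2])
  note r2 = rat_val_limit[OF this]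
  show "f1_finite f n" "f2_finite f n"
    using r1 r2 diag_shift_nonzero[of 1] diag_shift_nonzero[of 2] by (simp_all add: f1_finite_def f2_finite_def)
  show "rat_val (hg_f1 f) (of_nat n) = l1" "rat_val (hg_f2 f) (of_nat n) = l2"
    by (rule r1 r2)+
qed

lemma alp_tendsto:
  assumes "(F 1 \<longlongrightarrow> l) (at w)" "(F 1 \<longlongrightarrow> l') (at (w + 1))"
  shows "(alp \<longlongrightarrow> l - l' - poly R w) (at w)"
proof -
  have "alp = (\<lambda>u. F 1 u - F 1 (u + 1) - poly R u)" by (rule ext) (rule alp_F)
  thus ?thesis using assms by (auto intro!: tendsto_intros tendsto_shift)
qed

lemma bet_tendsto:
  assumes "(F 2 \<longlongrightarrow> l) (at (w + 1))" "(F 2 \<longlongrightarrow> l') (at (w + 2))" "(F 1 \<longlongrightarrow> l1) (at (w + 1))"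
    "(alp \<longlongrightarrow> a) (at (w + 1))"
  shows "(bet \<longlongrightarrow> l - l' - l1 * (a + poly R w)) (at w)"
  unfolding bet_def[abs_def] using assms by (auto intro!: tendsto_intros tendsto_shift)

lemma alpha_fun_limit:
  assumes "(F 1 \<longlongrightarrow> l) (at w)" "(F 1 \<longlongrightarrow> l') (at (w + 1))"
  shows "rat_val (alpha_fun R f) w = l - l' - poly R w"
  by (rule rat_val_eq_limit, rule Lim_transform_eventually[OF alp_tendsto[OF assms] eventually_alpha_fun])

lemma beta_fun_limit:
  assumes "(F 2 \<longlongrightarrow> l) (at (w + 1))" "(F 2 \<longlongrightarrow> l') (at (w + 2))" "(F 1 \<longlongrightarrow> l1) (at (w + 1))"
    "(alp \<longlongrightarrow> a) (at (w + 1))"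
  shows "rat_val (beta_fun R f) w = l - l' - l1 * (a + poly R w)"
  by (rule rat_val_eq_limit, rule Lim_transform_eventually[OF bet_tendsto[OF assms] eventually_beta_fun])

text \<open>The relation defining an HG-family and the recurrence for its coefficients hold for generic
  \<open>u\<close> and pass to the limit.\<close>

theorem canonical_family:
  assumes limits_exist
  shows "(\<forall>n. f1_finite f n \<and> f2_finite f n) \<and>
    (\<exists>P. HG_family R f P \<and> three_term (alpha R f) (beta R f) P)"
proof -
  define L where "L i n = (THE l. (F i \<longlongrightarrow> l) (at (of_nat n)))" for i n
  have L: "(F i \<longlongrightarrow> L i n) (at (of_nat n))" if "i \<le> n" for i n
  proof -
    obtain l where l: "(F i \<longlongrightarrow> l) (at (of_nat n))" using assms \<open>i \<le> n\<close> unfolding limits_exist_def by blast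
    hence "L i n = l" unfolding L_def by (intro the_equality LIM_unique[OF _ l])
    with l show ?thesis by simp
  qed
  have L0: "L 0 n = 1" for n
    using LIM_unique[OF L[of 0 n], of 1] by (simp add: F_def[abs_def])
  have L1: "(F 1 \<longlongrightarrow> L 1 (n + 1)) (at (of_nat n + 1))" for n using L[of 1 "n + 1"] by (simp add: add.commute)
  have L2: "(F 2 \<longlongrightarrow> L 2 (n + 2)) (at (of_nat n + 2))" for n using L[of 2 "n + 2"] by (simp add: add.commute)
  note fin = finite_from_limits[OF L1 L2]
  have L11: "(F 1 \<longlongrightarrow> L 1 (n + 2)) (at (of_nat n + 1 + 1))" for n
    using L1[of "n + 1"] by (simp add: ac_simps)
  have L21: "(F 2 \<longlongrightarrow> L 2 (n + 2)) (at (of_nat n + 1 + 1))" for n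
    using L2[of "n"] by (simp add: ac_simps)
  have L22: "(F 2 \<longlongrightarrow> L 2 (n + 3)) (at (of_nat n + 1 + 2))" for n
    using L2[of "n + 1"] by (simp add: ac_simps numeral_3_eq_3)
  have alpha: "alpha R f (n + 1) = L 1 (n + 1) - L 1 (n + 2) - poly R (of_nat n + 1)" for n
    using alpha_fun_limit[OF L1[of n] L11] by (simp add: alpha_def add.commute)
  have alpha0: "alpha R f 0 = - L 1 1 - poly R 0"
    using fin(3)[of 0] by (simp add: alpha_def)
  have alp: "(alp \<longlongrightarrow> alpha R f (n + 1)) (at (of_nat n + 1))" for n
    unfolding alpha by (rule alp_tendsto[OF L1 L11])
  have alp': "(alp \<longlongrightarrow> alpha R f (n + 2)) (at (of_nat n + 1 + 1))" for n
    using alp[of "n + 1"] by (simp add: ac_simps)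
  have beta: "beta R f (n + 1) = L 2 (n + 2) - L 2 (n + 3) - L 1 (n + 2) * (alpha R f (n + 2) + poly R (of_nat n + 1))" for n
    using beta_fun_limit[OF L21 L22 L11 alp', of n] by (simp add: beta_def add.commute)
  have bet: "(bet \<longlongrightarrow> beta R f (n + 1)) (at (of_nat n + 1))" for n
    unfolding beta by (rule bet_tendsto[OF L21 L22 L11 alp'])
  have beta0: "beta R f 0 = - L 2 2 - L 1 1 * (alpha R f 1 + poly R 0)"
    using fin(3,4)[of 0] by (simp add: beta_def alpha_def numeral_2_eq_2)
  define C where "C n k = (if k \<le> n then L (n - k) n else 0)" for n k
  define P where "P n = (\<Sum>k\<le>n. smult (C n k) (newton_basis R k))" for n
  have rel: "poly D (of_nat k) * C n (k + 1) = eval_us N (of_nat n) (of_nat k) * C n k" for n k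
  proof (cases "k < n")
    case True
    define i where "i = n - k - 1"
    have i: "n = k + Suc i" using True by (simp add: i_def)
    let ?w = "of_nat n :: complex"
    have "\<forall>\<^sub>F u in at ?w. F (Suc i) u * (poly A (- of_nat (Suc i)) * poly B (2 * u - of_nat (Suc i))) =
        F i u * poly D (u - of_nat (Suc i))"
      using eventually_B[of "- of_nat (Suc i)" ?w]
      by eventually_elim (rule F_Suc_mult, simp add: algebra_simps)
    moreover have "((\<lambda>u. F (Suc i) u * (poly A (- of_nat (Suc i)) * poly B (2 * u - of_nat (Suc i)))) \<longlongrightarrow>
        L (Suc i) n * (poly A (- of_nat (Suc i)) * poly B (2 * ?w - of_nat (Suc i)))) (at ?w)"
      by (intro tendsto_intros L) (simp add: i)
    ultimately have lim: "((\<lambda>u. F i u * poly D (u - of_nat (Suc i))) \<longlongrightarrow>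
        L (Suc i) n * (poly A (- of_nat (Suc i)) * poly B (2 * ?w - of_nat (Suc i)))) (at ?w)"
      by (rule Lim_transform_eventually[rotated])
    have "((\<lambda>u. F i u * poly D (u - of_nat (Suc i))) \<longlongrightarrow> L i n * poly D (?w - of_nat (Suc i))) (at ?w)"
      by (intro tendsto_intros L) (simp add: i)
    from LIM_unique[OF lim this]
    have "L (Suc i) n * (poly A (- of_nat (Suc i)) * poly B (2 * ?w - of_nat (Suc i))) =
      L i n * poly D (?w - of_nat (Suc i))" .
    moreover have "C n k = L (Suc i) n" "C n (k + 1) = L i n" by (simp_all add: C_def i)
    moreover have e: "?w - of_nat (Suc i) = of_nat k" "- of_nat (Suc i) = of_nat k - ?w"
      "2 * ?w - of_nat (Suc i) = of_nat k + ?w" by (simp_all add: i)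
    ultimately show ?thesis unfolding N e by (simp only: mult.commute)
  next
    case False
    thus ?thesis using A0 by (cases "k = n") (simp_all add: C_def N)
  qed
  have C: "HG_coeffs R N D P C"
    unfolding HG_coeffs_def using rel by (auto simp: P_def C_def L0)
  have fam: "HG_family R f P" unfolding f using HG_familyI[OF C D D_neg1] lead by blast
  have rec: "C (n + 2) k = (if k = 0 then 0 else C (n + 1) (k - 1))
        - (poly R (of_nat k) + alpha R f (n + 1)) * C (n + 1) k - beta R f n * C n k" for n k
  proof -
    consider "k > n + 2" | "k = n + 2" | "k = n + 1" | "k \<le> n" by linarith
    thus ?thesis
    proof cases
      case 1
      thus ?thesis by (simp add: C_def)
    next
      case 2
      thus ?thesis by (simp add: C_def L0)
    next
      case 3
      thus ?thesis using alpha[of n] by (simp add: C_def L0 add.commute)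
    next
      case 4
      \<comment> \<open>For \<open>n = k = 0\<close> the term \<open>c(1,-1)\<close> is missing, and the equation is the definition of \<open>\<beta>\<^sub>0\<close>.\<close>
      show ?thesis
      proof (cases "n = 0")
        case True
        thus ?thesis using 4 by (simp add: beta0 C_def L0 algebra_simps numeral_2_eq_2)
      next
        case False
        define m where "m = n - k"
        define p where "p = n - 1"
        have n: "n = m + k" "n = p + 1" using 4 False by (simp_all add: m_def p_def)
        let ?w = "of_nat (n + 1) :: complex"
        have wn: "?w = of_nat n + 1" "?w + 1 = of_nat (n + 2)" "?w + - 1 = of_nat n" by simp_all
        have Lk: "(F (m + 2) \<longlongrightarrow> (if k = 0 then 0 else C (n + 1) (k - 1))) (at ?w)"
        proof (cases "k = 0")
          case True
          have "n + 1 \<ge> 2" using False by simp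
          hence "(F (n + 1 + 1) \<longlongrightarrow> 0) (at ?w)" using assms unfolding limits_exist_def by blast
          moreover have "n + 1 + 1 = m + 2" using True n by simp
          ultimately show ?thesis using True by simp
        next
          case False
          have "n + 1 - (k - 1) = m + 2" using False 4 by (simp add: m_def)
          hence "C (n + 1) (k - 1) = L (m + 2) (n + 1)" using 4 by (simp add: C_def)
          moreover have "(F (m + 2) \<longlongrightarrow> L (m + 2) (n + 1)) (at ?w)"
            by (rule L) (use False n(1) in simp)
          ultimately show ?thesis using False by (simp only: if_False)
        qed
        have "\<forall>\<^sub>F u in at ?w. F (m + 2) u - (poly R (u - of_nat (m + 1)) + alp u) * F (m + 1) u
            - bet (u + - 1) * F m (u + - 1) = F (m + 2) (u + 1)"
          using eventually_B_range[where w = ?w and n = "m + 3" and c = 1]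
        proof eventually_elim
          case (elim u)
          have "F (m + 2) (u + 1) = F (m + 2) u - (poly R (u - of_nat (m + 1)) + alp u) * F (m + 1) u
              - bet (u - 1) * F m (u - 1)"
            by (rule coefficient_recurrence) (use elim in blast)
          thus ?case by (simp only: diff_conv_add_uminus)
        qed
        moreover have "((\<lambda>u. F (m + 2) u - (poly R (u - of_nat (m + 1)) + alp u) * F (m + 1) u
            - bet (u + - 1) * F m (u + - 1)) \<longlongrightarrow> (if k = 0 then 0 else C (n + 1) (k - 1))
            - (poly R (?w - of_nat (m + 1)) + alpha R f (n + 1)) * L (m + 1) (n + 1) - beta R f n * L m n) (at ?w)"
        proof -
          have "(bet \<longlongrightarrow> beta R f n) (at (?w + - 1))" using bet[of p] by (simp add: n(2) add.commute)
          moreover have "(F m \<longlongrightarrow> L m n) (at (?w + - 1))" unfolding wn(3) by (rule L) (simp add: n(1))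
          moreover have "(alp \<longlongrightarrow> alpha R f (n + 1)) (at ?w)" using alp[of n] by (simp add: add.commute)
          moreover have "(F (m + 1) \<longlongrightarrow> L (m + 1) (n + 1)) (at ?w)" by (rule L) (simp add: n(1))
          ultimately show ?thesis by (intro tendsto_intros Lk tendsto_shift)
        qed
        ultimately have lim: "((\<lambda>u. F (m + 2) (u + 1)) \<longlongrightarrow> (if k = 0 then 0 else C (n + 1) (k - 1))
            - (poly R (?w - of_nat (m + 1)) + alpha R f (n + 1)) * L (m + 1) (n + 1) - beta R f n * L m n) (at ?w)"
          by (rule Lim_transform_eventually[rotated])
        have "((\<lambda>u. F (m + 2) (u + 1)) \<longlongrightarrow> L (m + 2) (n + 2)) (at ?w)"
          by (rule tendsto_shift, unfold wn(2), rule L) (simp add: n(1))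
        from LIM_unique[OF this lim]
        have "L (m + 2) (n + 2) = (if k = 0 then 0 else C (n + 1) (k - 1))
            - (poly R (?w - of_nat (m + 1)) + alpha R f (n + 1)) * L (m + 1) (n + 1) - beta R f n * L m n" .
        moreover have "C (n + 2) k = L (m + 2) (n + 2)" "C (n + 1) k = L (m + 1) (n + 1)" "C n k = L m n"
          by (simp_all add: C_def n(1))
        moreover have "?w - of_nat (m + 1) = of_nat k" by (simp add: n(1))
        ultimately show ?thesis by simp
      qed
    qed
  qed
  have "three_term (alpha R f) (beta R f) P" unfolding three_term_def
  proof (intro conjI allI)
    show "P 0 = 1" by (simp add: P_def C_def L0)
    show "P 1 = [:- alpha R f 0, 1:]" by (simp add: P_def C_def L0 alpha0)
    show "P (n + 2) = [:- alpha R f (n + 1), 1:] * P (n + 1) - smult (beta R f n) (P n)" for n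
      by (rule newton_sum_recurrence[OF P_def _ rec]) (simp add: C_def)
  qed
  with fam fin(1,2) show ?thesis by blast
qed

end

context factored_pair
begin

definition regular :: bool where
  "regular \<longleftrightarrow> (\<forall>i>0. poly B (of_nat i) \<noteq> 0)"

text \<open>Here the limits are values, and \<open>F (n + 1)\<close> vanishes at \<open>n\<close> because of
  its factor \<open>D(-1)\<close>.\<close>

lemma regular_limits:
  assumes regular
  shows limits_exist
proof -
  have nz: "poly B (2 * of_nat n - of_nat j) \<noteq> 0" if "j < 2 * n" for n j
  proof -
    have e: "(2 * of_nat n - of_nat j :: complex) = of_nat (2 * n - j)" using that by (simp add: of_nat_diff)
    show ?thesis unfolding e by (rule assms[unfolded regular_def, rule_format]) (use that in simp)
  qed
  have lim: "(F i \<longlongrightarrow> F i (of_nat n)) (at (of_nat n))" if "i \<le> n \<or> (n \<ge> 2 \<and> i = n + 1)" for i n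
    by (rule F_tendsto, rule nz) (use that in auto)
  have zero: "F (n + 1) (of_nat n) = 0" for n
  proof -
    have "of_nat n - of_nat (n + 1) = (-1 :: complex)" by simp
    thus ?thesis using F_Suc[of n "of_nat n"] D_neg1 by simp
  qed
  show ?thesis unfolding limits_exist_def
  proof (intro conjI allI impI)
    fix n i :: nat assume "i \<le> n"
    thus "\<exists>l. (F i \<longlongrightarrow> l) (at (of_nat n))" using lim by blast
  next
    fix n :: nat assume "2 \<le> n"
    thus "(F (n + 1) \<longlongrightarrow> 0) (at (of_nat n))" using lim[of "n + 1" n] by (simp add: zero[simplified])
  qed
qed

lemma eval_N_nat:
  assumes "k \<le> n"
  shows "eval_us N (of_nat n) (of_nat k) = poly A (- of_nat (n - k)) * poly B (of_nat (n + k))"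
  using assms by (simp add: N of_nat_diff add.commute)

lemma HG_rows_unique:
  assumes P: "HG_family R f P" "HG_family R f Q" and nz: "\<And>i. n \<le> i \<Longrightarrow> i > 0 \<Longrightarrow> poly B (of_nat i) \<noteq> 0"
  shows "P n = Q n"
proof -
  obtain C C' where C: "HG_coeffs R N D P C" "HG_coeffs R N D Q C'"
    using P HG_familyD[OF _ D] unfolding f by blast
  have "eval_us N (of_nat n) (of_nat k) \<noteq> 0" if "k < n" for k
    unfolding eval_N_nat[OF less_imp_le[OF that]] using nz[of "n + k"] A[of "n - k"] that by simp
  thus ?thesis by (rule HG_coeffs_row_unique[OF C])
qed

lemma regular_HG_iff:
  assumes regular
  shows "HG_family R f P \<longleftrightarrow> three_term (alpha R f) (beta R f) P"
proof -
  obtain Q where Q: "HG_family R f Q" "three_term (alpha R f) (beta R f) Q"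
    using canonical_family[OF regular_limits[OF assms]] by blast
  have "HG_family R f P \<Longrightarrow> P = Q"
    using HG_rows_unique[OF _ Q(1)] assms unfolding regular_def by blast
  thus ?thesis using Q three_term_unique by blast
qed

text \<open>For \<open>n = 0\<close> the terms \<open>f\<^sub>1(-1)\<close> and \<open>f\<^sub>2(-1)\<close> were removed by hand; when they vanish, nothing
  was removed.\<close>

lemma boundary_values:
  assumes lim: limits_exist and 0: "(F 1 \<longlongrightarrow> 0) (at 0)" "(F 2 \<longlongrightarrow> 0) (at 1)"
  shows "alpha R f 0 = rat_val (alpha_fun R f) 0" "beta R f 0 = rat_val (beta_fun R f) 0"
proof -
  have ex: "\<exists>l. (F i \<longlongrightarrow> l) (at (of_nat n))" if "i \<le> n" for i n
    using lim that unfolding limits_exist_def by blast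
  obtain l1 where l1: "(F 1 \<longlongrightarrow> l1) (at 1)" using ex[of 1 1] by auto
  obtain l1' where l1': "(F 1 \<longlongrightarrow> l1') (at 2)" using ex[of 1 2] by auto
  obtain l2 where l2: "(F 2 \<longlongrightarrow> l2) (at 2)" using ex[of 2 2] by auto
  have fin: "rat_val (hg_f1 f) 0 = l1" "rat_val (hg_f2 f) 0 = l2"
    using finite_from_limits[of l1 0 l2] l1 l2 by simp_all
  have two: "1 + 1 = (2::complex)" by simp
  have a1: "(alp \<longlongrightarrow> l1 - l1' - poly R 1) (at 1)"
    by (rule alp_tendsto) (simp_all only: l1 two l1')
  have a1v: "rat_val (alpha_fun R f) 1 = l1 - l1' - poly R 1"
    by (rule alpha_fun_limit) (simp_all only: l1 two l1')
  have "rat_val (alpha_fun R f) 0 = 0 - l1 - poly R 0"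
    by (rule alpha_fun_limit) (simp_all only: 0 add_0_left l1)
  thus "alpha R f 0 = rat_val (alpha_fun R f) 0" by (simp add: alpha_def fin)
  have "rat_val (beta_fun R f) 0 = 0 - l2 - l1 * (l1 - l1' - poly R 1 + poly R 0)"
    by (rule beta_fun_limit) (simp_all only: 0 add_0_left l1 l2 a1)
  thus "beta R f 0 = rat_val (beta_fun R f) 0" by (simp add: beta_def fin a1v)
qed

lemma regular_boundary_values:
  assumes regular and B: "poly B (-1) \<noteq> 0" "poly B 0 \<noteq> 0"
  shows "alpha R f 0 = rat_val (alpha_fun R f) 0" "beta R f 0 = rat_val (beta_fun R f) 0"
proof -
  have B1: "poly B 1 \<noteq> 0" using assms(1) unfolding regular_def by (metis of_nat_1 zero_less_one)
  have "(F 1 \<longlongrightarrow> F 1 0) (at 0)"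
    by (rule F_tendsto) (use B in \<open>simp add: le_Suc_eq\<close>)
  moreover have "F 1 0 = 0" using D_neg1 by (simp add: F_1[unfolded One_nat_def])
  ultimately have 1: "(F 1 \<longlongrightarrow> 0) (at 0)" by simp
  have "(F 2 \<longlongrightarrow> F 2 1) (at 1)"
  proof (rule F_tendsto)
    fix j :: nat assume "1 \<le> j" "j \<le> 2"
    hence "j = 1 \<or> j = 2" by linarith
    thus "poly B (2 * 1 - of_nat j) \<noteq> 0" using B B1 by auto
  qed
  moreover have "F 2 1 = 0" using D_neg1 by (simp add: F_2)
  ultimately have 2: "(F 2 \<longlongrightarrow> 0) (at 1)" by simp
  show "alpha R f 0 = rat_val (alpha_fun R f) 0" "beta R f 0 = rat_val (beta_fun R f) 0"
    by (rule boundary_values[OF regular_limits[OF assms(1)] 1 2])+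
qed

end

section \<open>The first case of the list\<close>

lemma eval_us_hom:
  "eval_us (x * y) a b = eval_us x a b * eval_us y a b"
  "eval_us (x + y) a b = eval_us x a b + eval_us y a b"
  "eval_us (x - y) a b = eval_us x a b - eval_us y a b"
  "eval_us 1 a b = 1" "eval_us (numeral n) a b = numeral n"
  "eval_us var_u a b = a" "eval_us var_s a b = b" "eval_us (const_us c) a b = c"
  by (simp_all add: eval_us_def var_u_def var_s_def const_us_def)

lemma eval_subst_us: "eval_us (subst_us q x) a b = poly q (eval_us x a b)"
proof -
  have "const_us 0 = 0" by (simp add: const_us_def)
  hence "poly (poly (poly (map_poly const_us q) x) [:a:]) b = poly q (poly (poly x [:a:]) b)"
    by (induction q) (simp_all add: map_poly_pCons, simp add: const_us_def)
  thus ?thesis by (simp add: subst_us_def eval_us_def)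
qed

definition num_a :: "complex poly \<Rightarrow> complex poly poly" where
  "num_a q = (var_s - var_u) * subst_us q (var_s + var_u)"

lemma eval_num_a: "eval_us (num_a q) u s = poly [:0, 1:] (s - u) * poly q (s + u)"
  by (simp add: num_a_def eval_us_hom eval_subst_us)

lemma degree_le_1_cases:
  assumes "degree q \<le> 1" obtains a b where "q = [:a, b:]"
proof -
  have "q = [:coeff q 0, coeff q 1:]"
    by (rule poly_eqI) (use assms in \<open>auto simp: coeff_pCons coeff_eq_0 split: nat.splits\<close>)
  thus ?thesis by (rule that)
qed

lemma degree_le_2_cases:
  assumes "degree q \<le> 2" obtains a b c where "q = [:a, b, c:]"
proof -
  have "q = [:coeff q 0, coeff q 1, coeff q 2:]"
    by (rule poly_eqI)
       (use assms in \<open>auto simp: coeff_pCons coeff_eq_0 numeral_2_eq_2 split: nat.splits\<close>)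
  thus ?thesis by (rule that)
qed

lemma num_a_linear:
  "num_a [:a, b:] = [:[:0, 1:], - 1:] * [:[:a, b:], [:b:]:]"
proof -
  have "const_us 0 = 0" by (simp add: const_us_def)
  hence "subst_us [:a, b:] (var_s + var_u) = [:[:a, b:], [:b:]:]"
    by (simp add: subst_us_def map_poly_pCons const_us_def var_s_def var_u_def one_pCons)
  thus ?thesis unfolding num_a_def by (simp only:) (simp add: var_s_def var_u_def one_pCons)
qed

lemma lead_num_a:
  assumes "degree q \<le> 1" "q \<noteq> 0"
  shows "\<exists>c. c \<noteq> 0 \<and> lead_coeff (num_a q) = [:c:]"
proof -
  obtain a b where q: "q = [:a, b:]" by (rule degree_le_1_cases[OF assms(1)])
  show ?thesis
  proof (cases "b = 0")
    case True
    thus ?thesis using assms(2) unfolding q num_a_linear lead_coeff_mult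
      by (intro exI[of _ "- a"]) simp
  next
    case False
    thus ?thesis unfolding q num_a_linear lead_coeff_mult
      by (intro exI[of _ "- b"]) simp
  qed
qed

text \<open>Here \<open>g\<close> and \<open>h\<close> stand for \<open>D(u) / (q(2u) q(2u+1))\<close> and
  \<open>D(u-1) / q(2u-1)\<close>. The polynomial \<open>X\<close> is quadratic in \<open>k\<close>, because
  \<open>(k-1) q(k-1) - (k-u-1) q(k+u-1) = u q(u)\<close> is the coefficient of \<open>R(k) - R(0)\<close>;
  the hypotheses say that \<open>u + 1\<close> and \<open>u\<close> are zeros.\<close>

lemma kernel_a_algebra:
  fixes q0 q1 r0 r1 r2 v0 v1 u k g h :: "'a :: field"
  defines "q \<equiv> \<lambda>x. q0 + x * q1" and "R \<equiv> \<lambda>x. r0 + x * (r1 + x * r2)"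
  defines "D \<equiv> \<lambda>x. x * q x * (R (x + 1) - r0) + (x + 1) * (v0 + x * v1)"
  defines "X \<equiv> \<lambda>k. D (k - 1) - (R k + (- h + g * q (2 * u) - R u)) * q (k + u - 1) * (k - u - 1)
     - g * q (k + u) * q (k + u - 1)"
  assumes g: "g * (q (2 * u) * q (2 * u + 1)) = D u" and h: "h * q (2 * u - 1) = D (u - 1)"
  shows "X k = (u * q u * r2 + v1 - (r0 - h + g * q (2 * u) - R u) * q1 - g * q1 * q1)
    * ((k - u - 1) * (k - u))"
proof -
  \<comment> \<open>Newton interpolation of a quadratic polynomial at the nodes \<open>u\<close> and \<open>u + 1\<close>\<close>
  have "X k = X u + (k - u) * (X (u + 1) - X u) +
    (u * q u * r2 + v1 - (r0 - h + g * q (2 * u) - R u) * q1 - g * q1 * q1) * ((k - u - 1) * (k - u))"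
    unfolding X_def D_def q_def R_def by algebra
  moreover have "X u = D (u - 1) - h * q (2 * u - 1)"
    unfolding X_def by (simp add: algebra_simps)
  moreover have "X (u + 1) = D u - g * (q (2 * u) * q (2 * u + 1))"
    unfolding X_def by (simp add: algebra_simps)
  ultimately show ?thesis using g h by simp
qed

lemma poly_den_a:
  "poly (den_a R q v) x = x * poly q x * (poly R (x + 1) - poly R 0) + (x + 1) * poly v x"
  by (simp add: den_a_def poly_pcompose algebra_simps)

text \<open>The case \<open>q = 0\<close> is \<open>f = 0\<close>, which belongs to no family.\<close>

locale pair_a =
  fixes R q v :: "complex poly" and f :: "complex poly fract poly"
  assumes deg: "degree R \<le> 2" "degree q \<le> 1" "degree v \<le> 1"
    and den: "den_a R q v \<noteq> 0" and q: "q \<noteq> 0"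
    and f_a: "f = quot_us (num_a q) (den_a R q v)"
begin

lemma kernel_a:
  assumes nz: "poly q (2 * u - 1) \<noteq> 0" "poly q (2 * u) \<noteq> 0" "poly q (2 * u + 1) \<noteq> 0"
  shows "\<exists>K. \<forall>k. kernel_poly R (den_a R q v) [:0, 1:] q u k =
    K * (poly [:0, 1:] (k - u - 1) * poly [:0, 1:] (k - u))"
proof -
  obtain r0 r1 r2 where R: "R = [:r0, r1, r2:]" by (rule degree_le_2_cases[OF deg(1)])
  obtain q0 q1 where qq: "q = [:q0, q1:]" by (rule degree_le_1_cases[OF deg(2)])
  obtain v0 v1 where v: "v = [:v0, v1:]" by (rule degree_le_1_cases[OF deg(3)])
  define D where "D = poly (den_a R q v)"
  define g where "g = step_factor (den_a R q v) q u"
  define h where "h = D (u - 1) / poly q (2 * u - 1)"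
  have p: "poly q x = q0 + x * q1" "poly R x = r0 + x * (r1 + x * r2)"
    "D x = x * (q0 + x * q1) * (r0 + (x + 1) * (r1 + (x + 1) * r2) - r0) + (x + 1) * (v0 + x * v1)" for x
    by (simp_all add: qq R D_def poly_den_a v)
  have g: "g * (poly q (2 * u) * poly q (2 * u + 1)) = D u"
    using nz by (simp add: g_def step_factor_def D_def)
  have h: "h * poly q (2 * u - 1) = D (u - 1)" using nz by (simp add: h_def)
  have alp: "alpha_at R (den_a R q v) [:0, 1:] q u = - h + g * poly q (2 * u) - poly R u"
    using nz by (simp add: alpha_at_def h_def g_def step_factor_def D_def)
  have id: "poly [:0, 1:] x = x" for x :: complex by simp
  have "kernel_poly R (den_a R q v) [:0, 1:] q u k =
    (u * poly q u * r2 + v1 - (r0 - h + g * poly q (2 * u) - poly R u) * q1 - g * q1 * q1)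
    * ((k - u - 1) * (k - u))" for k
    unfolding kernel_poly_def alp id D_def[symmetric] g_def[symmetric]
    unfolding p by (rule kernel_a_algebra) (use g h in \<open>simp_all only: p\<close>)
  thus ?thesis unfolding id by blast
qed

sublocale factored_pair R "den_a R q v" "[:0, 1:]" q "num_a q" f
proof
  show "poly (den_a R q v) (-1) = 0" by (simp add: poly_den_a)
  show "\<exists>a. a \<noteq> 0 \<and> lead_coeff (num_a q) = [:a:]" by (rule lead_num_a[OF deg(2) q])
qed (use f_a den q kernel_a in \<open>simp_all add: eval_num_a\<close>)

lemma q_roots:
  assumes "poly q x = 0" "poly q y = 0"
  shows "x = y"
proof -
  obtain q0 q1 where qq: "q = [:q0, q1:]" by (rule degree_le_1_cases[OF deg(2)])
  have "(x - y) * q1 = poly q x - poly q y" by (simp add: qq algebra_simps)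
  hence "(x - y) * q1 = 0" using assms by simp
  moreover have "q1 \<noteq> 0" using assms(1) q by (auto simp: qq)
  ultimately show ?thesis by simp
qed

text \<open>Evaluated at \<open>k = 0\<close>, where \<open>D(k - 1)\<close> vanishes, the kernel identity shows the factor \<open>q(u)\<close> of
  \<open>\<beta>(u)\<close>.\<close>

lemma bet_factor_q:
  assumes "poly q (2 * u) \<noteq> 0" "poly q (2 * u + 1) \<noteq> 0" "poly q (2 * u + 2) \<noteq> 0" "poly q (2 * u + 3) \<noteq> 0"
  shows "bet u * ((u + 1) * (u + 2)) =
    G u * poly q u * ((u + 2) * (poly R 0 + alp (u + 1)) - G (u + 1) * poly q (u + 1))"
proof -
  have nz: "poly q (2 * (u + 1) + 1 - of_nat j) \<noteq> 0" if "j \<le> (3::nat)" for j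
  proof -
    have "j = 0 \<or> j = 1 \<or> j = 2 \<or> j = 3" using that by linarith
    moreover have "2 * (u + 1) + 1 - of_nat 0 = 2 * u + 3" "2 * (u + 1) + 1 - of_nat 1 = 2 * u + 2"
      "2 * (u + 1) + 1 - of_nat 2 = 2 * u + 1" "2 * (u + 1) + 1 - of_nat 3 = 2 * u" by simp_all
    ultimately show ?thesis using assms by metis
  qed
  have e: "u + 1 - 1 = u" "0 - (u + 1) = - (u + 1)" "- (u + 1) - 1 = - (u + 2)" "0 + (u + 1) - 1 = u"
    "0 + (u + 1) = u + 1" "0 - 1 = (-1 :: complex)" by simp_all
  have id: "poly [:0, 1:] x = x" for x :: complex by simp
  have "bet (u + 1 - 1) * (poly [:0, 1:] (0 - (u + 1) - 1) * poly [:0, 1:] (0 - (u + 1))) =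
      G (u + 1 - 1) * kernel_poly R (den_a R q v) [:0, 1:] q (u + 1) 0"
    by (rule bet_kernel[OF nz])
  hence "bet u * (- (u + 2) * - (u + 1)) = G u *
      (0 - (poly R 0 + alp (u + 1)) * poly q u * - (u + 2) - G (u + 1) * poly q (u + 1) * poly q u)"
    unfolding kernel_poly_def e id D_neg1 .
  thus ?thesis by (simp add: algebra_simps)
qed

context
  fixes m :: nat
  assumes m: "m > 0" "poly q (of_nat m) = 0"
begin

lemma q_m: "poly q x = 0 \<longleftrightarrow> x = of_nat m"
  using m q_roots by blast

lemma q_form: "\<exists>q1. q1 \<noteq> 0 \<and> (\<forall>x. poly q x = q1 * (x - of_nat m))"
proof -
  obtain q0 q1 where qq: "q = [:q0, q1:]" by (rule degree_le_1_cases[OF deg(2)])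
  have q0: "q0 = - (of_nat m * q1)" using m(2) by (simp add: qq eq_neg_iff_add_eq_0)
  moreover have "q1 \<noteq> 0" using q by (auto simp: qq q0)
  ultimately show ?thesis by (intro exI[of _ q1]) (simp add: qq algebra_simps)
qed

lemma q_above: "poly q (2 * of_nat m + of_nat j) \<noteq> 0"
proof
  assume "poly q (2 * of_nat m + of_nat j) = 0"
  hence "of_nat (2 * m + j) = (of_nat m :: complex)" by (simp add: q_m)
  hence "2 * m + j = m" by (simp only: of_nat_eq_iff)
  thus False using m by simp
qed

lemma beta_m: "beta R f m = 0"
proof -
  have nz: "poly q (2 * of_nat m) \<noteq> 0" "poly q (2 * of_nat m + 1) \<noteq> 0"
    "poly q (2 * of_nat m + 2) \<noteq> 0" "poly q (2 * of_nat m + 3) \<noteq> 0"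
    using q_above[of 0] q_above[of 1] q_above[of 2] q_above[of 3] by simp_all
  have "bet (of_nat m) * ((of_nat m + 1) * (of_nat m + 2)) = 0"
    unfolding bet_factor_q[OF nz] m(2) by simp
  moreover have "of_nat m + 1 \<noteq> (0::complex)" "of_nat m + 2 \<noteq> (0::complex)"
    by (metis of_nat_Suc of_nat_eq_0_iff add.commute nat.simps(3),
        metis of_nat_add of_nat_numeral of_nat_eq_0_iff add_is_0 zero_neq_numeral)
  ultimately have "bet (of_nat m) = 0" by simp
  thus ?thesis using beta_fun_at(2)[OF nz] m by (simp add: beta_def)
qed

text \<open>For \<open>k + n = m\<close> the factor \<open>N(n,k)\<close> vanishes, so that the relation
  becomes \<open>D(k) c(n,k+1) = 0\<close>. If \<open>(n,k)\<close> with \<open>k < n\<close> is closest to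
  the diagonal, then \<open>c(n,k+1)\<close> is either \<open>c(n,n) = 1\<close> or \<open>D(n-1)\<close> up
  to a nonzero factor.\<close>

lemma D_zero:
  assumes P: "HG_family R f P"
  shows "\<exists>a. (m = 2 * a + 1 \<and> poly (den_a R q v) (of_nat a) = 0) \<or>
    (m = 2 * a + 2 \<and> (poly (den_a R q v) (of_nat a) = 0 \<or> poly (den_a R q v) (of_nat (a + 1)) = 0))"
proof -
  let ?D = "den_a R q v"
  obtain C where C: "HG_coeffs R (num_a q) ?D P C" using P HG_familyD[OF _ den] unfolding f_a by blast
  have rel: "poly ?D (of_nat k) * C n (k + 1) = eval_us (num_a q) (of_nat n) (of_nat k) * C n k"
    and diag: "C n n = 1" for n k
    using C by (simp_all add: HG_coeffs_def)
  have N: "eval_us (num_a q) (of_nat n) (of_nat k) = 0 \<longleftrightarrow> k = n \<or> k + n = m" for n k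
  proof -
    have "of_nat k + of_nat n = (of_nat m :: complex) \<longleftrightarrow> k + n = m"
      by (metis of_nat_add of_nat_eq_iff)
    thus ?thesis by (simp add: eval_num_a q_m)
  qed
  define a where "a = (m - 1) div 2"
  have "m = 2 * a + 1 \<or> m = 2 * a + 2" using m(1) unfolding a_def by presburger
  thus ?thesis
  proof
    assume ma: "m = 2 * a + 1"
    have "eval_us (num_a q) (of_nat (a + 1)) (of_nat a) = 0" unfolding N using ma by simp
    hence "poly ?D (of_nat a) = 0" using rel[of a "a + 1"] diag[of "a + 1"] by simp
    thus ?thesis using ma by blast
  next
    assume ma: "m = 2 * a + 2"
    have N0: "eval_us (num_a q) (of_nat (a + 2)) (of_nat a) = 0" unfolding N using ma by simp
    hence "poly ?D (of_nat a) = 0 \<or> C (a + 2) (a + 1) = 0" using rel[of a "a + 2"] by auto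
    moreover have "poly ?D (of_nat (a + 1)) = 0" if "C (a + 2) (a + 1) = 0"
      using rel[of "a + 1" "a + 2"] diag[of "a + 2"] that by simp
    ultimately show ?thesis using ma by blast
  qed
qed

text \<open>A zero \<open>D(a) = 0\<close> cuts off all rows beyond \<open>m\<close>: every \<open>P\<^sub>n\<close> with \<open>n > m\<close> vanishes at
  \<open>-R(0)\<close>.\<close>

lemma not_quasi_orthogonal:
  assumes P: "HG_family R f P"
  shows "\<not> quasi_orthogonal P"
proof
  assume qo: "quasi_orthogonal P"
  let ?D = "den_a R q v"
  obtain C where C: "HG_coeffs R (num_a q) ?D P C" using P HG_familyD[OF _ den] unfolding f_a by blast
  have rel: "poly ?D (of_nat k) * C n (k + 1) = eval_us (num_a q) (of_nat n) (of_nat k) * C n k" for n k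
    using C by (simp add: HG_coeffs_def)
  obtain a where a: "a < m" "poly ?D (of_nat a) = 0"
  proof -
    obtain a where "(m = 2 * a + 1 \<and> poly ?D (of_nat a) = 0) \<or>
      (m = 2 * a + 2 \<and> (poly ?D (of_nat a) = 0 \<or> poly ?D (of_nat (a + 1)) = 0))"
      using D_zero[OF P] by blast
    thus thesis using that[of a] that[of "a + 1"] by force
  qed
  have zero: "poly (P n) (- poly R 0) = 0" if "n > m" for n
  proof -
    have N: "eval_us (num_a q) (of_nat n) (of_nat k) \<noteq> 0" if "k < n" for k
    proof -
      have "of_nat k + of_nat n \<noteq> (of_nat m :: complex)"
        using \<open>n > m\<close> by (metis of_nat_add of_nat_eq_iff not_add_less2)
      thus ?thesis using that by (simp add: eval_num_a q_m)
    qed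
    have "C n (a - j) = 0" for j
    proof (induction j)
      case 0
      show ?case using rel[of a n] a N[of a] \<open>n > m\<close> by simp
    next
      case (Suc j)
      show ?case
      proof (cases "j < a")
        case True
        hence "a - j = a - Suc j + 1" by simp
        thus ?thesis using rel[of "a - Suc j" n] Suc N[of "a - Suc j"] \<open>n > m\<close> a(1) by simp
      next
        case False
        thus ?thesis using Suc by simp
      qed
    qed
    from this[of a] have C0: "C n 0 = 0" by simp
    have "P n = (\<Sum>k\<le>n. smult (C n k) (newton_basis R k))" using C by (simp add: HG_coeffs_def)
    hence "poly (P n) (- poly R 0) = (\<Sum>k\<le>n. C n k * poly (newton_basis R k) (- poly R 0))"
      by (simp add: poly_sum)
    also have "\<dots> = 0"
    proof (rule sum.neutral, rule ballI)
      fix k assume "k \<in> {..n}"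
      show "C n k * poly (newton_basis R k) (- poly R 0) = 0"
        using C0 newton_basis_root[of k R] by (cases "k = 0") simp_all
    qed
    finally show ?thesis .
  qed
  obtain n where "n \<ge> Suc m" "poly (P n) (- poly R 0) \<noteq> 0"
    using quasi_orthogonal_no_persistent_root[OF qo] by blast
  with zero[of n] show False by simp
qed

text \<open>If the denominator vanishes at \<open>n\<close>, then \<open>n - 1\<close> is the zero of
  \<open>D\<close> found in \<open>D_zero\<close>, and the singularity is removable.\<close>

lemma F1_limit:
  assumes P: "HG_family R f P" and n: "n > 0"
  shows "\<exists>l. (F 1 \<longlongrightarrow> l) (at (of_nat n))"
proof (cases "2 * n - 1 = m")
  case False
  have "poly q (2 * of_nat n - 1) \<noteq> 0"
  proof
    assume "poly q (2 * of_nat n - 1) = 0"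
    hence "(2 * of_nat n - 1 :: complex) = of_nat m" by (simp add: q_m)
    hence "of_nat (2 * n - 1) = (of_nat m :: complex)" using n by (simp add: of_nat_diff)
    thus False using False by (simp only: of_nat_eq_iff)
  qed
  hence "(F 1 \<longlongrightarrow> F 1 (of_nat n)) (at (of_nat n))" by (intro F_tendsto) (simp add: le_Suc_eq)
  thus ?thesis by blast
next
  case True
  obtain a where a: "(m = 2 * a + 1 \<and> poly (den_a R q v) (of_nat a) = 0) \<or>
      (m = 2 * a + 2 \<and> (poly (den_a R q v) (of_nat a) = 0 \<or> poly (den_a R q v) (of_nat (a + 1)) = 0))"
    using D_zero[OF P] by blast
  have "odd m" using True n by presburger
  hence ma: "m = 2 * a + 1" "poly (den_a R q v) (of_nat a) = 0" using a by auto
  have na: "n = a + 1" using True ma n by simp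
  obtain q1 where q1: "q1 \<noteq> 0" "\<And>x. poly q x = q1 * (x - of_nat m)" using q_form by blast
  have "poly (den_a R q v \<circ>\<^sub>p [:-1, 1:]) (of_nat n) = 0" using ma(2) by (simp add: poly_pcompose na)
  from removable[OF this, of "- 2 * q1"] obtain l where
    l: "((\<lambda>u. poly (den_a R q v \<circ>\<^sub>p [:-1, 1:]) u / (- 2 * q1 * (u - of_nat n))) \<longlongrightarrow> l) (at (of_nat n))"
    using q1(1) by auto
  have "F 1 = (\<lambda>u. poly (den_a R q v \<circ>\<^sub>p [:-1, 1:]) u / (- 2 * q1 * (u - of_nat n)))"
  proof
    fix u :: complex
    have "u + -1 = u - 1" "poly [:0, 1:] (-1::complex) * (q1 * (2 * u - 1 - of_nat m)) = - 2 * q1 * (u - of_nat n)"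
      by (simp_all add: na ma(1) algebra_simps)
    thus "F 1 u = poly (den_a R q v \<circ>\<^sub>p [:-1, 1:]) u / (- 2 * q1 * (u - of_nat n))"
      unfolding F_1 q1(2) by (simp only: poly_pcompose) (simp add: add.commute)
  qed
  with l show ?thesis by auto
qed

lemma F2_limit:
  assumes P: "HG_family R f P" and n: "n > 1"
  shows "\<exists>l. (F 2 \<longlongrightarrow> l) (at (of_nat n))"
proof (cases "2 * n - 2 = m")
  case False
  have nz: "poly q (2 * of_nat n - 2) \<noteq> 0"
  proof
    assume "poly q (2 * of_nat n - 2) = 0"
    hence "(2 * of_nat n - 2 :: complex) = of_nat m" by (simp add: q_m)
    hence "of_nat (2 * n - 2) = (of_nat m :: complex)" using n by (simp add: of_nat_diff)
    thus False using False by (simp only: of_nat_eq_iff)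
  qed
  have "n > 0" using n by simp
  from F1_limit[OF P this] obtain l where l: "(F 1 \<longlongrightarrow> l) (at (of_nat n))" by blast
  have "F 2 = (\<lambda>u. F 1 u * (poly (den_a R q v) (u - 2) / (poly [:0, 1:] (-2) * poly q (2 * u - 2))))"
    by (rule ext) (simp only: F_2 F_1)
  moreover have "((\<lambda>u. F 1 u * (poly (den_a R q v) (u - 2) / (poly [:0, 1:] (-2) * poly q (2 * u - 2)))) \<longlongrightarrow>
      l * (poly (den_a R q v) (of_nat n - 2) / (poly [:0, 1:] (-2) * poly q (2 * of_nat n - 2)))) (at (of_nat n))"
    using nz by (intro tendsto_intros l) simp
  ultimately show ?thesis by auto
next
  case True
  obtain a where a: "(m = 2 * a + 1 \<and> poly (den_a R q v) (of_nat a) = 0) \<or>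
      (m = 2 * a + 2 \<and> (poly (den_a R q v) (of_nat a) = 0 \<or> poly (den_a R q v) (of_nat (a + 1)) = 0))"
    using D_zero[OF P] by blast
  have "even m" using True n by presburger
  hence ma: "m = 2 * a + 2" "poly (den_a R q v) (of_nat a) = 0 \<or> poly (den_a R q v) (of_nat (a + 1)) = 0"
    using a by auto
  have na: "n = a + 2" using True ma n by simp
  obtain q1 where q1: "q1 \<noteq> 0" "\<And>x. poly q x = q1 * (x - of_nat m)" using q_form by blast
  define p where "p = (den_a R q v \<circ>\<^sub>p [:-1, 1:]) * (den_a R q v \<circ>\<^sub>p [:-2, 1:])"
  have "poly p (of_nat n) = 0" using ma(2) by (auto simp: p_def poly_pcompose na)
  from removable[OF this, of "4 * q1"] obtain l where
    l: "((\<lambda>u. poly p u / (4 * q1 * (u - of_nat n))) \<longlongrightarrow> l) (at (of_nat n))"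
    using q1(1) by auto
  have "poly q (2 * of_nat n - 1) \<noteq> 0"
  proof
    assume "poly q (2 * of_nat n - 1) = 0"
    hence "(2 * of_nat n - 1 :: complex) = of_nat m" by (simp add: q_m)
    hence "of_nat (2 * n - 1) = (of_nat m :: complex)" using n by (simp add: of_nat_diff)
    hence "2 * n - 1 = m" by (simp only: of_nat_eq_iff)
    thus False using True n by simp
  qed
  hence "((\<lambda>u. (poly p u / (4 * q1 * (u - of_nat n))) / poly q (2 * u - 1)) \<longlongrightarrow> l / poly q (2 * of_nat n - 1)) (at (of_nat n))"
    by (intro tendsto_intros l)
  moreover have "F 2 = (\<lambda>u. (poly p u / (4 * q1 * (u - of_nat n))) / poly q (2 * u - 1))"
  proof
    fix u :: complex
    have e: "u + -1 = u - 1" "u + -2 = u - 2" "q1 * (2 * u - 2 - of_nat m) = 2 * q1 * (u - of_nat n)"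
      by (simp_all add: na ma(1) algebra_simps)
    have "poly p u = poly (den_a R q v) (u - 1) * poly (den_a R q v) (u - 2)"
      by (simp add: p_def poly_pcompose add.commute)
    moreover define y where "y = u - of_nat n"
    ultimately show "F 2 u = (poly p u / (4 * q1 * (u - of_nat n))) / poly q (2 * u - 1)"
      unfolding F_2 q1(2)[of "2 * u - 2"] e y_def[symmetric] by (simp add: ac_simps)
  qed
  ultimately show ?thesis by auto
qed

text \<open>Row \<open>n + 1\<close> is obtained from rows \<open>n\<close> and \<open>n - 1\<close> by the
  recurrence, whose coefficients have limits as \<open>F 1\<close> and \<open>F 2\<close> do. The recurrence
  also propagates the vanishing of the limits beyond the diagonal. Rows 0 and 1 are computed from the
  products: the arguments of \<open>q\<close> are not positive there, apart from \<open>q(1)\<close> in row 1,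
  and therefore no zeros of \<open>q\<close>.\<close>

lemma all_limits:
  assumes P: "HG_family R f P"
  shows "\<exists>l. (F i \<longlongrightarrow> l) (at (of_nat n)) \<and> (i > n \<longrightarrow> l = 0)"
proof -
  let ?D = "den_a R q v"
  have q_neg: "poly q (- of_nat j) \<noteq> 0" for j
  proof
    assume "poly q (- of_nat j) = 0"
    hence "- of_nat j = (of_nat m :: complex)" by (simp add: q_m)
    hence "of_nat (m + j) = (0 :: complex)" by (metis of_nat_add add.left_inverse)
    thus False using m by (simp only: of_nat_eq_0_iff)
  qed
  define Z where "Z n \<longleftrightarrow> (\<forall>i. \<exists>l. (F i \<longlongrightarrow> l) (at (of_nat n)) \<and> (i > n \<longrightarrow> l = 0))" for n
  have Z0: "Z 0" unfolding Z_def
  proof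
    fix i
    have "(F i \<longlongrightarrow> F i 0) (at 0)" by (rule F_tendsto) (use q_neg in simp)
    moreover have "F i 0 = 0" if "i > 0"
      unfolding F_def using that D_neg1 by (intro prod_zero) (auto intro!: bexI[of _ 1])
    ultimately show "\<exists>l. (F i \<longlongrightarrow> l) (at (of_nat 0)) \<and> (i > 0 \<longrightarrow> l = 0)" by auto
  qed
  have Z1: "Z 1" unfolding Z_def
  proof
    fix i
    show "\<exists>l. (F i \<longlongrightarrow> l) (at (of_nat 1)) \<and> (i > 1 \<longrightarrow> l = 0)"
    proof (induction i)
      case 0
      show ?case by (intro exI[of _ 1]) (simp add: F_def[abs_def])
    next
      case (Suc i)
      show ?case
      proof (cases "i = 0")
        case True
        thus ?thesis using F1_limit[OF P, of 1] by simp
      next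
        case False
        then obtain j where j: "i = Suc j" by (cases i) auto
        obtain l where l: "(F i \<longlongrightarrow> l) (at (of_nat 1))" "i > 1 \<longrightarrow> l = 0" using Suc by blast
        let ?h = "\<lambda>u. poly ?D (u - of_nat (Suc i)) / (poly [:0, 1:] (- of_nat (Suc i)) * poly q (2 * u - of_nat (Suc i)))"
        have e: "2 * of_nat 1 - of_nat (Suc i) = (- of_nat j :: complex)" by (simp add: j)
        have nz: "poly [:0, 1:] (- of_nat (Suc i)) * poly q (2 * of_nat 1 - of_nat (Suc i)) \<noteq> 0"
          unfolding e using q_neg[of j] A_nz[of i] by simp
        have F: "F (Suc i) = (\<lambda>u. F i u * ?h u)" by (rule ext) (rule F_Suc)
        have "(F (Suc i) \<longlongrightarrow> l * ?h (of_nat 1)) (at (of_nat 1))"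
          unfolding F by (intro tendsto_intros l nz)
        moreover have "l * ?h (of_nat 1) = 0"
          using l(2) D_neg1 by (cases "i = 1") (use False in simp_all)
        ultimately show ?thesis by auto
      qed
    qed
  qed
  have step: "Z (Suc n)" if n: "n > 0" and Zn: "Z n" and Zm: "Z (n - 1)" for n
    unfolding Z_def
  proof
    fix i
    let ?w = "of_nat n :: complex"
    have w: "?w + 1 = of_nat (n + 1)" "?w + - 1 = of_nat (n - 1)" "?w + - 1 + 1 = of_nat n"
      "?w + - 1 + 2 = of_nat (n + 1)"
      using n by (simp_all add: of_nat_diff)
    show "\<exists>l. (F i \<longlongrightarrow> l) (at (of_nat (Suc n))) \<and> (i > Suc n \<longrightarrow> l = 0)"
    proof -
      consider "i = 0" | "i = 1" | k where "i = k + 2"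
        by (metis One_nat_def Suc_1 add_2_eq_Suc' not0_implies_Suc)
      thus ?thesis
      proof cases
        case 1
        thus ?thesis by (intro exI[of _ 1]) (simp add: F_def[abs_def])
      next
        case 2
        thus ?thesis using F1_limit[OF P, of "Suc n"] by simp
      next
        case (3 k)
        obtain l1 where l1: "(F 1 \<longlongrightarrow> l1) (at ?w)" using F1_limit[OF P n] by blast
        obtain l1' where l1': "(F 1 \<longlongrightarrow> l1') (at (?w + 1))" unfolding w using F1_limit[OF P, of "n + 1"] by auto
        obtain a where a: "(alp \<longlongrightarrow> a) (at ?w)" using alp_tendsto[OF l1 l1'] by blast
        obtain l2 where l2: "(F 2 \<longlongrightarrow> l2) (at ?w)" using Zn unfolding Z_def by blast
        obtain l2' where l2': "(F 2 \<longlongrightarrow> l2') (at (of_nat (n + 1)))" using F2_limit[OF P, of "n + 1"] n by auto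
        obtain b where b: "(bet \<longlongrightarrow> b) (at (?w + - 1))"
        proof -
          have "(bet \<longlongrightarrow> l2 - l2' - l1 * (a + poly R (?w + - 1))) (at (?w + - 1))"
            by (rule bet_tendsto[where w = "?w + - 1", unfolded w(3,4), OF l2 l2' l1 a])
          thus ?thesis by (rule that)
        qed
        obtain x where x: "(F (k + 2) \<longlongrightarrow> x) (at ?w)" "k + 2 > n \<longrightarrow> x = 0" using Zn unfolding Z_def by blast
        obtain y where y: "(F (k + 1) \<longlongrightarrow> y) (at ?w)" "k + 1 > n \<longrightarrow> y = 0" using Zn unfolding Z_def by blast
        obtain z where z: "(F k \<longlongrightarrow> z) (at (?w + - 1))" "k > n - 1 \<longrightarrow> z = 0"
          unfolding w(2) using Zm unfolding Z_def by blast
        let ?l = "x - (poly R (?w - of_nat (k + 1)) + a) * y - b * z"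
        have "((\<lambda>u. F (k + 2) u - (poly R (u - of_nat (k + 1)) + alp u) * F (k + 1) u
            - bet (u + - 1) * F k (u + - 1)) \<longlongrightarrow> ?l) (at ?w)"
          by (intro tendsto_intros x y a tendsto_shift[OF b] tendsto_shift[OF z(1)])
        moreover have "\<forall>\<^sub>F u in at ?w. F (k + 2) u - (poly R (u - of_nat (k + 1)) + alp u) * F (k + 1) u
            - bet (u + - 1) * F k (u + - 1) = F (k + 2) (u + 1)"
          using eventually_B_range[where w = ?w and n = "k + 3" and c = 1]
        proof eventually_elim
          case (elim u)
          have "F (k + 2) (u + 1) = F (k + 2) u - (poly R (u - of_nat (k + 1)) + alp u) * F (k + 1) u
              - bet (u - 1) * F k (u - 1)"
            by (rule coefficient_recurrence) (use elim in blast)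
          thus ?case by (simp only: diff_conv_add_uminus)
        qed
        ultimately have lim: "((\<lambda>u. F (k + 2) (u + 1)) \<longlongrightarrow> ?l) (at ?w)"
          by (rule Lim_transform_eventually)
        have "?w = of_nat (Suc n) + - 1" by simp
        from tendsto_shift[OF lim[unfolded this]] have "(F (k + 2) \<longlongrightarrow> ?l) (at (of_nat (Suc n)))" by simp
        moreover have "?l = 0" if "k + 2 > Suc n" using x(2) y(2) z(2) that n by simp
        ultimately show ?thesis using 3 by blast
      qed
    qed
  qed
  have "Z n \<and> Z (Suc n)" for n
  proof (induction n)
    case 0
    show ?case using Z0 Z1 by simp
  next
    case (Suc n)
    show ?case using Suc step[of "Suc n"] by simp
  qed
  thus ?thesis unfolding Z_def by blast
qed

lemma degenerate_limits:
  assumes P: "HG_family R f P"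
  shows limits_exist
  unfolding limits_exist_def
proof (intro conjI allI impI)
  fix n i :: nat assume "i \<le> n"
  show "\<exists>l. (F i \<longlongrightarrow> l) (at (of_nat n))" using all_limits[OF P] by blast
next
  fix n :: nat assume "2 \<le> n"
  show "(F (n + 1) \<longlongrightarrow> 0) (at (of_nat n))" using all_limits[OF P, of "n + 1" n] by auto
qed

lemma degenerate_boundary_values:
  assumes P: "HG_family R f P"
  shows "alpha R f 0 = rat_val (alpha_fun R f) 0" "beta R f 0 = rat_val (beta_fun R f) 0"
proof -
  have 1: "(F 1 \<longlongrightarrow> 0) (at 0)" using all_limits[OF P, of 1 0] by auto
  have 2: "(F 2 \<longlongrightarrow> 0) (at 1)" using all_limits[OF P, of 2 1] by auto
  show "alpha R f 0 = rat_val (alpha_fun R f) 0" "beta R f 0 = rat_val (beta_fun R f) 0"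
    by (rule boundary_values[OF degenerate_limits[OF P] 1 2])+
qed

lemma degenerate_rows_unique:
  assumes P: "HG_family R f P" "HG_family R f Q" and n: "n > m"
  shows "P n = Q n"
proof (rule HG_rows_unique[OF P])
  fix i assume "n \<le> i" "i > 0"
  thus "poly q (of_nat i) \<noteq> 0" using n by (simp add: q_m)
qed

end

end

section \<open>Symmetry of the second recurrence coefficient\<close>

text \<open>With \<open>q\<close> proportional to \<open>u - t\<close> and \<open>D = (u + 1) d\<close>, this
  is, for a suitable constant \<open>c\<close>, the closed form of \<open>\<beta>(u)\<close> in case (a). It
  is invariant under the reflection \<open>u \<mapsto> t - 1 - u\<close>.\<close>

definition symmetric_form :: "complex \<Rightarrow> complex \<Rightarrow> (complex \<Rightarrow> complex) \<Rightarrow> complex \<Rightarrow> complex" where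
  "symmetric_form c t d u = c * ((u + 1) * (u - t) * (d u * d (t - 1 - u))) /
     ((2 * u - t) * (2 * u + 2 - t) * (2 * u + 1 - t)^2)"

lemma symmetric_form_reflect: "symmetric_form c t d (t - 1 - u) = symmetric_form c t d u"
proof -
  have e: "t - 1 - u + 1 = - (u - t)" "t - 1 - u - t = - (u + 1)" "t - 1 - (t - 1 - u) = u"
    "2 * (t - 1 - u) - t = - (2 * u + 2 - t)" "2 * (t - 1 - u) + 2 - t = - (2 * u - t)"
    "2 * (t - 1 - u) + 1 - t = - (2 * u + 1 - t)" by simp_all
  show ?thesis unfolding symmetric_form_def e power2_minus
    by (simp only: mult.commute mult.left_commute minus_mult_minus)
qed

lemma symmetric_form_algebra:
  fixes q1 t r1 r2 v0 v1 u :: "'a :: field"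
  defines "q \<equiv> \<lambda>x. q1 * (x - t)" and "\<rho> \<equiv> \<lambda>x. r1 + x * r2"
  defines "d \<equiv> \<lambda>x. x * q x * \<rho> (x + 1) + (v0 + x * v1)"
  shows "d (u + 1) * q (2 * u + 1) - d u * q (2 * u + 2) - \<rho> (u + 1) * q (2 * u + 1) * q (2 * u + 2) =
    - (q1 * d (t - 1 - u))"
  unfolding d_def q_def \<rho>_def by algebra

text \<open>Here \<open>du\<close> and \<open>dn\<close> stand for \<open>d(u)\<close> and
  \<open>d(u+1)\<close>, the \<open>y1\<close>, \<open>y2\<close>, \<open>y3\<close> for
  \<open>q(2u+1)\<close>, \<open>q(2u+2)\<close>, \<open>q(2u+3)\<close>, \<open>x\<close> for
  \<open>q(u+1)\<close>, and \<open>r\<close> for \<open>(R(u+1) - R(0)) / (u+1)\<close>; the bracket is the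
  last factor in \<open>bet_factor_q\<close>.\<close>

lemma beta_bracket_algebra:
  fixes u du dn y1 y2 y3 x r :: "'a :: field"
  assumes "y1 \<noteq> 0" "y2 \<noteq> 0" "y3 \<noteq> 0" "(u + 2) * y2 - x = (u + 1) * y3"
  shows "(u + 2) * (- ((u + 1) * du / y1) + (u + 2) * dn / y3 - (u + 1) * r) - (u + 2) * dn / (y2 * y3) * x =
    (u + 1) * (u + 2) * ((dn * y1 - du * y2 - r * y1 * y2) / (y1 * y2))"
proof -
  have x: "x = (u + 2) * y2 - (u + 1) * y3" using assms(4) by (simp add: algebra_simps)
  have "(u + 2) * dn / y3 - dn / (y2 * y3) * x = (u + 1) * dn / y2"
    unfolding x using assms(1-3) by (simp add: field_simps)
  hence "(u + 2) * ((u + 2) * dn / y3) - (u + 2) * dn / (y2 * y3) * x = (u + 2) * ((u + 1) * dn / y2)"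
    by (metis (no_types, lifting) mult.assoc right_diff_distrib times_divide_eq_right times_divide_eq_left)
  moreover have "(dn * y1 - du * y2 - r * y1 * y2) / (y1 * y2) = dn / y2 - du / y1 - r"
    using assms(1-3) by (simp add: field_simps)
  moreover define a b e w3 where "a = du / y1" and "b = dn / y2" and "e = (u + 2) * dn / y3"
    and "w3 = (u + 2) * dn / (y2 * y3) * x"
  ultimately have h: "(u + 2) * e - w3 = (u + 2) * ((u + 1) * b)"
    "(dn * y1 - du * y2 - r * y1 * y2) / (y1 * y2) = b - a - r" by simp_all
  have "(u + 2) * (- ((u + 1) * a) + e - (u + 1) * r) - w3 = (u + 1) * (u + 2) * (b - a - r)"
    using h(1) by algebra
  thus ?thesis unfolding h(2) by (simp add: a_def e_def w3_def)
qed

lemma (in pair_a) beta_fun_symmetric: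
  assumes t: "poly q t = 0"
  shows "\<exists>c d. c \<noteq> 0 \<and> d \<noteq> 0 \<and>
    (\<forall>w. \<forall>\<^sub>F u in at w. rat_val (beta_fun R f) u = symmetric_form c t (poly d) u)"
proof -
  obtain r0 r1 r2 where R: "R = [:r0, r1, r2:]" by (rule degree_le_2_cases[OF deg(1)])
  obtain q0 q1 where qq: "q = [:q0, q1:]" by (rule degree_le_1_cases[OF deg(2)])
  obtain v0 v1 where v: "v = [:v0, v1:]" by (rule degree_le_1_cases[OF deg(3)])
  have q0: "q0 = - (t * q1)" using t by (simp add: qq eq_neg_iff_add_eq_0)
  have q1: "q1 \<noteq> 0" using q by (auto simp: qq q0)
  have qx: "poly q x = q1 * (x - t)" for x by (simp add: qq q0 algebra_simps)
  define d where "d = [:0, 1:] * q * [:r1 + r2, r2:] + v"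
  define \<rho> where "\<rho> x = r1 + x * r2" for x
  have dx: "poly d x = x * (q1 * (x - t)) * \<rho> (x + 1) + (v0 + x * v1)" for x
    by (simp add: d_def qx v \<rho>_def algebra_simps)
  have Rx: "poly R (x + 1) - poly R 0 = (x + 1) * \<rho> (x + 1)" for x
    by (simp add: R \<rho>_def)
  have Dx: "poly (den_a R q v) x = (x + 1) * poly d x" for x
    unfolding poly_den_a Rx dx qx by (simp add: v algebra_simps)
  have d0: "d \<noteq> 0"
  proof
    assume "d = 0"
    hence "den_a R q v = 0" by (intro poly_eqI_degree_lead_coeff poly_ext) (simp add: Dx poly_eq_poly_eq_iff fun_eq_iff)
    thus False using den by simp
  qed
  have val: "rat_val (beta_fun R f) u = symmetric_form (- 1 / q1^2) t (poly d) u"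
    if nz: "poly q (2 * u) \<noteq> 0" "poly q (2 * u + 1) \<noteq> 0" "poly q (2 * u + 2) \<noteq> 0" "poly q (2 * u + 3) \<noteq> 0"
      and u: "u + 1 \<noteq> 0" "u + 2 \<noteq> 0" for u
  proof -
    define y0 y1 y2 y3 where y: "y0 = poly q (2 * u)" "y1 = poly q (2 * u + 1)"
      "y2 = poly q (2 * u + 2)" "y3 = poly q (2 * u + 3)"
    have y0: "y0 \<noteq> 0" "y1 \<noteq> 0" "y2 \<noteq> 0" "y3 \<noteq> 0" using nz by (simp_all add: y)
    have e: "2 * (u + 1) = 2 * u + 2" "2 * u + 2 + 1 = 2 * u + 3" "2 * u + 2 - 1 = 2 * u + 1"
      "u + 1 - 1 = u" "u + 1 + 1 = u + 2" by simp_all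
    have G: "G u = (u + 1) * poly d u / (y0 * y1)" "G (u + 1) = (u + 2) * poly d (u + 1) / (y2 * y3)"
      by (simp_all only: step_factor_def e Dx y)
    have id: "poly [:0, 1:] (-1) = (-1 :: complex)" by simp
    have "alp (u + 1) = (u + 1) * poly d u / (- 1 * y1) - (u + 2) * poly d (u + 1) / (- 1 * y3) - poly R (u + 1)"
      by (simp only: alpha_at_def e Dx y id)
    hence alp: "poly R 0 + alp (u + 1) = - ((u + 1) * poly d u / y1) + (u + 2) * poly d (u + 1) / y3
        - (u + 1) * \<rho> (u + 1)"
      unfolding Rx[symmetric] by simp
    have "bet u * ((u + 1) * (u + 2)) = G u * poly q u *
        ((u + 1) * (u + 2) * ((poly d (u + 1) * y1 - poly d u * y2 - \<rho> (u + 1) * y1 * y2) / (y1 * y2)))"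
      unfolding bet_factor_q[OF nz] alp G(2)
      by (subst beta_bracket_algebra[OF y0(2,3,4)]) (simp_all add: y qx algebra_simps)
    hence "bet u * ((u + 1) * (u + 2)) = (G u * poly q u *
        ((poly d (u + 1) * y1 - poly d u * y2 - \<rho> (u + 1) * y1 * y2) / (y1 * y2))) * ((u + 1) * (u + 2))"
      by (simp only: ac_simps)
    hence "bet u = G u * poly q u * ((poly d (u + 1) * y1 - poly d u * y2 - \<rho> (u + 1) * y1 * y2) / (y1 * y2))"
      using u by (simp only: mult_cancel_right mult_eq_0_iff simp_thms)
    also have "poly d (u + 1) * y1 - poly d u * y2 - \<rho> (u + 1) * y1 * y2 = - (q1 * poly d (t - 1 - u))"
      unfolding y qx dx \<rho>_def by (rule symmetric_form_algebra)
    also have "G u * poly q u * (- (q1 * poly d (t - 1 - u)) / (y1 * y2)) =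
        symmetric_form (- 1 / q1^2) t (poly d) u"
    proof -
      have "x * a / (q1 * b * (q1 * c)) * (q1 * z) * (- (q1 * a') / (q1 * c * (q1 * h))) =
          - 1 / q1^2 * (x * z * (a * a')) / (b * h * c^2)" for x a b c z a' h
        using q1 by (simp add: power2_eq_square ac_simps)
      thus ?thesis unfolding G symmetric_form_def y qx by blast
    qed
    finally show ?thesis using beta_fun_at(2)[OF nz] by simp
  qed
  have "\<forall>\<^sub>F u in at w. rat_val (beta_fun R f) u = symmetric_form (- 1 / q1^2) t (poly d) u" for w
  proof -
    have u: "\<forall>\<^sub>F u in at w. poly [:c, 1:] u \<noteq> (0 :: complex)" for c by (rule eventually_poly_nonzero) simp
    show ?thesis
      using eventually_B[of 0 w] eventually_B[of 1 w] eventually_B[of 2 w] eventually_B[of 3 w] u[of 1] u[of 2]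
      by eventually_elim (rule val, simp_all add: add.commute)
  qed
  thus ?thesis using d0 q1 by (intro exI[of _ "- 1 / q1^2"] exI[of _ d]) simp
qed

text \<open>Two reflections compose to a translation, so that a function with two of these symmetric
  forms is periodic. A zero at \<open>m\<close> then recurs infinitely often. The numbers \<open>m\<close> and \<open>m - p\<close> are zeros of \<open>q\<close> for the two pairs, so that \<open>m - p\<close> is 0 or -1.\<close>

lemma no_two_symmetric_forms:
  fixes m p :: nat and g :: "complex \<Rightarrow> complex"
  assumes m: "m > 0" and p: "p = m \<or> p = m + 1"
    and nz: "c \<noteq> 0" "d \<noteq> 0"
    and g: "\<And>w. \<forall>\<^sub>F u in at w. g u = symmetric_form c (of_nat m) (poly d) u"
    and g': "\<And>w. \<forall>\<^sub>F u in at w. g u = symmetric_form c' (of_nat m - of_nat p) (poly d') u"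
  shows False
proof -
  define S where "S = symmetric_form c (of_nat m) (poly d)"
  define S' where "S' = symmetric_form c' (of_nat m - of_nat p) (poly d')"
  define good where "good t u \<longleftrightarrow> 2 * u - t \<noteq> 0 \<and> 2 * u + 2 - t \<noteq> 0 \<and> 2 * u + 1 - t \<noteq> 0" for t u :: complex
  have cont: "(symmetric_form c t (poly d) \<longlongrightarrow> symmetric_form c t (poly d) z) (at z)"
    if "good t z" for c t d z
    unfolding symmetric_form_def[abs_def] using that by (intro tendsto_intros) (auto simp: good_def)
  have SS': "S z = S' z" if "good (of_nat m) z" "good (of_nat m - of_nat p) z" for z
  proof -
    have "(g \<longlongrightarrow> S z) (at z)" unfolding S_def
      by (rule Lim_transform_eventually[OF cont[OF that(1)]]) (use g[of z] in eventually_elim, simp)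
    moreover have "(g \<longlongrightarrow> S' z) (at z)" unfolding S'_def
      by (rule Lim_transform_eventually[OF cont[OF that(2)]]) (use g'[of z] in eventually_elim, simp)
    ultimately show ?thesis by (rule LIM_unique)
  qed
  have int_good: "good (of_int t) (of_int z)" if "2 * z - t > 0 \<or> 2 * z + 2 - t < 0" for t z :: int
  proof -
    have "2 * z - t \<noteq> 0" "2 * z + 2 - t \<noteq> 0" "2 * z + 1 - t \<noteq> 0" using that by auto
    hence "of_int (2 * z - t) \<noteq> (0::complex)" "of_int (2 * z + 2 - t) \<noteq> (0::complex)"
      "of_int (2 * z + 1 - t) \<noteq> (0::complex)" by (simp_all only: of_int_eq_0_iff not_False_eq_True)
    thus ?thesis by (simp add: good_def)
  qed
  have per: "S (of_nat (n + p)) = S (of_nat n)" if n: "n \<ge> m" for n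
  proof -
    \<comment> \<open>The reflection of \<open>n + p\<close> is negative, hence off the poles of both forms, which lie near \<open>m/2\<close> and \<open>(m-p)/2\<close>.\<close>
    define z where "z = int m - 1 - int (n + p)"
    have ez: "of_nat m - 1 - of_nat (n + p) = (of_int z :: complex)"
      "of_nat m - of_nat p - 1 - of_int z = (of_nat n :: complex)" by (simp_all add: z_def)
    have "good (of_int (int m)) (of_int z)" "good (of_int (int m - int p)) (of_int z)"
      "good (of_int (int m)) (of_int (int n))" "good (of_int (int m - int p)) (of_int (int n))"
      by (rule int_good; use n m p in \<open>auto simp: z_def\<close>)+
    hence gd: "good (of_nat m) (of_int z)" "good (of_nat m - of_nat p) (of_int z)"
      "good (of_nat m) (of_nat n)" "good (of_nat m - of_nat p) (of_nat n)" by simp_all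
    have "S (of_nat (n + p)) = S (of_int z)"
      unfolding S_def ez(1)[symmetric] by (rule symmetric_form_reflect[symmetric])
    also have "\<dots> = S' (of_int z)"
      by (rule SS'[OF gd(1,2)])
    also have "\<dots> = S' (of_nat n)"
      unfolding S'_def ez(2)[symmetric] by (rule symmetric_form_reflect[symmetric])
    also have "\<dots> = S (of_nat n)"
      by (rule SS'[OF gd(3,4), symmetric])
    finally show ?thesis .
  qed
  have zero: "S (of_nat (m + j * p)) = 0" for j
  proof (induction j)
    case 0
    show ?case by (simp add: S_def symmetric_form_def)
  next
    case (Suc j)
    have e: "m + Suc j * p = (m + j * p) + p" by simp
    have "S (of_nat (m + j * p + p)) = S (of_nat (m + j * p))" by (rule per) simp
    thus ?case unfolding e Suc .
  qed
  define r where "r = d * (d \<circ>\<^sub>p [:of_nat m - 1, -1:])"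
  have root: "poly r (of_nat (m + Suc j * p)) = 0" for j
  proof -
    define n where "n = m + Suc j * p"
    have n: "n > m" using m p by (auto simp: n_def)
    have "good (of_int (int m)) (of_int (int n))" by (rule int_good) (use n in auto)
    hence good: "good (of_nat m) (of_nat n)" by simp
    have "of_nat n + 1 \<noteq> (0 :: complex)" by (metis of_nat_Suc of_nat_eq_0_iff add.commute nat.simps(3))
    moreover have "of_nat n - of_nat m \<noteq> (0 :: complex)" using n by simp
    moreover have "S (of_nat n) = 0" unfolding n_def by (rule zero)
    ultimately have "poly d (of_nat n) * poly d (of_nat m - 1 - of_nat n) = 0"
      using good nz(1) by (auto simp: S_def symmetric_form_def good_def)
    thus ?thesis unfolding n_def[symmetric] by (simp add: r_def poly_pcompose)
  qed
  have "inj (\<lambda>j. of_nat (m + Suc j * p) :: complex)"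
  proof (rule injI)
    fix x y assume "(of_nat (m + Suc x * p) :: complex) = of_nat (m + Suc y * p)"
    hence "m + Suc x * p = m + Suc y * p" by (simp only: of_nat_eq_iff)
    moreover have "p > 0" using m p by auto
    ultimately show "x = y" by simp
  qed
  hence "infinite (range (\<lambda>j. of_nat (m + Suc j * p) :: complex))" by (rule range_inj_infinite)
  moreover have "range (\<lambda>j. of_nat (m + Suc j * p) :: complex) \<subseteq> {z. poly r z = 0}" using root by blast
  ultimately have "infinite {z. poly r z = 0}" by (meson finite_subset)
  hence "r = 0" using poly_roots_finite by blast
  thus False using nz(2) by (simp add: r_def pcompose_eq_0_iff)
qed

section \<open>The second and third case of the list\<close>

text \<open>Cases (b) and (c) correspond to \<open>e = 0\<close> and \<open>e = 1\<close>. Shifting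
  \<open>u\<close> and \<open>s\<close> by 1/2 turns one into the other, but the root -1 of \<open>D\<close>
  belongs to the second factor if \<open>e = 0\<close> and to the first if \<open>e = 1\<close>.\<close>

definition num_bc :: "complex \<Rightarrow> complex \<Rightarrow> complex \<Rightarrow> complex poly poly" where
  "num_bc e c l = const_us l * (var_s - var_u) * (var_s - var_u + 1 - const_us c)
     * ((var_s + var_u + const_us (1 + e)) * (var_s + var_u + const_us (c + e)))"

definition den_bc :: "complex \<Rightarrow> complex poly" where
  "den_bc e = [:(1 + e) / 2, 1:] * [:(2 + e) / 2, 1:]"

definition A_bc :: "complex \<Rightarrow> complex \<Rightarrow> complex poly" where
  "A_bc c l = [:0, l:] * [:1 - c, 1:]"

definition B_bc :: "complex \<Rightarrow> complex \<Rightarrow> complex poly" where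
  "B_bc e c = [:1 + e, 1:] * [:c + e, 1:]"

lemma poly_bc:
  "poly (den_bc e) x = (2 * x + 1 + e) * (2 * x + 2 + e) / 4"
  "poly (A_bc c l) x = l * (x * (x + 1 - c))"
  "poly (B_bc e c) x = (x + 1 + e) * (x + c + e)"
proof -
  have h: "(1 + e) / 2 + x = (2 * x + 1 + e) / 2" "(2 + e) / 2 + x = (2 * x + 2 + e) / 2"
    by (simp_all add: add_divide_distrib)
  have lin: "poly [:a, 1:] x = a + x" for a by simp
  show "poly (den_bc e) x = (2 * x + 1 + e) * (2 * x + 2 + e) / 4"
    unfolding den_bc_def poly_mult lin h by simp
qed (simp_all add: A_bc_def B_bc_def algebra_simps)

lemma eval_num_bc: "eval_us (num_bc e c l) u s = poly (A_bc c l) (s - u) * poly (B_bc e c) (s + u)"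
  by (simp add: num_bc_def eval_us_hom poly_bc add.assoc ac_simps)

lemma lead_num_bc: "lead_coeff (num_bc e c l) = [:l:]"
proof -
  have "var_s - var_u = [:[:0, 1:], - 1:]"
    "var_s - var_u + 1 - const_us c = [:[:1 - c, 1:], - 1:]"
    "var_s + var_u + const_us (1 + e) = [:[:1 + e, 1:], 1:]"
    "var_s + var_u + const_us (c + e) = [:[:c + e, 1:], 1:]"
    by (simp_all add: var_s_def var_u_def const_us_def one_pCons)
  thus ?thesis unfolding num_bc_def lead_coeff_mult by (simp add: const_us_def)
qed

lemma den_bc_nat:
  assumes "e = 0 \<or> e = 1"
  shows "poly (den_bc e) (of_nat k) \<noteq> 0"
proof -
  have "of_nat (2 * k + 1) \<noteq> (0::complex)" "of_nat (2 * k + 2) \<noteq> (0::complex)" "of_nat (2 * k + 3) \<noteq> (0::complex)"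
    by (simp_all only: of_nat_eq_0_iff)
  hence "2 * of_nat k + 1 + e \<noteq> 0" "2 * of_nat k + 2 + e \<noteq> 0"
    using assms by (auto simp: add.commute)
  thus ?thesis unfolding poly_bc by simp
qed

lemma case_b_num: "case_b R f \<Longrightarrow> degree R = 0 \<and> (\<exists>c l. f = quot_us (num_bc 0 c l) (den_bc 0))"
  unfolding case_b_def num_bc_def den_bc_def by (auto simp: const_us_def one_pCons)

lemma case_c_num: "case_c R f \<Longrightarrow> degree R = 0 \<and> (\<exists>c l. f = quot_us (num_bc 1 c l) (den_bc 1))"
proof -
  assume "case_c R f"
  then obtain c l where R: "degree R = 0" and f: "f = quot_us
        (const_us l * (var_s - var_u) * (var_s - var_u + 1 - const_us c)
           * ((var_s + var_u + 2) * (var_s + var_u + const_us c + 1)))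
        ([:1, 1:] * [:3/2, 1:])" unfolding case_c_def by blast
  have h: "var_s + var_u + 2 = var_s + var_u + const_us (1 + 1)"
    "var_s + var_u + const_us c + 1 = var_s + var_u + const_us (c + 1)"
    by (simp_all add: const_us_def one_pCons numeral_poly)
  have "[:(1 + 1) / 2, 1:] = [:1, 1 :: complex:]" "[:(2 + 1) / 2, 1:] = [:3/2, 1 :: complex:]" by simp_all
  hence "f = quot_us (num_bc 1 c l) (den_bc 1)" by (simp only: f num_bc_def den_bc_def h)
  thus ?thesis using R by blast
qed

text \<open>As \<open>D\<close> has no zero at a nonnegative integer, every zero of \<open>N(n,k)\<close> with
  \<open>0 \<le> k < n\<close> contradicts the existence of a family, and every zero of
  \<open>N(n+1,n)\<close> or \<open>N(n+2,n)\<close> contradicts the finiteness of \<open>f\<^sub>1(n)\<close>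
  or \<open>f\<^sub>2(n)\<close>. The first uses the zero of \<open>A\<close> in \<open>N(i+1,0)\<close>; the
  second uses \<open>A(-1)\<close> or \<open>A(-2)\<close> for \<open>\<lambda> = 0\<close> or \<open>i \<le>
  1\<close>, and otherwise the zero of \<open>B\<close> at \<open>i - e \<ge> 1\<close>.\<close>

lemma exceptional_parameters:
  assumes e: "e = of_nat \<epsilon>" "\<epsilon> \<le> 1" and bad: "l = 0 \<or> c = - of_nat i"
    and f: "f = quot_us (num_bc e c l) (den_bc e)"
  shows "\<not> HG_well_defined R f" "\<not> (\<forall>n. f1_finite f n \<and> f2_finite f n)"
proof -
  have e01: "e = 0 \<or> e = 1" using e by (cases \<epsilon>) auto
  note D = den_bc_nat[OF e01]
  have D0: "den_bc e \<noteq> 0" using D[of 0] by auto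
  note N = eval_num_bc[of e c l]
  show "\<not> HG_well_defined R f"
  proof
    assume "HG_well_defined R f"
    then obtain P C where C: "HG_coeffs R (num_bc e c l) (den_bc e) P C"
      using HG_familyD[OF _ D0] unfolding f HG_well_defined_def by blast
    have "eval_us (num_bc e c l) (of_nat (i + 1)) (of_nat 0) \<noteq> 0"
      by (rule HG_coeffs_numerator_nonzero[OF C D]) simp
    moreover have "eval_us (num_bc e c l) (of_nat (i + 1)) (of_nat 0) = 0"
      using bad unfolding N poly_bc by auto
    ultimately show False by simp
  qed
  show "\<not> (\<forall>n. f1_finite f n \<and> f2_finite f n)"
  proof
    assume fin: "\<forall>n. f1_finite f n \<and> f2_finite f n"
    have N1: "eval_us (num_bc e c l) (of_nat n + 1) (of_nat n) \<noteq> 0" for n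
      using f1_finite_value[OF D0, of "num_bc e c l" n] fin D[of n] unfolding f by auto
    have "poly (den_bc e) (of_nat n + 1) \<noteq> 0" for n using D[of "n + 1"] by (simp add: add.commute)
    hence N2: "eval_us (num_bc e c l) (of_nat n + 2) (of_nat n) \<noteq> 0" for n
      using f2_finite_value[OF D0, of "num_bc e c l" n] fin D[of n] unfolding f by auto
    have ev: "eval_us (num_bc e c l) (w + 1) w = poly (A_bc c l) (-1) * poly (B_bc e c) (2 * w + 1)"
      "eval_us (num_bc e c l) (w + 2) w = poly (A_bc c l) (-2) * poly (B_bc e c) (2 * w + 2)" for w
      unfolding N by simp_all
    have A1: "l \<noteq> 0" "c \<noteq> 0" "c \<noteq> -1"
      using N1[of 0] N2[of 0] unfolding ev poly_bc(2) by auto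
    have B1: "poly (B_bc e c) (2 * of_nat n + 1) \<noteq> 0" and B2: "poly (B_bc e c) (2 * of_nat n + 2) \<noteq> 0" for n
      using N1[of n] N2[of n] unfolding ev by simp_all
    have c: "c = - of_nat i" using bad A1 by simp
    have "i \<ge> 2"
    proof (rule ccontr)
      assume "\<not> i \<ge> 2"
      hence "i = 0 \<or> i = 1" by linarith
      thus False using A1 c by auto
    qed
    define k where "k = i - \<epsilon>"
    have k: "i = k + \<epsilon>" "k > 0" using \<open>i \<ge> 2\<close> e(2) by (simp_all add: k_def)
    have z: "poly (B_bc e c) (of_nat k) = 0" unfolding poly_bc by (simp add: c e k)
    show False
    proof (cases "odd k")
      case True
      then obtain n where "k = 2 * n + 1" by (rule oddE)
      thus False using z B1[of n] by (simp add: add.commute)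
    next
      case False
      hence "even k" by simp
      then obtain n where "k = 2 * n" by (rule evenE)
      with k obtain n' where "k = 2 * n' + 2" by (cases n) auto
      thus False using z B2[of n'] by (simp add: add.commute)
    qed
  qed
qed

text \<open>In the variable \<open>y = 2u + c + e\<close> the recurrence coefficients are
  \<open>\<alpha>(u) + R = - 1 / (2\<lambda>(y\<^sup>2 - 1))\<close> and \<open>\<beta>(u - 1) = G(u - 1) / (4\<lambda>\<^sup>2 y (y - 1))\<close>.\<close>

lemma kernel_bc_polynomial:
  fixes u k y e c :: "'a :: field_char_0"
  assumes "y = 2 * u + c + e"
  shows "(2 * (k - 1) + 1 + e) * (2 * (k - 1) + 2 + e) * ((y - 1) * y * (y + 1))
      + 2 * y * (((k + u - 1 + 1 + e) * (k + u - 1 + c + e)) * ((k - u - 1) * (k - u - 1 + 1 - c)))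
      - (y - 1) * (((k + u + 1 + e) * (k + u + c + e)) * ((k + u - 1 + 1 + e) * (k + u - 1 + c + e)))
    = (y + 1) * (((k - u - 1) * (k - u - 1 + 1 - c)) * ((k - u) * (k - u + 1 - c)))"
  unfolding assms by algebra

lemma kernel_bc:
  assumes l: "l \<noteq> 0" and c: "c \<noteq> 0" and R: "degree R = 0"
    and nz: "poly (B_bc e c) (2 * u - 1) \<noteq> 0" "poly (B_bc e c) (2 * u) \<noteq> 0" "poly (B_bc e c) (2 * u + 1) \<noteq> 0"
  shows "kernel_poly R (den_bc e) (A_bc c l) (B_bc e c) u k =
    1 / (4 * l^2 * ((2 * u + c + e - 1) * (2 * u + c + e))) * (poly (A_bc c l) (k - u - 1) * poly (A_bc c l) (k - u))"
proof -
  define y where "y = 2 * u + c + e"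
  obtain r where r: "R = [:r:]" using R by (rule degree_eq_zeroE)
  have B: "poly (B_bc e c) (2 * u - 1) = (2 * u + e) * (y - 1)" "poly (B_bc e c) (2 * u) = (2 * u + 1 + e) * y"
    "poly (B_bc e c) (2 * u + 1) = (2 * u + 2 + e) * (y + 1)"
    unfolding poly_bc y_def by (simp_all add: algebra_simps)
  have y: "y - 1 \<noteq> 0" "y \<noteq> 0" "y + 1 \<noteq> 0" "2 * u + e \<noteq> 0" "2 * u + 1 + e \<noteq> 0" "2 * u + 2 + e \<noteq> 0"
    using nz unfolding B by simp_all
  have D: "poly (den_bc e) (u - 1) = (y - c - 1) * (2 * u + e) / 4" "poly (den_bc e) u = (y - c + 1) * (2 * u + 2 + e) / 4"
    unfolding poly_bc y_def by (simp_all add: algebra_simps)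
  have A1: "poly (A_bc c l) (-1) = l * c" unfolding poly_bc by simp
  have frac: "x * w / 4 / (p * (w * z)) = x / (4 * (p * z))" if "w \<noteq> 0" for x w p z :: complex
    using that by (simp add: ac_simps)
  have diff_of_fractions: "p / (4 * (m * a)) - q / (4 * (m * b)) = (p * b - q * a) / (4 * m * (a * b))"
    if "m \<noteq> 0" "a \<noteq> 0" "b \<noteq> 0" for p q m a b :: complex
    using that by (simp add: field_simps)
  have cancel_c: "- (2 * c) / (4 * (l * c) * z) = - (1 / (2 * l * z))" for z
    using c l by (cases "z = 0") (simp_all add: field_simps)
  have alp: "alpha_at R (den_bc e) (A_bc c l) (B_bc e c) u + poly R k = - (1 / (2 * l * ((y - 1) * (y + 1))))"
  proof -
    have "alpha_at R (den_bc e) (A_bc c l) (B_bc e c) u + poly R k =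
        (y - c - 1) / (4 * (l * c * (y - 1))) - (y - c + 1) / (4 * (l * c * (y + 1)))"
      unfolding alpha_at_def A1 B D frac[OF y(4)] frac[OF y(6)] r by simp
    also have "\<dots> = ((y - c - 1) * (y + 1) - (y - c + 1) * (y - 1)) / (4 * (l * c) * ((y - 1) * (y + 1)))"
      using diff_of_fractions[of "l * c" "y - 1" "y + 1" "y - c - 1" "y - c + 1"] l c y by (simp only: mult.assoc mult_eq_0_iff simp_thms)
    also have "(y - c - 1) * (y + 1) - (y - c + 1) * (y - 1) = - (2 * c)" by algebra
    also have "- (2 * c) / (4 * (l * c) * ((y - 1) * (y + 1))) = - (1 / (2 * l * ((y - 1) * (y + 1))))"
      by (rule cancel_c)
    finally show ?thesis .
  qed
  have g: "step_factor (den_bc e) (B_bc e c) u = 1 / (4 * (y * (y + 1)))"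
  proof -
    have yc: "y - c + 1 = 2 * u + 1 + e" by (simp add: y_def)
    have "w * x / 4 / (w * p * (x * z)) = 1 / (4 * (p * z))" if "w \<noteq> 0" "x \<noteq> 0" for w x p z :: complex
      using that by simp
    from this[OF y(5,6)] show ?thesis unfolding step_factor_def B D yc .
  qed
  define d b1 b2 a1 a2 where "d = (2 * (k - 1) + 1 + e) * (2 * (k - 1) + 2 + e)"
    and "b1 = (k + u - 1 + 1 + e) * (k + u - 1 + c + e)" and "b2 = (k + u + 1 + e) * (k + u + c + e)"
    and "a1 = (k - u - 1) * (k - u - 1 + 1 - c)" and "a2 = (k - u) * (k - u + 1 - c)"
  note ab = this
  have id: "d * ((y - 1) * y * (y + 1)) + 2 * y * (b1 * a1) - (y - 1) * (b2 * b1) = (y + 1) * (a1 * a2)"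
    unfolding ab by (rule kernel_bc_polynomial[OF y_def])
  have common_denominator: "d / 4 - (- (1 / (2 * l * (s * t)))) * b1 * (l * a1) - 1 / (4 * (y * t)) * b2 * b1 =
      (d * (s * y * t) + 2 * y * (b1 * a1) - s * (b2 * b1)) / (4 * (s * y * t))"
    if "s \<noteq> 0" "y \<noteq> 0" "t \<noteq> 0" "l \<noteq> 0" for s y t l d a1 b1 b2 :: complex
  proof -
    have "(- (1 / (2 * l * (s * t)))) * b1 * (l * a1) = - (2 * y * (b1 * a1)) / (4 * (s * y * t))"
      using that by simp
    moreover have "1 / (4 * (y * t)) * b2 * b1 = s * (b2 * b1) / (4 * (s * y * t))" using that by simp
    moreover have "d / 4 = d * (s * y * t) / (4 * (s * y * t))" using that by simp
    ultimately show ?thesis by (simp only: diff_divide_distrib add_divide_distrib minus_divide_left[symmetric]) simp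
  qed
  have cancel_denominator: "t * (a1 * a2) / (4 * (s * y * t)) = 1 / (4 * l^2 * (s * y)) * ((l * a1) * (l * a2))"
    if "s \<noteq> 0" "y \<noteq> 0" "t \<noteq> 0" "l \<noteq> 0" for s y t l a1 a2 :: complex
    using that by (simp add: power2_eq_square)
  have "kernel_poly R (den_bc e) (A_bc c l) (B_bc e c) u k =
      d / 4 - (- (1 / (2 * l * ((y - 1) * (y + 1))))) * b1 * (l * a1) - 1 / (4 * (y * (y + 1))) * b2 * b1"
    unfolding kernel_poly_def alp[unfolded add.commute[of _ "poly R k"]] g poly_bc ab by (rule refl)
  also have "\<dots> = (d * ((y - 1) * y * (y + 1)) + 2 * y * (b1 * a1) - (y - 1) * (b2 * b1)) / (4 * ((y - 1) * y * (y + 1)))"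
    by (rule common_denominator[OF y(1-3) l])
  also have "\<dots> = 1 / (4 * l^2 * ((y - 1) * y)) * ((l * a1) * (l * a2))"
    unfolding id by (rule cancel_denominator[OF y(1-3) l])
  finally show ?thesis unfolding poly_bc y_def[symmetric] ab .
qed

locale pair_bc =
  fixes R :: "complex poly" and e c l :: complex and f :: "complex poly fract poly"
  assumes e: "e = 0 \<or> e = 1" and l: "l \<noteq> 0" and c: "\<And>i::nat. c \<noteq> - of_nat i"
    and R: "degree R = 0" and f_bc: "f = quot_us (num_bc e c l) (den_bc e)"
begin

lemma c_nat: "c + of_nat i \<noteq> 0"
  using c[of i] by (simp add: eq_neg_iff_add_eq_0)

lemma B_nat:
  assumes "i > 0"
  shows "poly (B_bc e c) (of_nat i) \<noteq> 0"
proof -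
  have "of_nat i + 1 + e \<noteq> 0"
  proof -
    have "of_nat (i + 1) \<noteq> (0 :: complex)" "of_nat (i + 2) \<noteq> (0 :: complex)" by (simp_all only: of_nat_eq_0_iff)
    thus ?thesis using e by (auto simp: algebra_simps)
  qed
  moreover have "of_nat i + c + e \<noteq> 0" using e c_nat[of i] c_nat[of "i + 1"] by (auto simp: algebra_simps)
  ultimately show ?thesis unfolding poly_bc by simp
qed

sublocale factored_pair R "den_bc e" "A_bc c l" "B_bc e c" "num_bc e c l" f
proof
  show "f = quot_us (num_bc e c l) (den_bc e)" by (rule f_bc)
  show "den_bc e \<noteq> 0" using den_bc_nat[OF e, of 0] by auto
  show "poly (den_bc e) (-1) = 0" using e unfolding poly_bc by auto
  show "\<exists>a. a \<noteq> 0 \<and> lead_coeff (num_bc e c l) = [:a:]" using l lead_num_bc by blast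
  show "eval_us (num_bc e c l) u s = poly (A_bc c l) (s - u) * poly (B_bc e c) (s + u)" for u s
    by (rule eval_num_bc)
  show "poly (A_bc c l) 0 = 0" unfolding poly_bc by simp
  show "poly (A_bc c l) (- of_nat i) \<noteq> 0" if "i > 0" for i :: nat
  proof -
    have x: "- of_nat i + 1 - c = - (c + of_nat (i - 1))" using that by (simp add: of_nat_diff)
    have "i \<noteq> 0" using that by simp
    thus ?thesis unfolding poly_bc x using l c_nat[of "i - 1"]
      by (simp only: mult_eq_0_iff neg_equal_0_iff_equal of_nat_eq_0_iff simp_thms)
  qed
  show "B_bc e c \<noteq> 0" using B_nat[of 1] by auto
  show "\<exists>K. \<forall>k. kernel_poly R (den_bc e) (A_bc c l) (B_bc e c) u k =
      K * (poly (A_bc c l) (k - u - 1) * poly (A_bc c l) (k - u))"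
    if "poly (B_bc e c) (2 * u - 1) \<noteq> 0" "poly (B_bc e c) (2 * u) \<noteq> 0" "poly (B_bc e c) (2 * u + 1) \<noteq> 0" for u
  proof -
    have "c \<noteq> 0" using c_nat[of 0] by simp
    from kernel_bc[OF l this R that] show ?thesis by blast
  qed
qed

lemma regular_bc: regular
  unfolding regular_def using B_nat by blast

text \<open>The kernel polynomial is evaluated at \<open>k = 0\<close>, where the two values of
  \<open>A\<close> cancel.\<close>

lemma beta_nonzero_bc:
  assumes m: "m > 0"
  shows "rat_val (beta_fun R f) (of_nat m) \<noteq> 0"
proof -
  have nz: "poly (B_bc e c) (2 * of_nat m) \<noteq> 0" "poly (B_bc e c) (2 * of_nat m + 1) \<noteq> 0"
    "poly (B_bc e c) (2 * of_nat m + 2) \<noteq> 0" "poly (B_bc e c) (2 * of_nat m + 3) \<noteq> 0"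
    using B_nat[of "2 * m"] B_nat[of "2 * m + 1"] B_nat[of "2 * m + 2"] B_nat[of "2 * m + 3"] m
    by (simp_all add: algebra_simps)
  let ?u = "of_nat (m + 1) :: complex"
  have nzB: "poly (B_bc e c) (2 * ?u + 1 - of_nat j) \<noteq> 0" if "j \<le> (3::nat)" for j
  proof -
    have x: "2 * ?u + 1 - of_nat j = of_nat (2 * m + 3 - j)" using that by (simp add: of_nat_diff)
    show ?thesis unfolding x by (rule B_nat) (use m that in simp)
  qed
  have e': "?u - 1 = of_nat m" "- ?u - 1 = - of_nat (m + 2)" "0 - ?u = - of_nat (m + 1)"
    "2 * ?u - 1 = 2 * of_nat m + 1" "2 * ?u = 2 * of_nat m + 2" "2 * of_nat m + 2 + 1 = 2 * of_nat m + (3::complex)"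
    by simp_all
  have x: "2 * ?u - 1 = of_nat (2 * m + 1)" "2 * ?u = of_nat (2 * m + 2)" "2 * ?u + 1 = of_nat (2 * m + 3)" by simp_all
  have nzu: "poly (B_bc e c) (2 * ?u - 1) \<noteq> 0" "poly (B_bc e c) (2 * ?u) \<noteq> 0" "poly (B_bc e c) (2 * ?u + 1) \<noteq> 0"
    unfolding x(1) x(3) by (rule B_nat, simp, unfold x(2), rule B_nat, simp, rule B_nat, simp)
  have A2: "poly (A_bc c l) (- of_nat (m + 2)) * poly (A_bc c l) (- of_nat (m + 1)) \<noteq> 0"
    using A[of "m + 2"] A[of "m + 1"] by simp
  have c0: "c \<noteq> 0" using c_nat[of 0] by simp
  have y: "2 * of_nat m + 2 + c + e - 1 \<noteq> 0" "2 * of_nat m + 2 + c + e \<noteq> 0"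
  proof -
    have x: "2 * of_nat m + 2 + c + e - 1 = 2 * of_nat m + 1 + c + e" by simp
    show "2 * of_nat m + 2 + c + e - 1 \<noteq> 0" "2 * of_nat m + 2 + c + e \<noteq> 0"
      unfolding x using nz(2,3) unfolding poly_bc by (simp_all only: mult_eq_0_iff de_Morgan_disj not_False_eq_True)
  qed
  have "bet (?u - 1) * (poly (A_bc c l) (0 - ?u - 1) * poly (A_bc c l) (0 - ?u)) =
      G (?u - 1) * kernel_poly R (den_bc e) (A_bc c l) (B_bc e c) ?u 0"
    by (rule bet_kernel) (rule nzB)
  also have "kernel_poly R (den_bc e) (A_bc c l) (B_bc e c) ?u 0 = 1 / (4 * l^2 * ((2 * ?u + c + e - 1) * (2 * ?u + c + e))) *
     (poly (A_bc c l) (0 - ?u - 1) * poly (A_bc c l) (0 - ?u))"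
    by (rule kernel_bc[OF l c0 R nzu])
  finally have "bet (of_nat m) * (poly (A_bc c l) (- of_nat (m + 2)) * poly (A_bc c l) (- of_nat (m + 1))) =
     (G (of_nat m) * (1 / (4 * l^2 * ((2 * of_nat m + 2 + c + e - 1) * (2 * of_nat m + 2 + c + e))))) *
     (poly (A_bc c l) (- of_nat (m + 2)) * poly (A_bc c l) (- of_nat (m + 1)))"
    unfolding e' by (simp only: mult.assoc)
  hence "bet (of_nat m) = G (of_nat m) * (1 / (4 * l^2 * ((2 * of_nat m + 2 + c + e - 1) * (2 * of_nat m + 2 + c + e))))"
    using A2 by (simp only: mult_cancel_right simp_thms)
  moreover have "G (of_nat m) \<noteq> 0"
    using den_bc_nat[OF e, of m] nz unfolding step_factor_def by simp
  ultimately have "bet (of_nat m) \<noteq> 0" using y l by simp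
  thus ?thesis using beta_fun_at(2)[OF nz] by simp
qed

end

section \<open>Classification of the listed pairs\<close>

text \<open>At \<open>n = 0\<close> nothing was removed from \<open>\<alpha>(0)\<close> and
  \<open>\<beta>(0)\<close>. This fails for instance for the Chebyshev polynomials of the first kind, whose
  \<open>\<beta>\<^sub>0\<close> differs from the constant value of \<open>\<beta>\<^sub>n\<close>.\<close>

definition boundary_regular :: "complex poly \<Rightarrow> complex poly fract poly \<Rightarrow> bool" where
  "boundary_regular R f \<longleftrightarrow> alpha R f 0 = rat_val (alpha_fun R f) 0 \<and> beta R f 0 = rat_val (beta_fun R f) 0"

definition symmetric_beta :: "complex poly \<Rightarrow> complex poly fract poly \<Rightarrow> complex \<Rightarrow> bool" where
  "symmetric_beta R f t \<longleftrightarrow> (\<exists>c d. c \<noteq> 0 \<and> d \<noteq> 0 \<and>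
     (\<forall>w. \<forall>\<^sub>F u in at w. rat_val (beta_fun R f) u = symmetric_form c t (poly d) u))"

definition exceptional_pair :: "complex poly \<Rightarrow> complex poly fract poly \<Rightarrow> bool" where
  "exceptional_pair R f \<longleftrightarrow> \<not> HG_well_defined R f \<and> \<not> (\<forall>n. f1_finite f n \<and> f2_finite f n)"

text \<open>The last condition lists the possible behaviour at \<open>n = 0\<close>: the removed terms vanish
  except possibly in case (b), where \<open>\<beta>\<close> has no zero at a positive integer, and in case (a)
  with \<open>q(0) = 0\<close> or \<open>q(-1) = 0\<close>.\<close>

definition regular_pair :: "complex poly \<Rightarrow> complex poly fract poly \<Rightarrow> bool" where
  "regular_pair R f \<longleftrightarrow> (\<forall>n. f1_finite f n \<and> f2_finite f n) \<and> HG_well_defined R f \<and>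
     (\<forall>P. HG_family R f P \<longleftrightarrow> three_term (alpha R f) (beta R f) P) \<and>
     (boundary_regular R f \<or> (\<forall>m>0. rat_val (beta_fun R f) (of_nat m) \<noteq> 0) \<or>
      symmetric_beta R f 0 \<or> symmetric_beta R f (-1))"

text \<open>The case \<open>q(m) = 0\<close> of (a): the families of such a pair may differ up to row
  \<open>m\<close>; beyond it they agree, and none of them is quasi-orthogonal.\<close>

definition cut_pair :: "nat \<Rightarrow> complex poly \<Rightarrow> complex poly fract poly \<Rightarrow> bool" where
  "cut_pair m R f \<longleftrightarrow> m > 0 \<and> beta R f m = 0 \<and> symmetric_beta R f (of_nat m) \<and>
     (\<forall>P. HG_family R f P \<longrightarrow> \<not> quasi_orthogonal P) \<and>
     (\<forall>P Q n. HG_family R f P \<longrightarrow> HG_family R f Q \<longrightarrow> n > m \<longrightarrow> P n = Q n) \<and>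
     (HG_well_defined R f \<longrightarrow> boundary_regular R f \<and>
        (\<exists>P. HG_family R f P \<and> three_term (alpha R f) (beta R f) P))"

lemma (in factored_pair) regular_pairI:
  assumes "regular"
    and "boundary_regular R f \<or> (\<forall>m>0. rat_val (beta_fun R f) (of_nat m) \<noteq> 0) \<or>
      symmetric_beta R f 0 \<or> symmetric_beta R f (-1)"
  shows "regular_pair R f"
  using assms canonical_family[OF regular_limits[OF assms(1)]] regular_HG_iff[OF assms(1)]
  unfolding regular_pair_def HG_well_defined_def by blast

lemma (in pair_a) pair_a_cases: "regular_pair R f \<or> (\<exists>m. cut_pair m R f)"
proof (cases "regular")
  case True
  have "boundary_regular R f \<or> symmetric_beta R f 0 \<or> symmetric_beta R f (-1)"
  proof (cases "poly q 0 = 0 \<or> poly q (-1) = 0")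
    case True
    thus ?thesis using beta_fun_symmetric unfolding symmetric_beta_def by blast
  next
    case False
    thus ?thesis using regular_boundary_values[OF \<open>regular\<close>] unfolding boundary_regular_def by blast
  qed
  thus ?thesis using regular_pairI[OF True] by blast
next
  case False
  then obtain m where m: "m > 0" "poly q (of_nat m) = 0" unfolding regular_def by blast
  have "cut_pair m R f" unfolding cut_pair_def
  proof (intro conjI allI impI)
    show "symmetric_beta R f (of_nat m)" using beta_fun_symmetric[OF m(2)] unfolding symmetric_beta_def .
    show "\<not> quasi_orthogonal P" if "HG_family R f P" for P using not_quasi_orthogonal[OF m that] .
    show "P n = Q n" if "HG_family R f P" "HG_family R f Q" "n > m" for P Q n
      using degenerate_rows_unique[OF m that] .
    assume "HG_well_defined R f"
    then obtain P where P: "HG_family R f P" unfolding HG_well_defined_def by blast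
    show "boundary_regular R f"
      using degenerate_boundary_values[OF m P] unfolding boundary_regular_def by blast
    show "\<exists>P. HG_family R f P \<and> three_term (alpha R f) (beta R f) P"
      using canonical_family[OF degenerate_limits[OF m P]] by blast
  qed (use m beta_m in auto)
  thus ?thesis by blast
qed

lemma exceptional_zero: "exceptional_pair R 0"
proof -
  have "diag_shift 1 0 = 0" by (simp add: diag_shift_def)
  thus ?thesis unfolding exceptional_pair_def HG_well_defined_def f1_finite_def
    using not_HG_zero by blast
qed

lemma listed_bc_cases:
  assumes e: "e = of_nat \<epsilon>" "\<epsilon> \<le> 1" and R: "degree R = 0"
    and f: "f = quot_us (num_bc e c l) (den_bc e)"
  shows "exceptional_pair R f \<or> regular_pair R f"
proof (cases "l = 0 \<or> (\<exists>i::nat. c = - of_nat i)")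
  case True
  then obtain i :: nat where "l = 0 \<or> c = - of_nat i" by blast
  from exceptional_parameters[OF e this f] show ?thesis unfolding exceptional_pair_def by blast
next
  case False
  interpret pair_bc R e c l f
    using False e R f by unfold_locales (auto simp: le_Suc_eq)
  show ?thesis using regular_pairI[OF regular_bc] beta_nonzero_bc by blast
qed

lemma listed_cases:
  assumes "listed R f"
  shows "exceptional_pair R f \<or> regular_pair R f \<or> (\<exists>m. cut_pair m R f)"
proof -
  consider "case_a R f" | "case_b R f" | "case_c R f" using assms unfolding listed_def by blast
  thus ?thesis
  proof cases
    case 1
    then obtain q v where qv: "degree R \<le> 2" "degree q \<le> 1" "degree v \<le> 1" "den_a R q v \<noteq> 0"
      "f = quot_us (num_a q) (den_a R q v)" unfolding case_a_def num_a_def by blast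
    show ?thesis
    proof (cases "q = 0")
      case True
      hence "f = 0" using qv(5) by (simp add: num_a_def subst_us_def quot_us_def)
      thus ?thesis using exceptional_zero by blast
    next
      case False
      interpret pair_a R q v f using qv False by unfold_locales
      show ?thesis using pair_a_cases by blast
    qed
  next
    case 2
    thus ?thesis using case_b_num[of R f] listed_bc_cases[of 0 0 R f] by auto
  next
    case 3
    thus ?thesis using case_c_num[of R f] listed_bc_cases[of 1 1 R f] by auto
  qed
qed

text \<open>\<open>\<beta>\<close> vanishes at \<open>m > 0\<close> and is symmetric about \<open>(m -
  1)/2\<close>. Each way in which the other pair could fail to be regular at \<open>n = 0\<close> is
  incompatible with this.\<close>

lemma boundary_from_cut:
  assumes cut: "cut_pair m R f" and reg: "regular_pair R' f'" and eq: "beta_fun R f = beta_fun R' f'"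
  shows "boundary_regular R' f'"
proof (rule ccontr)
  assume "\<not> boundary_regular R' f'"
  hence "(\<forall>m>0. rat_val (beta_fun R' f') (of_nat m) \<noteq> 0) \<or> symmetric_beta R' f' 0 \<or> symmetric_beta R' f' (-1)"
    using reg unfolding regular_pair_def by blast
  moreover have m: "m > 0" "rat_val (beta_fun R f) (of_nat m) = 0" and sym: "symmetric_beta R f (of_nat m)"
    using cut by (auto simp: cut_pair_def beta_def)
  moreover have False if h: "symmetric_beta R' f' (of_nat m - of_nat p)" "p = m \<or> p = m + 1" for p
  proof -
    obtain c d where cd: "c \<noteq> 0" "d \<noteq> 0"
      "\<And>w. \<forall>\<^sub>F u in at w. rat_val (beta_fun R f) u = symmetric_form c (of_nat m) (poly d) u"
      using sym unfolding symmetric_beta_def by blast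
    obtain c' d' where cd': "\<And>w. \<forall>\<^sub>F u in at w. rat_val (beta_fun R f) u =
        symmetric_form c' (of_nat m - of_nat p) (poly d') u"
      using h(1) unfolding symmetric_beta_def eq by blast
    show False by (rule no_two_symmetric_forms[OF m(1) h(2) cd cd'])
  qed
  from this[of m] this[of "m + 1"] have "\<not> symmetric_beta R' f' 0" "\<not> symmetric_beta R' f' (-1)" by auto
  ultimately show False unfolding eq by blast
qed

lemma well_defined_tail:
  assumes "regular_pair R f \<or> (\<exists>m. cut_pair m R f)" "HG_well_defined R f"
  shows "\<exists>m P. HG_family R f P \<and> three_term (alpha R f) (beta R f) P \<and>
    (\<forall>Q n. HG_family R f Q \<longrightarrow> n > m \<longrightarrow> Q n = P n)"
  using assms(1)
proof
  assume r: "regular_pair R f"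
  obtain P where P: "HG_family R f P" using assms(2) unfolding HG_well_defined_def by blast
  have "three_term (alpha R f) (beta R f) P" using r P unfolding regular_pair_def by blast
  moreover have "Q = P" if "HG_family R f Q" for Q
    using r P that three_term_unique unfolding regular_pair_def by blast
  ultimately show ?thesis using P by blast
next
  assume "\<exists>m. cut_pair m R f"
  thus ?thesis using assms(2) unfolding cut_pair_def by blast
qed

text \<open>For large \<open>n\<close> the members of the common family obey both recurrences, and two
  rational functions that agree at infinitely many integers are equal.\<close>

lemma coefficient_functions_eq:
  assumes P: "regular_pair R f \<or> (\<exists>m. cut_pair m R f)" "HG_family R f Q"
    and P': "regular_pair R' f' \<or> (\<exists>m. cut_pair m R' f')" "HG_family R' f' Q"
  shows "alpha_fun R f = alpha_fun R' f'" "beta_fun R f = beta_fun R' f'"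
proof -
  have wd: "HG_well_defined R f" "HG_well_defined R' f'" using P(2) P'(2) unfolding HG_well_defined_def by blast+
  obtain m S where S: "three_term (alpha R f) (beta R f) S" "\<And>n. n > m \<Longrightarrow> Q n = S n"
    using well_defined_tail[OF P(1) wd(1)] P(2) by blast
  obtain m' S' where S': "three_term (alpha R' f') (beta R' f') S'" "\<And>n. n > m' \<Longrightarrow> Q n = S' n"
    using well_defined_tail[OF P'(1) wd(2)] P'(2) by blast
  have fam: "poly_family Q" using P(2) unfolding HG_family_def by blast
  have eq: "alpha R f (n + 1) = alpha R' f' (n + 1) \<and> beta R f n = beta R' f' n" if n: "n > max m m'" for n
  proof -
    have "[:- alpha R f (n + 1), 1:] * Q (n + 1) - smult (beta R f n) (Q n) = Q (n + 2)"
      using S n by (simp add: three_term_def)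
    moreover have "[:- alpha R' f' (n + 1), 1:] * Q (n + 1) - smult (beta R' f' n) (Q n) = Q (n + 2)"
      using S' n by (simp add: three_term_def)
    ultimately show ?thesis using recurrence_step_unique[OF fam] by metis
  qed
  define I where "I = (of_nat :: nat \<Rightarrow> complex) ` {max m m' + 1 <..}"
  have "infinite I" unfolding I_def
    by (subst finite_image_iff) (auto simp: inj_on_def infinite_Ioi)
  have "rat_val (alpha_fun R f) z = rat_val (alpha_fun R' f') z \<and>
      rat_val (beta_fun R f) z = rat_val (beta_fun R' f') z" if zI: "z \<in> I" for z
  proof -
    obtain n where n: "z = of_nat n" "n > max m m' + 1" using zI by (auto simp: I_def)
    then obtain k where k: "n = k + 1" "k > max m m'" by (cases n) auto
    have "alpha R f n = alpha R' f' n" using eq[OF k(2)] k(1) by simp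
    moreover have "beta R f n = beta R' f' n" using eq[of n] k by simp
    ultimately show ?thesis using n by (simp add: alpha_def beta_def)
  qed
  hence sub: "I \<subseteq> {z. rat_val (alpha_fun R f) z = rat_val (alpha_fun R' f') z}"
    "I \<subseteq> {z. rat_val (beta_fun R f) z = rat_val (beta_fun R' f') z}" by auto
  show "alpha_fun R f = alpha_fun R' f'" "beta_fun R f = beta_fun R' f'"
    by (rule rat_fun_eqI, rule infinite_super[OF _ \<open>infinite I\<close>], rule sub)+
qed

lemma same_family_coeffs:
  assumes P: "regular_pair R f \<or> (\<exists>m. cut_pair m R f)" "HG_family R f Q"
    and P': "regular_pair R' f' \<or> (\<exists>m. cut_pair m R' f')" "HG_family R' f' Q"
  shows "alpha R f n = alpha R' f' n \<and> beta R f n = beta R' f' n"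
proof (cases "regular_pair R f \<and> regular_pair R' f'")
  case True
  have "poly_family Q" using P(2) unfolding HG_family_def by blast
  moreover have "three_term (alpha R f) (beta R f) Q" "three_term (alpha R' f') (beta R' f') Q"
    using True P(2) P'(2) unfolding regular_pair_def by blast+
  ultimately show ?thesis using three_term_coeffs_unique by blast
next
  case False
  note eq = coefficient_functions_eq[OF P P']
  have cutb: "boundary_regular R f" if "cut_pair m R f" "HG_family R f P" for m R f P
    using that unfolding cut_pair_def HG_well_defined_def by blast
  have "boundary_regular R f \<and> boundary_regular R' f'"
  proof (cases "regular_pair R f")
    case True
    then obtain m where m: "cut_pair m R' f'" using False P'(1) by blast
    show ?thesis using boundary_from_cut[OF m True eq(2)[symmetric]] cutb[OF m P'(2)] by blast
  next
    case nr: False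
    then obtain m where m: "cut_pair m R f" using P(1) by blast
    have "boundary_regular R' f'"
      using P'(1) boundary_from_cut[OF m _ eq(2)] cutb[OF _ P'(2)] by blast
    thus ?thesis using cutb[OF m P(2)] by blast
  qed
  thus ?thesis by (cases "n = 0") (simp_all add: boundary_regular_def eq alpha_def beta_def)
qed

theorem corollary3:
  fixes R :: "complex poly" and f :: "complex poly fract poly"
  assumes "listed R f"
  shows
    "((\<exists>P. HG_family R f P \<and> quasi_orthogonal P) \<longleftrightarrow>
        (\<forall>n. f1_finite f n \<and> f2_finite f n \<and> beta R f n \<noteq> 0)) \<and>
     ((\<exists>P. HG_family R f P \<and> orthogonal_family P) \<longleftrightarrow>
        (\<forall>n. f1_finite f n \<and> f2_finite f n \<and>
             alpha R f n \<in> \<real> \<and> beta R f n \<in> \<real> \<and> Re (beta R f n) > 0)) \<and>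
     (\<forall>R' f'. listed R' f' \<longrightarrow> HG_well_defined R f \<longrightarrow> HG_well_defined R' f' \<longrightarrow>
        ((\<exists>P. HG_family R f P \<and> HG_family R' f' P) \<longleftrightarrow>
         (\<forall>n. alpha R f n = alpha R' f' n \<and> beta R f n = beta R' f' n)))"
proof -
  consider (exceptional) "exceptional_pair R f" | (regular) "regular_pair R f" | (cut) m where "cut_pair m R f"
    using listed_cases[OF assms] by blast
  hence "((\<exists>P. HG_family R f P \<and> quasi_orthogonal P) \<longleftrightarrow>
        (\<forall>n. f1_finite f n \<and> f2_finite f n \<and> beta R f n \<noteq> 0)) \<and>
     ((\<exists>P. HG_family R f P \<and> orthogonal_family P) \<longleftrightarrow>
        (\<forall>n. f1_finite f n \<and> f2_finite f n \<and>
             alpha R f n \<in> \<real> \<and> beta R f n \<in> \<real> \<and> Re (beta R f n) > 0))"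
  proof cases
    case exceptional
    thus ?thesis unfolding exceptional_pair_def HG_well_defined_def by blast
  next
    case regular
    obtain P where P: "HG_family R f P" "three_term (alpha R f) (beta R f) P"
      using regular unfolding regular_pair_def HG_well_defined_def by blast
    have unique: "Q = P" if "HG_family R f Q" for Q
      using regular that P(2) three_term_unique unfolding regular_pair_def by blast
    have fin: "f1_finite f n" "f2_finite f n" for n using regular unfolding regular_pair_def by blast+
    show ?thesis using P(1) unique fin quasi_orthogonal_iff[OF P(2)] orthogonal_family_iff[OF P(2)] by blast
  next
    case cut
    have "beta R f m = 0" "Re (beta R f m) = 0" using cut by (auto simp: cut_pair_def)
    moreover have "\<not> quasi_orthogonal P" if "HG_family R f P" for P using cut that unfolding cut_pair_def by blast
    moreover have "quasi_orthogonal P" if "orthogonal_family P" for P using that unfolding orthogonal_family_def by blast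
    ultimately show ?thesis by (metis less_irrefl)
  qed
  moreover have "(\<exists>P. HG_family R f P \<and> HG_family R' f' P) \<longleftrightarrow>
         (\<forall>n. alpha R f n = alpha R' f' n \<and> beta R f n = beta R' f' n)"
    if l: "listed R' f'" and wd: "HG_well_defined R f" "HG_well_defined R' f'" for R' f'
  proof
    have c: "regular_pair R f \<or> (\<exists>m. cut_pair m R f)" "regular_pair R' f' \<or> (\<exists>m. cut_pair m R' f')"
      using listed_cases[OF assms] listed_cases[OF l] wd unfolding exceptional_pair_def by blast+
    { assume "\<exists>P. HG_family R f P \<and> HG_family R' f' P"
      thus "\<forall>n. alpha R f n = alpha R' f' n \<and> beta R f n = beta R' f' n"
        using same_family_coeffs[OF c(1) _ c(2)] by blast }
    assume eq: "\<forall>n. alpha R f n = alpha R' f' n \<and> beta R f n = beta R' f' n"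
    hence "alpha R f = alpha R' f'" "beta R f = beta R' f'" by auto
    moreover obtain P where P: "HG_family R f P" "three_term (alpha R f) (beta R f) P"
      using well_defined_tail[OF c(1) wd(1)] by blast
    moreover obtain P' where P': "HG_family R' f' P'" "three_term (alpha R' f') (beta R' f') P'"
      using well_defined_tail[OF c(2) wd(2)] by blast
    ultimately have "P = P'" using three_term_unique by metis
    thus "\<exists>P. HG_family R f P \<and> HG_family R' f' P" using P P' by blast
  qed
  ultimately show ?thesis by blast
qed

end
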